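(* There is a universal constant $c>0$ such that the following holds. Let $N\ge 2$, $n\in[N]$, and let $I_1,\dots,I_N,R_1,\dots,R_N\ge1$ be integers with $R_0=R_N$. Let $\mathcal{X}\in\mathbb{R}^{I_1\times\cdots\times I_N}$ be a tensor with mode-$n$ unfolding $X_{[n]}\in\mathbb{R}^{I_n\times\prod_{j\ne n}I_j}$, let $\mathcal{G}^{(j)}\in\mathbb{R}^{R_{j-1}\times I_j\times R_j}$ for $j\in[N]\setminus\{n\}$ be core tensors, and let $G_{[2]}^{\ne n}\in\mathbb{R}^{(\prod_{j\ne n}I_j)\times R_{n-1}R_n}$ be the mode-2 unfolding of the subchain tensor $\mathcal{G}^{\ne n}$, assumed nonzero. Let $w=(n-1,\dots,1,N,\dots,n+1)$ and $\varepsilon,\delta\in(0,1)$. Let $\Psi\in\mathbb{R}^{J_1\times\prod_{j\ne n}I_j}$ be a $(J_1,(I_{w(j)})_{j=1}^{N-1})$-recursive sketch, let $\Psi G_{[2]}^{\ne n}=U_1\Sigma_1V_1^\top$ be a compact SVD, and let $\tilde\ell_i(G_{[2]}^{\ne n})=\|e_i^\top G_{[2]}^{\ne n}V_1\Sigma_1^{-1}\|_2^2$ for $i\in[\prod_{j\ne n}I_j]$. Let $S\in\mathbb{R}^{J_2\times\prod_{j\ne n}I_j}$ be a sampling matrix with parameters $(J_2,q)$ (drawn, given $\Psi$, with fresh independent randomness), where $q$ is the probability distribution with $q(i)\propto\tilde\ell_i(G_{[2]}^{\ne n})$. If $$J_1\ge c\,N(R_{n-1}R_n)^2/\delta,\qquad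 J_2\ge c\,R_{n-1}R_n\max\big(\log(R_{n-1}R_n/\delta),\,1/(\varepsilon\delta)\big),$$ then $\tilde G\in\operatorname{arg\,min}_{G\in\mathbb{R}^{I_n\times R_{n-1}R_n}}\|S G_{[2]}^{\ne n}G^\top - S X_{[n]}^\top\|_F$ satisfies, with probability at least $1-\delta$, $$\|G_{[2]}^{\ne n}\tilde G^\top - X_{[n]}^\top\|_F\le(1+\varepsilon)\min_{G\in\mathbb{R}^{I_n\times R_{n-1}R_n}}\|G_{[2]}^{\ne n}G^\top - X_{[n]}^\top\|_F.$$
   Context: Notation: $[k]=\{1,\dots,k\}$; $e_i$ is the $i$th canonical basis vector; $\otimes$ is the Kronecker product. For $i_1\in[I_1],\dots,i_M\in[I_M]$, $\overline{i_1\cdots i_M}=1+\sum_{k=1}^M(i_k-1)\prod_{j=1}^{k-1}I_j$ (similarly for any list of indices with given ranges; the first listed index varies fastest). The mode-$n$ unfolding of an $N$-way tensor is $X_{[n]}(i_n,\overline{i_{n+1}\cdots i_Ni_1\cdots i_{n-1}})=\mathcal{X}(i_1,\dots,i_N)$. A compact SVD $A=U\Sigma V^\top$ has $\Sigma\in\mathbb{R}^{\operatorname{rank}(A)\times\operatorname{rank}(A)}$ and $U,V$ with $\operatorname{rank}(A)$ orthonormal columns. Subchain tensor: $\mathcal{G}^{\ne n}\in\mathbb{R}^{R_n\times(\prod_{j\ne n}I_j)\times R_{n-1}}$ is $$\mathcal{G}^{\ne n}(r_n,\overline{i_{n+1}\cdots i_Ni_1\cdots i_{n-1}},r_{n-1})=\sum_{\{r_j\}_{j\ne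 n-1,n}}\ \prod_{j\in[N],\,j\ne n}\mathcal{G}^{(j)}(r_{j-1},i_j,r_j),$$ where $r_j\in[R_j]$, indices of $r$ are read cyclically ($r_0=r_N$), and the sum is over all $r_j$ other than $r_{n-1}$ and $r_n$. Thus the row index of $G^{\ne n}_{[2]}$ is $\overline{i_{n+1}\cdots i_Ni_1\cdots i_{n-1}}$ and its column index is $\overline{r_{n-1}r_n}$. Sampling matrix: given a probability distribution $q$ on $[I]$, let $f:[J]\to[I]$ be random with $f(1),\dots,f(J)$ independent and distributed according to $q$; the sampling matrix with parameters $(J,q)$ is $S\in\mathbb{R}^{J\times I}$, $S(j,i)=\mathbf{1}\{f(j)=i\}/\sqrt{J\,q(f(j))}$. If $\tilde\ell_i(G_{[2]}^{\ne n})=0$ for all $i$ (i.e. $\Psi G_{[2]}^{\ne n}=0$), $q$ is taken to be an arbitrary fixed distribution, e.g. uniform. $k$-wise independence: a random function $h:[I]\to B$ ($B$ finite) is $k$-wise independent if for any $k$ distinct $i_1,\dots,i_k\in[I]$ (for all elements of $[I]$ if $I<k$) the values $h(i_1),\dots,h(i_k)$ are independent and uniform on $B$. CountSketch: with $h:[I]\to[J]$ 3-wise independent and $s:[I]\to\{-1,+1\}$ 4-wise independent ($h,s$ independent of each other), it is the matrix $C\in\mathbb{R}^{J\times I}$ with $C(j,i)=s(i)\mathbf{1}\{h(i)=j\}$. Degree-two TensorSketch: with $h_1,h_2:[I]\to[J]$ 3-wise independent and $s_1,s_2:[I]\to\{-1,+1\}$ 4-wise independent (all four mutually independent) and $h(i_1,i_2)=((h_1(i_1)+h_2(i_2))\bmod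 J)+1$, it is the matrix $T\in\mathbb{R}^{J\times I^2}$ with $T(j,\overline{i_1i_2})=s_1(i_1)s_2(i_2)\mathbf{1}\{h(i_1,i_2)=j\}$. Recursive sketch: let $J,I_1,\dots,I_M$ be positive integers. If $M=2^q$, the $(J,(I_k)_{k=1}^M)$-recursive sketch is the random matrix $\Psi_{J,(I_k)_{k=1}^M}=T^{(q)}T^{(q-1)}\cdots T^{(1)}C\in\mathbb{R}^{J\times\prod_kI_k}$, where $C=C_1\otimes\cdots\otimes C_M$ with $C_k\in\mathbb{R}^{J\times I_k}$ CountSketches, and $T^{(m)}=T^{(m)}_1\otimes\cdots\otimes T^{(m)}_{2^{q-m}}$ with $T^{(m)}_k\in\mathbb{R}^{J\times J^2}$ degree-two TensorSketches, all the $C_k$ and $T^{(m)}_k$ being mutually independent. If $M$ is not a power of 2, put $q=\lceil\log_2M\rceil$, $I_{\max}=\max_{k\in[M]}I_k$, $\tilde I_k=I_k$ for $k\le M$, $\tilde I_k=I_{\max}$ for $M<k\le2^q$, and define $\Psi_{J,(I_k)_{k=1}^M}x=\Psi_{J,(\tilde I_k)_{k=1}^{2^q}}(x\otimes e_1^{\otimes(2^q-M)})$ with $e_1\in\mathbb{R}^{I_{\max}}$. *)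

theory Defs
  imports
    "HOL-Probability.Probability"
    "Jordan_Normal_Form.DL_Rank"
    "Jordan_Normal_Form.Gauss_Jordan_Elimination"
begin

text \<open>Indices inside a mode, rows and columns are zero-based; the modes of an \<open>N\<close>-way tensor
  are numbered \<open>1, \<dots>, N\<close>. A tensor is a real function of a multi-index \<open>i\<close>, where \<open>i j\<close> is the
  index in mode \<open>j\<close>; only its values on \<open>PiE {1..N} (\<lambda>j. {..<I j})\<close> are used.\<close>

section \<open>Tensors\<close>

text \<open>For \<open>js = [j\<^sub>1, \<dots>, j\<^sub>M]\<close>, the grouping of the indices \<open>i j\<^sub>1, \<dots>, i j\<^sub>M\<close> into one index,
  the first listed index varying fastest.\<close>

definition lin_idx :: "(nat \<Rightarrow> nat) \<Rightarrow> nat list \<Rightarrow> (nat \<Rightarrow> nat) \<Rightarrow> nat" where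
  "lin_idx I js i = (\<Sum>k<length js. i (js ! k) * (\<Prod>l<k. I (js ! l)))"

definition multi_idx :: "(nat \<Rightarrow> nat) \<Rightarrow> nat list \<Rightarrow> nat \<Rightarrow> nat \<Rightarrow> nat" where
  "multi_idx I js = inv_into (PiE (set js) (\<lambda>j. {..<I j})) (lin_idx I js)"

lemma lin_idx_append:
  "lin_idx I (js @ [j]) i = lin_idx I js i + i j * (\<Prod>l<length js. I (js ! l))"
proof -
  have "(\<Prod>l<k. I ((js @ [j]) ! l)) = (\<Prod>l<k. I (js ! l))" if "k \<le> length js" for k
    using that by (intro prod.cong) (auto simp: nth_append)
  then show ?thesis
    unfolding lin_idx_def by (auto simp: nth_append intro!: sum.cong)
qed

lemma prod_nth_distinct:
  fixes I :: "nat \<Rightarrow> nat"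
  assumes "distinct js"
  shows "(\<Prod>l<length js. I (js ! l)) = (\<Prod>j\<in>set js. I j)"
  using assms by (simp add: prod.distinct_set_conv_list prod.list_conv_set_nth atLeast0LessThan)

lemma lin_idx_less:
  assumes "distinct js" "\<And>j. j \<in> set js \<Longrightarrow> i j < I j"
  shows "lin_idx I js i < (\<Prod>j\<in>set js. I j)"
  using assms
proof (induction js rule: rev_induct)
  case Nil
  then show ?case by (simp add: lin_idx_def)
next
  case (snoc j js)
  let ?P = "\<Prod>j\<in>set js. I j"
  have "lin_idx I js i < ?P" and "Suc (i j) \<le> I j"
    using snoc by (auto simp: Suc_le_eq)
  then have "lin_idx I js i + i j * ?P < I j * ?P"
    using mult_le_mono1[of "Suc (i j)" "I j" ?P] by simp
  then show ?case
    using snoc.prems by (simp add: lin_idx_append prod_nth_distinct)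
qed

lemma lin_idx_inj:
  assumes "distinct js" "\<And>j. j \<in> set js \<Longrightarrow> i j < I j" "\<And>j. j \<in> set js \<Longrightarrow> i' j < I j"
    and "lin_idx I js i = lin_idx I js i'" "j \<in> set js"
  shows "i j = i' j"
  using assms
proof (induction js arbitrary: j rule: rev_induct)
  case Nil
  then show ?case by simp
next
  case (snoc k js)
  let ?P = "\<Prod>j\<in>set js. I j"
  have lt: "lin_idx I js i < ?P" "lin_idx I js i' < ?P"
    using snoc.prems by (auto intro!: lin_idx_less)
  have eq: "lin_idx I js i + i k * ?P = lin_idx I js i' + i' k * ?P"
    using snoc.prems by (simp add: lin_idx_append prod_nth_distinct)
  have nz: "?P \<noteq> 0" using lt by linarith
  have "i k = (lin_idx I js i + i k * ?P) div ?P" using lt by (simp only: div_mult_self1[OF nz] div_less add_0_right)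
  also have "\<dots> = i' k" unfolding eq using lt by (simp only: div_mult_self1[OF nz] div_less add_0_right)
  finally have k: "i k = i' k" .
  with eq have "lin_idx I js i = lin_idx I js i'" by simp
  then show ?case
    using k snoc.IH[of j] snoc.prems by auto
qed

lemma multi_idx_lin_idx:
  assumes "distinct js" "i \<in> PiE (set js) (\<lambda>j. {..<I j})"
  shows "multi_idx I js (lin_idx I js i) = i"
proof -
  have "inj_on (lin_idx I js) (PiE (set js) (\<lambda>j. {..<I j}))"
  proof (rule inj_onI)
    fix x y
    assume x: "x \<in> PiE (set js) (\<lambda>j. {..<I j})" and y: "y \<in> PiE (set js) (\<lambda>j. {..<I j})"
      and e: "lin_idx I js x = lin_idx I js y"
    have "x j < I j" "y j < I j" if "j \<in> set js" for j
      using PiE_mem[OF x that] PiE_mem[OF y that] by auto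
    then show "x = y"
      by (intro PiE_ext[OF x y] lin_idx_inj[OF assms(1) _ _ e]) auto
  qed
  then show ?thesis
    unfolding multi_idx_def using assms(2) by (rule inv_into_f_f)
qed

definition other_modes :: "nat \<Rightarrow> nat \<Rightarrow> nat list" where
  "other_modes N n = [Suc n..<Suc N] @ [1..<n]"

definition mode_unfold :: "nat \<Rightarrow> nat \<Rightarrow> (nat \<Rightarrow> nat) \<Rightarrow> ((nat \<Rightarrow> nat) \<Rightarrow> real) \<Rightarrow> real mat" where
  "mode_unfold N n I X = mat (I n) (\<Prod>j\<in>{1..N} - {n}. I j)
     (\<lambda>(a, c). X ((multi_idx I (other_modes N n) c)(n := a)))"

lemma mode_unfold_entry:
  assumes "n \<in> {1..N}" "i \<in> PiE {1..N} (\<lambda>j. {..<I j})"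
  shows "mode_unfold N n I X $$ (i n, lin_idx I (other_modes N n) i) = X i"
proof -
  let ?js = "other_modes N n" and ?i = "restrict i ({1..N} - {n})"
  have set_js: "set ?js = {1..N} - {n}" and dist: "distinct ?js"
    using assms(1) by (auto simp: other_modes_def)
  have lt: "i j < I j" if "j \<in> {1..N}" for j
    using PiE_mem[OF assms(2) that] by simp
  have lin: "lin_idx I ?js i = lin_idx I ?js ?i"
    unfolding lin_idx_def set_js[symmetric] by (intro sum.cong) auto
  have "?i \<in> PiE (set ?js) (\<lambda>j. {..<I j})"
    unfolding set_js by (rule PiE_I) (auto simp: lt)
  then have "multi_idx I ?js (lin_idx I ?js i) = ?i"
    unfolding lin by (rule multi_idx_lin_idx[OF dist])
  moreover have "?i(n := i n) = i"
  proof
    fix x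
    show "(?i(n := i n)) x = i x"
      using PiE_arb[OF assms(2), of x] by auto
  qed
  moreover have "lin_idx I ?js i < (\<Prod>j\<in>{1..N} - {n}. I j)"
    using lin_idx_less[OF dist, of i I] lt unfolding set_js by auto
  ultimately show ?thesis
    unfolding mode_unfold_def using lt[OF assms(1)] by simp
qed

text \<open>Ranks are \<open>R 0, \<dots>, R N\<close> with \<open>R 0 = R N\<close>, and the core \<open>G j r\<^bsub>j-1\<^esub> i\<^sub>j r\<^sub>j\<close> has size
  \<open>R (j - 1) \<times> I j \<times> R j\<close>. The cyclic reading of the rank indices is the condition \<open>r 0 = r N\<close>.\<close>

definition subchain_dims ::
  "nat \<Rightarrow> nat \<Rightarrow> (nat \<Rightarrow> nat) \<Rightarrow> (nat \<Rightarrow> nat) \<Rightarrow> nat \<Rightarrow> nat" where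
  "subchain_dims N n I R =
     (\<lambda>_. 0)(1 := R n, 2 := \<Prod>j\<in>{1..N} - {n}. I j, 3 := R (n - 1))"

definition subchain ::
  "nat \<Rightarrow> nat \<Rightarrow> (nat \<Rightarrow> nat) \<Rightarrow> (nat \<Rightarrow> nat) \<Rightarrow> (nat \<Rightarrow> nat \<Rightarrow> nat \<Rightarrow> nat \<Rightarrow> real)
     \<Rightarrow> (nat \<Rightarrow> nat) \<Rightarrow> real" where
  "subchain N n I R G t =
     (let i = multi_idx I (other_modes N n) (t 2) in
      \<Sum>r | r \<in> PiE {0..N} (\<lambda>j. {..<R j}) \<and> r 0 = r N \<and> r n = t 1 \<and> r (n - 1) = t 3.
        \<Prod>j\<in>{1..N} - {n}. G j (r (j - 1)) (i j) (r j))"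

definition subchain_mat ::
  "nat \<Rightarrow> nat \<Rightarrow> (nat \<Rightarrow> nat) \<Rightarrow> (nat \<Rightarrow> nat) \<Rightarrow> (nat \<Rightarrow> nat \<Rightarrow> nat \<Rightarrow> nat \<Rightarrow> real)
     \<Rightarrow> real mat" where
  "subchain_mat N n I R G = mode_unfold 3 2 (subchain_dims N n I R) (subchain N n I R G)"

lemma subchain_mat_entry:
  assumes "n \<in> {1..N}" "i \<in> PiE (set (other_modes N n)) (\<lambda>j. {..<I j})" "a < R (n - 1)" "b < R n"
  shows "subchain_mat N n I R G $$ (lin_idx I (other_modes N n) i, a + R (n - 1) * b) =
    (\<Sum>r | r \<in> PiE {0..N} (\<lambda>j. {..<R j}) \<and> r 0 = r N \<and> r n = b \<and> r (n - 1) = a.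
       \<Prod>j\<in>{1..N} - {n}. G j (r (j - 1)) (i j) (r j))"
proof -
  let ?js = "other_modes N n" and ?D = "subchain_dims N n I R"
  define t :: "nat \<Rightarrow> nat" where "t = (\<lambda>_. undefined)(1 := b, 2 := lin_idx I ?js i, 3 := a)"
  have set_js: "set ?js = {1..N} - {n}" and dist: "distinct ?js"
    using assms(1) by (auto simp: other_modes_def)
  have "lin_idx I ?js i < (\<Prod>j\<in>set ?js. I j)"
    using PiE_mem[OF assms(2)] by (intro lin_idx_less[OF dist]) auto
  then have "t j < ?D j" if "j \<in> {1, 2, 3}" for j :: nat
    using that assms(3,4) unfolding set_js by (auto simp: t_def subchain_dims_def)
  moreover have "{1..3} = {1, 2, 3 :: nat}" by auto
  ultimately have "t \<in> PiE {1..3} (\<lambda>j. {..<?D j})"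
    by (intro PiE_I) (auto simp: t_def)
  then have "mode_unfold 3 2 ?D (subchain N n I R G) $$ (t 2, lin_idx ?D (other_modes 3 2) t)
      = subchain N n I R G t"
    by (intro mode_unfold_entry) auto
  moreover have "other_modes 3 2 = [3, 1]"
    by (simp add: other_modes_def upt_rec)
  then have "lin_idx ?D (other_modes 3 2) t = a + R (n - 1) * b"
    by (simp add: lin_idx_def t_def subchain_dims_def)
  ultimately show ?thesis
    unfolding subchain_mat_def subchain_def
    by (simp add: t_def multi_idx_lin_idx[OF dist assms(2)])
qed

section \<open>Matrices\<close>

definition fro_norm :: "real mat \<Rightarrow> real" where
  "fro_norm A = sqrt (\<Sum>i<dim_row A. \<Sum>j<dim_col A. (A $$ (i, j))\<^sup>2)"

definition compact_svd :: "real mat \<Rightarrow> real mat \<Rightarrow> real mat \<Rightarrow> real mat \<Rightarrow> bool" where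
  "compact_svd A U D V \<longleftrightarrow>
     (let r = vec_space.rank (dim_row A) A in
        U \<in> carrier_mat (dim_row A) r \<and> D \<in> carrier_mat r r \<and> V \<in> carrier_mat (dim_col A) r \<and>
        U\<^sup>T * U = 1\<^sub>m r \<and> V\<^sup>T * V = 1\<^sub>m r \<and>
        diagonal_mat D \<and> (\<forall>i<r. D $$ (i, i) > 0) \<and>
        A = U * D * V\<^sup>T)"

text \<open>Standard Kronecker product: in a product of row (or column) indices the last factor varies
  fastest.\<close>

definition kron :: "real mat \<Rightarrow> real mat \<Rightarrow> real mat" where
  "kron A B = mat (dim_row A * dim_row B) (dim_col A * dim_col B)
     (\<lambda>(i, j). A $$ (i div dim_row B, j div dim_col B) * B $$ (i mod dim_row B, j mod dim_col B))"

definition kron_list :: "real mat list \<Rightarrow> real mat" where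
  "kron_list As = foldr kron As (1\<^sub>m 1)"

section \<open>Random matrices, represented by their laws\<close>

text \<open>A random function on \<open>{..<I}\<close> is a \<open>pmf\<close> on \<open>nat \<Rightarrow> 'b\<close>; arguments \<open>\<ge> I\<close> are irrelevant.\<close>

definition k_wise_indep :: "nat \<Rightarrow> nat \<Rightarrow> 'b set \<Rightarrow> (nat \<Rightarrow> 'b) pmf \<Rightarrow> bool" where
  "k_wise_indep k I B P \<longleftrightarrow>
     (\<forall>A. A \<subseteq> {..<I} \<and> card A = min k I \<longrightarrow>
        prob_space.indep_vars (measure_pmf P) (\<lambda>_. count_space UNIV) (\<lambda>i h. h i) A \<and>
        (\<forall>i\<in>A. map_pmf (\<lambda>h. h i) P = pmf_of_set B))"

definition is_hash :: "nat \<Rightarrow> nat \<Rightarrow> (nat \<Rightarrow> nat) pmf \<Rightarrow> bool" where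
  "is_hash I J P \<longleftrightarrow> k_wise_indep 3 I {..<J} P"

definition is_sign :: "nat \<Rightarrow> (nat \<Rightarrow> real) pmf \<Rightarrow> bool" where
  "is_sign I P \<longleftrightarrow> k_wise_indep 4 I {-1, 1} P"

definition count_sketch_mat ::
  "nat \<Rightarrow> nat \<Rightarrow> (nat \<Rightarrow> nat) \<times> (nat \<Rightarrow> real) \<Rightarrow> real mat" where
  "count_sketch_mat J I = (\<lambda>(h, s). mat J I (\<lambda>(j, i). s i * of_bool (h i = j)))"

definition count_sketch :: "nat \<Rightarrow> nat \<Rightarrow> real mat pmf \<Rightarrow> bool" where
  "count_sketch J I P \<longleftrightarrow>
     (\<exists>h s. is_hash I J h \<and> is_sign I s \<and> P = map_pmf (count_sketch_mat J I) (pair_pmf h s))"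

text \<open>A column index \<open>c\<close> stands for the pair \<open>(c mod I, c div I)\<close>. The hash values are zero-based;
  the successors recover the values in \<open>{1..J}\<close> whose sum modulo \<open>J\<close> is the combined hash.\<close>

definition tensor_sketch_mat ::
  "nat \<Rightarrow> nat \<Rightarrow> ((nat \<Rightarrow> nat) \<times> (nat \<Rightarrow> real)) \<times> ((nat \<Rightarrow> nat) \<times> (nat \<Rightarrow> real)) \<Rightarrow> real mat" where
  "tensor_sketch_mat J I = (\<lambda>((h1, s1), (h2, s2)). mat J (I\<^sup>2)
     (\<lambda>(j, c). s1 (c mod I) * s2 (c div I) *
        of_bool ((Suc (h1 (c mod I)) + Suc (h2 (c div I))) mod J = j)))"

definition tensor_sketch :: "nat \<Rightarrow> nat \<Rightarrow> real mat pmf \<Rightarrow> bool" where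
  "tensor_sketch J I P \<longleftrightarrow>
     (\<exists>h1 s1 h2 s2. is_hash I J h1 \<and> is_sign I s1 \<and> is_hash I J h2 \<and> is_sign I s2 \<and>
        P = map_pmf (tensor_sketch_mat J I) (pair_pmf (pair_pmf h1 s1) (pair_pmf h2 s2)))"

primrec sketch_tree :: "nat \<Rightarrow> (nat \<Rightarrow> real mat) \<Rightarrow> (nat \<times> nat \<Rightarrow> real mat) \<Rightarrow> nat \<Rightarrow> real mat" where
  "sketch_tree q C T 0 = kron_list (map C [1..<Suc (2 ^ q)])"
| "sketch_tree q C T (Suc m) =
     kron_list (map (\<lambda>k. T (Suc m, k)) [1..<Suc (2 ^ (q - Suc m))]) * sketch_tree q C T m"

definition recursive_sketch_pow2 :: "nat \<Rightarrow> nat list \<Rightarrow> real mat pmf \<Rightarrow> bool" where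
  "recursive_sketch_pow2 J Is P \<longleftrightarrow>
     (\<exists>q PC PT. length Is = 2 ^ q \<and>
        (\<forall>k\<in>{1..2 ^ q}. count_sketch J (Is ! (k - 1)) (PC k)) \<and>
        (\<forall>x\<in>(SIGMA m:{1..q}. {1..2 ^ (q - m)}). tensor_sketch J J (PT x)) \<and>
        P = map_pmf (\<lambda>(C, T). sketch_tree q C T q)
              (pair_pmf (Pi_pmf {1..2 ^ q} (0\<^sub>m 0 0) PC)
                        (Pi_pmf (SIGMA m:{1..q}. {1..2 ^ (q - m)}) (0\<^sub>m 0 0) PT)))"

text \<open>If the number \<open>M\<close> of factors is not a power of two, the sketch maps \<open>x\<close> to the padded sketch
  of \<open>x \<otimes> e\<close>, where \<open>e\<close> is a Kronecker power of the first unit vector;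
  with \<open>e\<close> a one-column matrix, \<open>x \<otimes> e = (1 \<otimes> e) x\<close>.\<close>

definition recursive_sketch :: "nat \<Rightarrow> nat list \<Rightarrow> real mat pmf \<Rightarrow> bool" where
  "recursive_sketch J Is P \<longleftrightarrow>
     (let M = length Is in
      if \<exists>q. M = 2 ^ q then recursive_sketch_pow2 J Is P
      else let d = 2 ^ nat \<lceil>log 2 (real M)\<rceil> - M; I_max = Max (set Is);
               e = kron_list (replicate d (mat_of_cols I_max [unit_vec I_max 0]))
           in \<exists>P'. recursive_sketch_pow2 J (Is @ replicate d I_max) P' \<and>
                P = map_pmf (\<lambda>\<Psi>. \<Psi> * kron (1\<^sub>m (prod_list Is)) e) P')"

section \<open>Sampling\<close>

definition approx_lev :: "real mat \<Rightarrow> real mat \<Rightarrow> real mat \<Rightarrow> nat \<Rightarrow> real" where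
  "approx_lev A D V i =
     (let v = Matrix.row (A * V * the (mat_inverse D)) i in scalar_prod v v)"

text \<open>The distribution on \<open>{..<K}\<close> proportional to the nonnegative weights \<open>w\<close>, and \<open>q\<^sub>0\<close> if they
  all vanish.\<close>

definition proportional_pmf :: "nat \<Rightarrow> (nat \<Rightarrow> real) \<Rightarrow> nat pmf \<Rightarrow> nat pmf" where
  "proportional_pmf K w q\<^sub>0 =
     (if \<forall>i<K. w i = 0 then q\<^sub>0
      else embed_pmf (\<lambda>i. if i < K then w i / (\<Sum>j<K. w j) else 0))"

lemma pmf_proportional_pmf:
  assumes "\<And>i. i < K \<Longrightarrow> w i \<ge> 0" "\<exists>i<K. w i \<noteq> 0"
  shows "pmf (proportional_pmf K w q\<^sub>0) i = (if i < K then w i / (\<Sum>j<K. w j) else 0)"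
proof -
  let ?f = "\<lambda>i. if i < K then w i / (\<Sum>j<K. w j) else 0"
  have pos: "(\<Sum>j<K. w j) > 0"
    using assms by (metis finite_lessThan lessThan_iff order_le_less sum_pos2)
  then have nn: "?f i \<ge> 0" for i
    using assms(1) by auto
  have "(\<integral>\<^sup>+ i. ennreal (?f i) \<partial>count_space UNIV) = (\<integral>\<^sup>+ i. ennreal (?f i) \<partial>count_space {..<K})"
    by (intro nn_integral_count_space_eq) auto
  also have "\<dots> = (\<Sum>i<K. ennreal (?f i))"
    by (simp add: nn_integral_count_space_finite)
  also have "\<dots> = ennreal (\<Sum>i<K. ?f i)"
    by (rule sum_ennreal) (use nn in blast)
  also have "(\<Sum>i<K. ?f i) = 1"
    using pos by (simp flip: sum_divide_distrib)
  finally have "pmf (embed_pmf ?f) i = ?f i"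
    using nn by (intro pmf_embed_pmf) auto
  with assms(2) show ?thesis
    unfolding proportional_pmf_def by auto
qed

definition sampling_mat :: "nat \<Rightarrow> nat \<Rightarrow> nat pmf \<Rightarrow> (nat \<Rightarrow> nat) \<Rightarrow> real mat" where
  "sampling_mat J K q f = mat J K (\<lambda>(j, i). of_bool (f j = i) / sqrt (real J * pmf q (f j)))"

definition sampling_pmf :: "nat \<Rightarrow> nat \<Rightarrow> nat pmf \<Rightarrow> real mat pmf" where
  "sampling_pmf J K q = map_pmf (sampling_mat J K q) (Pi_pmf {..<J} 0 (\<lambda>_. q))"

end

theory Submission
  imports Defs
begin

text \<open>Every CountSketch and TensorSketch \<open>T\<close> with \<open>J\<close> rows satisfies \<open>E \<langle>Tx, Ty\<rangle> = \<langle>x, y\<rangle>\<close> with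
  variance at most \<open>(9 / J) |x|\<^sup>2 |y|\<^sup>2\<close>. One plus the variance constant is multiplicative under
  products, hence under Kronecker products, so for \<open>M\<close> modes it is \<open>(1 + 9 / J)^O(M)\<close> for the
  recursive sketch, and Markov's inequality yields a subspace embedding of the column space of the
  subchain matrix \<open>G\<close>. If \<open>\<Psi> G = U \<Sigma> V\<^sup>T\<close> with such an embedding \<open>\<Psi>\<close>, then
  \<open>W = G V \<Sigma>\<^sup>-\<^sup>1\<close> is a well-conditioned basis of that column space, and rows are sampled by their
  norms in \<open>W\<close>. The sampled \<open>W\<close> stays well conditioned by a matrix Chernoff bound, and the sampled
  residual stays nearly orthogonal to \<open>W\<close> by a variance computation; together these give the
  approximation guarantee.

  The Chernoff bound is obtained without matrix exponentials. With \<open>T\<close> the identity minus a small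
  multiple of the sum of the rank-one matrices drawn so far and \<open>p\<close> large, the potential is the trace
  of \<open>T^p\<close>. For a downdate \<open>T' = T - u u\<^sup>T\<close> the difference of the traces is the sum of
  \<open>\<langle>T'^i u, T^j u\<rangle>\<close> over \<open>i + j = p - 1\<close>, and log-convexity of the moments \<open>\<langle>u, T^m u\<rangle>\<close> bounds each
  summand from below by a multiple of \<open>\<langle>u, T^(p - 1) u\<rangle>\<close>.\<close>

text \<open>The least-squares step asks for two things only: a lower bound for the sampled basis and
  a small product of that basis with the residual. A one-sided tail bound therefore suffices. Since
  the residual is orthogonal to the column space, the excess enters through Pythagoras, which is why
  1/\<epsilon> and not 1/\<epsilon>^2 appears in \<open>J2\<close>. The obstacle in the tail bound
  is that a drawn rank-one matrix does not commute with the current operator. The step size is so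
  small that the operator stays between half the identity and the identity for every outcome of the
  draws. A moment is then at most twice the next one, and exchanging \<open>T'\<close> for
  \<open>T\<close> costs little. As a fresh draw is independent of \<open>T\<close>, its covariance
  bound turns the resulting moment into a multiple of the trace. The linear dependence of
  \<open>J1\<close> on \<open>N\<close> reflects at most 4 N random factors in the sketch, each with
  constant 1 + 9 / J. The sketch may fail with probability \<delta>/2, each of the two sampling
  events with \<delta>/4. The number 600 covers 576, which arises as 2 * 288 for \<open>J1\<close>
  and as 64 * 9 for \<open>J2\<close>.\<close>

abbreviation mean :: "'a pmf \<Rightarrow> ('a \<Rightarrow> real) \<Rightarrow> real" where
  "mean p \<equiv> measure_pmf.expectation p"

section \<open>A lower tail bound for sums of rank-one matrices\<close>

text \<open>Vectors of this section are plain functions of which the inner product sees the first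
  \<open>r\<close> coordinates. An operator is then a function on functions and its powers are
  iterates, free of carrier conditions.\<close>

definition ip :: "nat \<Rightarrow> (nat \<Rightarrow> real) \<Rightarrow> (nat \<Rightarrow> real) \<Rightarrow> real" where
  "ip r x y = (\<Sum>i<r. x i * y i)"

lemma ip_commute: "ip r x y = ip r y x"
  by (simp add: ip_def mult.commute)

lemma ip_self_nonneg: "0 \<le> ip r x x"
  by (auto simp: ip_def intro!: sum_nonneg)

lemma ip_lin_left:
  "ip r (\<lambda>i. a * x i + b * y i) z = a * ip r x z + b * ip r y z"
  by (simp add: ip_def sum_distrib_left sum.distrib algebra_simps)

lemma ip_lin_right:
  "ip r z (\<lambda>i. a * x i + b * y i) = a * ip r z x + b * ip r z y"
  by (simp add: ip_def sum_distrib_left sum.distrib algebra_simps)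

lemma ip_sum_left:
  "ip r (\<lambda>i. \<Sum>j\<in>A. f j i) z = (\<Sum>j\<in>A. ip r (f j) z)"
  unfolding ip_def sum_distrib_right by (rule sum.swap)

lemma ip_sub_right:
  "ip r z (\<lambda>i. x i - b * y i) = ip r z x - b * ip r z y"
  by (simp add: ip_def sum_distrib_left sum_subtractf algebra_simps)

lemma ip_scale: "ip r (\<lambda>i. a * x i) y = a * ip r x y" "ip r x (\<lambda>i. a * y i) = a * ip r x y"
  by (simp_all add: ip_def sum_distrib_left algebra_simps)

text \<open>At t = - b / c the expression is a - b^2 / c; for c = 0 it is affine in t and bounded
  below, so b = 0. The Cauchy-Schwarz inequalities for powers of an operator and for expectations
  are both instances.\<close>

lemma discriminant_bound:
  fixes a b c :: real
  assumes "\<And>t. 0 \<le> a + 2 * t * b + t\<^sup>2 * c" "0 \<le> c"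
  shows "b\<^sup>2 \<le> a * c"
proof (cases "c = 0")
  case True
  have "b = 0"
  proof (rule ccontr)
    assume "b \<noteq> 0"
    \<comment> \<open>For this t the affine expression equals -1.\<close>
    then show False using assms(1)[of "- (a + 1) / (2 * b)"] True by (simp add: field_simps)
  qed
  then show ?thesis using True by simp
next
  case False
  then show ?thesis
    using assms(1)[of "- b / c"] assms(2) by (simp add: field_simps power2_eq_square)
qed

lemma ip_Cauchy_Schwarz: "(ip r x y)\<^sup>2 \<le> ip r x x * ip r y y"
  using Cauchy_Schwarz_ineq_sum[of x y "{..<r}"] by (simp add: ip_def power2_eq_square)

text \<open>Settles the degenerate case of the moment inequalities below: the log-convexity lemmas
  ask for strictly positive terms, while all moments of a null vector vanish.\<close>

lemma ip_null: "\<not> 0 < ip r x x \<Longrightarrow> ip r x y = 0"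
  using ip_Cauchy_Schwarz[of r x y] ip_self_nonneg[of r x] by (cases "ip r x x = 0") auto

text \<open>The ratios a (m + 1) / a m are nondecreasing; \<open>mono\<close> says so with
  denominators cleared. Hence the l ratios leading from a m to a (l + m) dominate those leading from
  a 0 to a l.\<close>

lemma log_convex_superadditive:
  fixes a :: "nat \<Rightarrow> real"
  assumes pos: "\<And>m. 0 < a m" and conv: "\<And>m. (a (Suc m))\<^sup>2 \<le> a m * a (Suc (Suc m))"
  shows "a l * a m \<le> a 0 * a (l + m)"
proof -
  have mono: "a (Suc l) * a m \<le> a l * a (Suc m)" if "l \<le> m" for l m
    using that
  proof (induction m rule: dec_induct)
    case (step m)
    have "a (Suc l) * a (Suc m) * a m \<le> (a (Suc m))\<^sup>2 * a l"
      using mult_right_mono[OF step.IH, of "a (Suc m)"] pos[of "Suc m"]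
      by (simp add: power2_eq_square mult_ac)
    also have "\<dots> \<le> a m * a (Suc (Suc m)) * a l"
      using conv pos[of l] by (intro mult_right_mono) auto
    finally show ?case using pos[of m] by (simp add: mult_ac)
  qed simp
  show ?thesis
  proof (induction l)
    case (Suc l)
    have "a (Suc l) * a m * a l \<le> a l * (a 0 * a (Suc l + m))"
    proof -
      have "a (Suc l) * (a l * a m) \<le> a (Suc l) * (a 0 * a (l + m))"
        using Suc.IH pos[of "Suc l"] by (intro mult_left_mono) auto
      also have "\<dots> = a 0 * (a (Suc l) * a (l + m))" by simp
      also have "\<dots> \<le> a 0 * (a l * a (Suc (l + m)))"
        using mono[of l "l + m"] pos[of 0] by (intro mult_left_mono) auto
      finally show ?thesis by (simp add: mult_ac)
    qed
    then show ?case using pos[of l] by (simp add: mult_ac)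
  qed simp
qed

text \<open>Every ratio of consecutive terms is at least the first one. For moments this is Jensen's
  inequality for the m-th power.\<close>

lemma log_convex_power:
  fixes a :: "nat \<Rightarrow> real"
  assumes pos: "\<And>m. 0 < a m" and conv: "\<And>m. (a (Suc m))\<^sup>2 \<le> a m * a (Suc (Suc m))"
  shows "a 0 * (a 1 / a 0) ^ m \<le> a m"
proof (induction m)
  case (Suc m)
  have "a 0 * (a 1 / a 0) ^ Suc m = (a 1 / a 0) * (a 0 * (a 1 / a 0) ^ m)" by simp
  also have "\<dots> \<le> (a 1 / a 0) * a m"
    using Suc.IH pos[of 0] pos[of 1] by (intro mult_left_mono) auto
  also have "\<dots> \<le> a (Suc m)"
    using log_convex_superadditive[of a 1 m, OF pos conv] pos[of 0] by (simp add: field_simps)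
  finally show ?case .
qed simp

section \<open>Moments of a self-adjoint operator between half the identity and the identity\<close>

text \<open>The spectrum lies in [1/2, 1]. The lower end bounds each moment by twice the next one,
  the upper end bounds an even moment by the odd one before it. Only quadratic forms occur, so
  nothing has to be diagonalised.\<close>

locale half_op =
  fixes r :: nat and T :: "(nat \<Rightarrow> real) \<Rightarrow> nat \<Rightarrow> real"
  assumes lin: "T (\<lambda>i. a * x i + b * y i) = (\<lambda>i. a * T x i + b * T y i)"
    and sym: "ip r x (T y) = ip r (T x) y"
    and lower: "ip r x x / 2 \<le> ip r x (T x)"
    and upper: "ip r x (T x) \<le> ip r x x"
begin

lemma pow_lin: "(T ^^ m) (\<lambda>i. a * x i + b * y i) = (\<lambda>i. a * (T ^^ m) x i + b * (T ^^ m) y i)"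
  by (induction m) (simp_all add: lin)

lemma pow_sym: "ip r x ((T ^^ m) y) = ip r ((T ^^ m) x) y"
  by (induction m arbitrary: x y) (simp_all add: sym funpow_swap1)

lemma pow_add: "ip r x ((T ^^ (m + n)) y) = ip r ((T ^^ m) x) ((T ^^ n) y)"
  by (simp only: funpow_add o_apply pow_sym[of x m])

lemma pow_add_Suc: "ip r x ((T ^^ Suc (m + n)) y) = ip r ((T ^^ m) x) (T ((T ^^ n) y))"
  using pow_add[of x m "Suc n" y] by simp

text \<open>An even power gives a squared norm |T^k x|^2, an odd one the quadratic form of
  \<open>T\<close> at T^k x.\<close>

lemma pow_nonneg: "0 \<le> ip r x ((T ^^ m) x)"
proof (cases "even m")
  case True
  then obtain k where "m = k + k" by (metis evenE mult_2)
  then show ?thesis by (simp only: pow_add ip_self_nonneg)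
next
  case False
  then obtain k where m: "m = Suc (k + k)" by (metis oddE mult_2 Suc_eq_plus1)
  have "0 \<le> ip r ((T ^^ k) x) (T ((T ^^ k) x))"
    using lower[of "(T ^^ k) x"] ip_self_nonneg[of r "(T ^^ k) x"] by linarith
  then show ?thesis unfolding m pow_add_Suc .
qed

lemma pow_Cauchy_Schwarz:
  "(ip r x ((T ^^ m) y))\<^sup>2 \<le> ip r x ((T ^^ m) x) * ip r y ((T ^^ m) y)"
proof (rule discriminant_bound)
  fix t :: real
  have "0 \<le> ip r (\<lambda>i. 1 * x i + t * y i) ((T ^^ m) (\<lambda>i. 1 * x i + t * y i))"
    by (rule pow_nonneg)
  also have "\<dots> = ip r x ((T ^^ m) x) + t * ip r x ((T ^^ m) y) + t * ip r y ((T ^^ m) x)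
      + t * t * ip r y ((T ^^ m) y)"
    unfolding pow_lin ip_lin_left ip_lin_right by (simp add: algebra_simps)
  also have "ip r y ((T ^^ m) x) = ip r x ((T ^^ m) y)"
    using pow_sym[of y m x] ip_commute[of r "(T ^^ m) y" x] by simp
  finally show "0 \<le> ip r x ((T ^^ m) x) + 2 * t * ip r x ((T ^^ m) y) + t\<^sup>2 * ip r y ((T ^^ m) y)"
    by (simp add: power2_eq_square algebra_simps)
qed (rule pow_nonneg)

text \<open>These are the moments of the spectral measure of \<open>T\<close> at
  \<open>x\<close>.\<close>

abbreviation mom :: "(nat \<Rightarrow> real) \<Rightarrow> nat \<Rightarrow> real" where
  "mom x m \<equiv> ip r x ((T ^^ m) x)"

text \<open>Cauchy-Schwarz for the positive semidefinite form of T^m, applied to \<open>x\<close>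
  and \<open>T x\<close>.\<close>

lemma mom_log_convex: "(mom x (Suc m))\<^sup>2 \<le> mom x m * mom x (Suc (Suc m))"
proof -
  have "ip r (T x) ((T ^^ m) (T x)) = mom x (Suc (Suc m))"
    unfolding sym[symmetric] by (simp add: funpow_swap1)
  then show ?thesis using pow_Cauchy_Schwarz[of x m "T x"] by (simp add: funpow_swap1)
qed

text \<open>The induction runs in steps of two: once the moments at m and m + 1 are positive,
  log-convexity forces the one at m + 2 to be positive.\<close>

lemma mom_pos:
  assumes "0 < ip r x x"
  shows "0 < mom x m"
proof (induction m rule: induct_nat_012)
  case 0
  then show ?case using assms by simp
next
  case 1
  then show ?case using lower[of x] assms by simp
next
  case (ge2 m)
  then have "0 < (mom x (Suc m))\<^sup>2" by (metis zero_less_power)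
  also note mom_log_convex
  finally show ?case using ge2(1) by (simp add: zero_less_mult_iff)
qed

lemma mom_superadditive: "mom x l * mom x m \<le> mom x 0 * mom x (l + m)"
proof (cases "0 < ip r x x")
  case True
  show ?thesis
    by (rule log_convex_superadditive[of "mom x", OF mom_pos[OF True] mom_log_convex])
next
  case False
  then show ?thesis by (simp add: ip_null)
qed

lemma mom_half: "mom x m \<le> 2 * mom x (Suc m)"
proof (cases "0 < ip r x x")
  case True
  have "mom x 1 * mom x m \<le> mom x 0 * mom x (1 + m)" by (rule mom_superadditive)
  moreover have "mom x 0 / 2 * mom x m \<le> mom x 1 * mom x m"
    using lower[of x] pow_nonneg by (intro mult_right_mono) auto
  ultimately have "mom x 0 * mom x m \<le> mom x 0 * (2 * mom x (Suc m))" by simp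
  then show ?thesis using True by simp
next
  case False
  then show ?thesis by (simp add: ip_null)
qed

text \<open>The upper bound on \<open>T\<close>, taken at T^(k+1) x, compares an even moment with
  the odd one after it. Ratios of consecutive moments are nondecreasing, so the preceding ratio is
  at most 1 as well. This links the odd moment p - 1 left by a downdate to the even moment p, which
  is a sum of squares.\<close>

lemma mom_even_le: "mom x (2 * Suc k) \<le> mom x (2 * Suc k - 1)"
proof (cases "0 < ip r x x")
  case True
  let ?m = "2 * k + 1"
  have e: "mom x (Suc (2 * Suc k)) \<le> mom x (2 * Suc k)"
  proof -
    have "mom x (Suc (Suc k + Suc k)) = ip r ((T ^^ Suc k) x) (T ((T ^^ Suc k) x))"
      by (rule pow_add_Suc)
    moreover have "mom x (Suc k + Suc k) = ip r ((T ^^ Suc k) x) ((T ^^ Suc k) x)"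
      by (rule pow_add)
    ultimately show ?thesis using upper[of "(T ^^ Suc k) x"] by (simp only: mult_2)
  qed
  have "(mom x (2 * Suc k))\<^sup>2 \<le> mom x ?m * mom x (Suc (2 * Suc k))"
    using mom_log_convex[of x ?m] by (simp del: funpow.simps)
  also have "\<dots> \<le> mom x ?m * mom x (2 * Suc k)"
    using e pow_nonneg by (intro mult_left_mono)
  finally have "mom x (2 * Suc k) \<le> mom x ?m"
    using mom_pos[OF True, of "2 * Suc k"] by (simp add: power2_eq_square del: funpow.simps)
  then show ?thesis by (simp del: funpow.simps)
next
  case False
  then show ?thesis by (simp add: ip_null)
qed

text \<open>In a direction that the sample has hardly touched the Rayleigh quotient is close to 1;
  this bound then forces the trace of a high power to be large.\<close>

lemma mom_ge_power:
  assumes "0 < ip r x x"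
  shows "ip r x x * (ip r x (T x) / ip r x x) ^ m \<le> mom x m"
  using log_convex_power[of "mom x" m, OF mom_pos[OF assms] mom_log_convex] by simp

end

section \<open>Traces of powers under a rank-one downdate\<close>

definition unitv :: "nat \<Rightarrow> nat \<Rightarrow> real" where
  "unitv i = (\<lambda>k. of_bool (k = i))"

lemma ip_unitv: "i < r \<Longrightarrow> ip r (unitv i) y = y i" "i < r \<Longrightarrow> ip r y (unitv i) = y i"
  by (simp_all add: ip_def unitv_def)

definition op_trace :: "nat \<Rightarrow> ((nat \<Rightarrow> real) \<Rightarrow> nat \<Rightarrow> real) \<Rightarrow> real" where
  "op_trace r T = (\<Sum>i<r. T (unitv i) i)"

locale rank_one_downdate = half_op r T + dd: half_op r T'
  for r T T' +
  fixes u :: "nat \<Rightarrow> real"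
  assumes downdate: "T' x = (\<lambda>i. T x i - ip r u x * u i)"
begin

text \<open>The expansion T^p - T'^p = sum over j < p of T'^(p-1-j) (T - T') T^j, with T - T' = u
  u^T.\<close>

lemma pow_telescope:
  "(T ^^ p) x i - (T' ^^ p) x i = (\<Sum>j<p. ip r ((T ^^ j) u) x * (T' ^^ (p - 1 - j)) u i)"
proof (induction p arbitrary: x)
  case (Suc p)
  have "(T' ^^ Suc p) x i = (T' ^^ p) (\<lambda>i. 1 * T x i + (- ip r u x) * u i) i"
    by (simp add: funpow_swap1 downdate)
  also have "\<dots> = (T' ^^ p) (T x) i - ip r u x * (T' ^^ p) u i"
    unfolding dd.pow_lin by simp
  finally have "(T ^^ Suc p) x i - (T' ^^ Suc p) x i
      = ((T ^^ p) (T x) i - (T' ^^ p) (T x) i) + ip r u x * (T' ^^ p) u i"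
    by (simp add: funpow_swap1)
  also have "\<dots> = (\<Sum>j<p. ip r ((T ^^ Suc j) u) x * (T' ^^ (p - 1 - j)) u i)
      + ip r u x * (T' ^^ p) u i"
    unfolding Suc.IH by (simp add: sym)
  also have "\<dots> = (\<Sum>j<Suc p. ip r ((T ^^ j) u) x * (T' ^^ (Suc p - 1 - j)) u i)"
    unfolding sum.lessThan_Suc_shift by (simp add: algebra_simps)
  finally show ?case .
qed simp

text \<open>Summing the telescope over the coordinates leaves these numbers with i + j = p - 1. They
  interpolate between the moments of \<open>T\<close> at i = 0 and those of \<open>T'\<close> at j =
  0.\<close>

definition mixed :: "nat \<Rightarrow> nat \<Rightarrow> real" where
  "mixed i j = ip r ((T' ^^ i) u) ((T ^^ j) u)"

lemma mixed_Suc: "mixed (Suc i) j = mixed i (Suc j) - mixed i 0 * mom u j"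
proof -
  define y z where "y = (T' ^^ i) u" and "z = (T ^^ j) u"
  have "ip r (T' y) z = ip r y (T' z)" by (rule dd.sym[symmetric])
  also have "\<dots> = ip r y (T z) - ip r u z * ip r y u"
    by (simp add: downdate ip_sub_right)
  finally show ?thesis by (simp add: mixed_def y_def z_def)
qed

lemma mixed_0_nonneg: "0 \<le> mixed i 0"
  unfolding mixed_def using dd.pow_nonneg[of u i] by (simp add: ip_commute)

lemma mixed_le: "mixed i j \<le> mom u (i + j)"
proof (induction i arbitrary: j)
  case 0
  then show ?case by (simp add: mixed_def)
next
  case (Suc i)
  have "mixed (Suc i) j \<le> mixed i (Suc j)"
    unfolding mixed_Suc using mixed_0_nonneg[of i] pow_nonneg[of u j] by simp
  then show ?case using Suc[of "Suc j"] by (simp del: funpow.simps)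
qed

text \<open>Exchanging one factor \<open>T'\<close> for \<open>T\<close> costs
  \<open>mixed i 0 * mom u j\<close>, at most the product of two moments of \<open>T\<close>.
  Superadditivity merges them at the price |u|^2 and \<open>mom_half\<close> raises the order by one
  at the price 2; i exchanges cost 2 i |u|^2.\<close>

lemma mixed_ge: "(1 - 2 * real i * ip r u u) * mom u (i + j) \<le> mixed i j"
proof (induction i arbitrary: j)
  case 0
  then show ?case by (simp add: mixed_def)
next
  case (Suc i)
  have "mixed i 0 * mom u j \<le> mom u i * mom u j"
    using mixed_le[of i 0] pow_nonneg by (intro mult_right_mono) auto
  also have "\<dots> \<le> ip r u u * mom u (i + j)"
    using mom_superadditive[of u i j] by simp
  also have "\<dots> \<le> ip r u u * (2 * mom u (Suc (i + j)))"
    by (intro mult_left_mono mom_half ip_self_nonneg)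
  finally have "mixed (Suc i) j \<ge> mixed i (Suc j) - ip r u u * (2 * mom u (Suc (i + j)))"
    unfolding mixed_Suc by simp
  with Suc[of "Suc j"] show ?case
    by (simp add: algebra_simps del: funpow.simps)
qed

text \<open>The hypothesis makes the total exchange cost at most 1/4, so each of the p telescope
  terms keeps at least 3/4 of \<open>mom u (p - 1)\<close>.\<close>

lemma trace_downdate:
  assumes "2 * real p * ip r u u \<le> 1 / 4"
  shows "op_trace r (T' ^^ p) \<le> op_trace r (T ^^ p) - 3 / 4 * real p * mom u (p - 1)"
proof -
  have "op_trace r (T ^^ p) - op_trace r (T' ^^ p)
      = (\<Sum>i<r. \<Sum>j<p. ip r ((T ^^ j) u) (unitv i) * (T' ^^ (p - 1 - j)) u i)"
    unfolding op_trace_def sum_subtractf[symmetric] pow_telescope ..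
  also have "\<dots> = (\<Sum>j<p. \<Sum>i<r. ip r ((T ^^ j) u) (unitv i) * (T' ^^ (p - 1 - j)) u i)"
    by (rule sum.swap)
  also have "\<dots> = (\<Sum>j<p. mixed (p - 1 - j) j)"
    by (simp add: ip_unitv mixed_def) (simp add: ip_def mult.commute)
  also have "\<dots> \<ge> (\<Sum>j<p. 3 / 4 * mom u (p - 1))"
  proof (rule sum_mono)
    fix j assume "j \<in> {..<p}"
    then have e: "p - 1 - j + j = p - 1" by simp
    have "2 * real (p - 1 - j) * ip r u u \<le> 2 * real p * ip r u u"
      by (intro mult_right_mono ip_self_nonneg) simp
    then have "3 / 4 * mom u (p - 1) \<le> (1 - 2 * real (p - 1 - j) * ip r u u) * mom u (p - 1)"
      using assms pow_nonneg by (intro mult_right_mono) auto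
    also have "\<dots> \<le> mixed (p - 1 - j) j"
      using mixed_ge[of "p - 1 - j" j] unfolding e .
    finally show "3 / 4 * mom u (p - 1) \<le> mixed (p - 1 - j) j" .
  qed
  finally show ?thesis by (simp add: algebra_simps)
qed

end

context half_op
begin

text \<open>For even exponents both the trace and the moments are sums of squares over the vectors
  T^k e_i, so a covariance bound can be applied vector by vector.\<close>

lemma trace_even: "op_trace r (T ^^ (2 * k)) = (\<Sum>i<r. ip r ((T ^^ k) (unitv i)) ((T ^^ k) (unitv i)))"
proof -
  have "(T ^^ (2 * k)) (unitv i) i = ip r ((T ^^ k) (unitv i)) ((T ^^ k) (unitv i))" if "i < r" for i
  proof -
    have "(T ^^ (2 * k)) (unitv i) i = ip r (unitv i) ((T ^^ (k + k)) (unitv i))"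
      using that by (simp add: ip_unitv mult_2)
    then show ?thesis by (simp only: pow_add)
  qed
  then show ?thesis unfolding op_trace_def by simp
qed

lemma mom_even: "mom x (2 * k) = (\<Sum>i<r. (ip r ((T ^^ k) (unitv i)) x)\<^sup>2)"
proof -
  have "mom x (2 * k) = ip r ((T ^^ k) x) ((T ^^ k) x)"
    by (simp only: mult_2 pow_add)
  also have "\<dots> = (\<Sum>i<r. (ip r (unitv i) ((T ^^ k) x))\<^sup>2)"
    unfolding ip_def[of r "(T ^^ k) x"] by (simp add: ip_unitv power2_eq_square)
  finally show ?thesis by (simp add: pow_sym)
qed

text \<open>A positive semidefinite form is bounded by its trace; here by Cauchy-Schwarz against
  each T^k e_i.\<close>

lemma mom_even_le_trace: "mom x (2 * k) \<le> ip r x x * op_trace r (T ^^ (2 * k))"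
  unfolding mom_even trace_even sum_distrib_left
  by (intro sum_mono) (metis ip_Cauchy_Schwarz mult.commute)

end

section \<open>The expected trace along the draws and the tail bound\<close>

text \<open>\<open>f\<close> is the outcome of the draws, and \<kappa> is a step size to be chosen
  so small that the operator stays above half the identity for every outcome.\<close>

definition downdates :: "real \<Rightarrow> nat \<Rightarrow> nat \<Rightarrow> (nat \<Rightarrow> nat \<Rightarrow> real) \<Rightarrow> (nat \<Rightarrow> nat) \<Rightarrow>
    (nat \<Rightarrow> real) \<Rightarrow> nat \<Rightarrow> real" where
  "downdates \<kappa> r J v f x = (\<lambda>i. x i - \<kappa> * (\<Sum>j<J. ip r (v (f j)) x * v (f j) i))"

lemma ip_downdates:
  "ip r y (downdates \<kappa> r J v f x) = ip r y x - \<kappa> * (\<Sum>j<J. ip r (v (f j)) x * ip r (v (f j)) y)"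
proof -
  have "ip r y (downdates \<kappa> r J v f x)
      = ip r y x - \<kappa> * ip r y (\<lambda>i. \<Sum>j<J. ip r (v (f j)) x * v (f j) i)"
    unfolding downdates_def by (rule ip_sub_right)
  also have "ip r y (\<lambda>i. \<Sum>j<J. ip r (v (f j)) x * v (f j) i)
      = (\<Sum>j<J. ip r (\<lambda>i. ip r (v (f j)) x * v (f j) i) y)"
    unfolding ip_commute[of r y] by (rule ip_sum_left)
  finally show ?thesis by (simp add: ip_scale)
qed

lemma half_op_downdates:
  assumes "0 \<le> \<kappa>" "\<And>j. j < J \<Longrightarrow> ip r (v (f j)) (v (f j)) \<le> L" "\<kappa> * real J * L \<le> 1 / 2"
  shows "half_op r (downdates \<kappa> r J v f)"
proof
  fix x y :: "nat \<Rightarrow> real" and a b :: real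
  show "downdates \<kappa> r J v f (\<lambda>i. a * x i + b * y i)
      = (\<lambda>i. a * downdates \<kappa> r J v f x i + b * downdates \<kappa> r J v f y i)"
    unfolding downdates_def ip_lin_right
    by (rule ext) (simp add: algebra_simps sum.distrib sum_distrib_left)
  show "ip r x (downdates \<kappa> r J v f y) = ip r (downdates \<kappa> r J v f x) y"
    unfolding ip_commute[of r _ y] ip_downdates by (simp add: ip_commute[of r y x] mult.commute)
  have sq: "ip r x (downdates \<kappa> r J v f x) = ip r x x - \<kappa> * (\<Sum>j<J. (ip r (v (f j)) x)\<^sup>2)"
    by (simp add: ip_downdates power2_eq_square)
  have "(\<Sum>j<J. (ip r (v (f j)) x)\<^sup>2) \<le> (\<Sum>j<J. L * ip r x x)"
  proof (rule sum_mono)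
    fix j assume "j \<in> {..<J}"
    then have "ip r (v (f j)) (v (f j)) * ip r x x \<le> L * ip r x x"
      by (intro mult_right_mono assms ip_self_nonneg) auto
    then show "(ip r (v (f j)) x)\<^sup>2 \<le> L * ip r x x"
      using ip_Cauchy_Schwarz[of r "v (f j)" x] by linarith
  qed
  then have "\<kappa> * (\<Sum>j<J. (ip r (v (f j)) x)\<^sup>2) \<le> \<kappa> * (real J * (L * ip r x x))"
    using assms(1) by (intro mult_left_mono) auto
  also have "\<dots> = \<kappa> * real J * L * ip r x x" by simp
  also have "\<dots> \<le> 1 / 2 * ip r x x" by (intro mult_right_mono assms ip_self_nonneg)
  finally show "ip r x x / 2 \<le> ip r x (downdates \<kappa> r J v f x)" unfolding sq by simp
  have "0 \<le> \<kappa> * (\<Sum>j<J. (ip r (v (f j)) x)\<^sup>2)"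
    using assms(1) by (intro mult_nonneg_nonneg sum_nonneg) auto
  then show "ip r x (downdates \<kappa> r J v f x) \<le> ip r x x" unfolding sq by simp
qed

text \<open>The mean of v^T T^(2k) v is the trace of T^k E[v v^T] T^k, as \<open>T\<close> does not
  depend on the draw.\<close>

lemma expectation_quadratic_even_pow:
  assumes "half_op r T" "finite (set_pmf q)"
    and cov: "\<And>x. \<mu> * ip r x x \<le> mean q (\<lambda>i. (ip r (v i) x)\<^sup>2)"
  shows "\<mu> * op_trace r (T ^^ (2 * k))
    \<le> mean q (\<lambda>i. ip r (v i) ((T ^^ (2 * k)) (v i)))"
proof -
  interpret half_op r T by fact
  have "mean q (\<lambda>i. ip r (v i) ((T ^^ (2 * k)) (v i)))
      = (\<Sum>l<r. mean q (\<lambda>i. (ip r (v i) ((T ^^ k) (unitv l)))\<^sup>2))"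
    unfolding mom_even
    by (subst Bochner_Integration.integral_sum)
       (auto intro: integrable_measure_pmf_finite assms simp: ip_commute)
  also have "\<dots> \<ge> (\<Sum>l<r. \<mu> * ip r ((T ^^ k) (unitv l)) ((T ^^ k) (unitv l)))"
    by (intro sum_mono cov)
  finally show ?thesis unfolding trace_even sum_distrib_left .
qed

lemma expectation_mono_pmf:
  fixes f g :: "'a \<Rightarrow> real"
  assumes "finite (set_pmf p)" "\<And>x. x \<in> set_pmf p \<Longrightarrow> f x \<le> g x"
  shows "mean p f \<le> mean p g"
  using assms by (intro integral_mono_AE) (auto simp: AE_measure_pmf_iff intro: integrable_measure_pmf_finite)

lemma expectation_pair_pmf_finite:
  fixes f :: "'a \<times> 'b \<Rightarrow> real"
  assumes "finite (set_pmf p)" "finite (set_pmf q)"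
  shows "mean (pair_pmf p q) f
    = mean q (\<lambda>y. mean p (\<lambda>x. f (x, y)))"
proof -
  have "mean (pair_pmf p q) f
      = (\<Sum>z\<in>set_pmf p \<times> set_pmf q. f z * pmf (pair_pmf p q) z)"
    by (rule integral_measure_pmf_real) (use assms in auto)
  also have "\<dots> = (\<Sum>x\<in>set_pmf p. \<Sum>y\<in>set_pmf q. f (x, y) * (pmf p x * pmf q y))"
    unfolding sum.cartesian_product by (intro sum.cong) (auto simp: pmf_pair)
  also have "\<dots> = (\<Sum>y\<in>set_pmf q. (\<Sum>x\<in>set_pmf p. f (x, y) * pmf p x) * pmf q y)"
    unfolding sum_distrib_right by (subst sum.swap) (simp add: mult_ac)
  also have "\<dots> = mean q (\<lambda>y. \<Sum>x\<in>set_pmf p. f (x, y) * pmf p x)"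
    by (rule integral_measure_pmf_real[symmetric]) (use assms in auto)
  also have "\<dots> = mean q (\<lambda>y. mean p (\<lambda>x. f (x, y)))"
    by (intro Bochner_Integration.integral_cong refl integral_measure_pmf_real[symmetric]) (use assms in auto)
  finally show ?thesis .
qed

lemma finite_set_Pi_pmf:
  assumes "finite A" "\<And>x. x \<in> A \<Longrightarrow> finite (set_pmf (p x))"
  shows "finite (set_pmf (Pi_pmf A d p))"
  unfolding set_Pi_pmf[OF assms(1)] using assms by (intro finite_PiE_dflt) auto

lemma Pi_pmf_range:
  assumes "f \<in> set_pmf (Pi_pmf A d p)" "finite A" "j \<in> A"
  shows "f j \<in> set_pmf (p j)"
  using assms unfolding set_Pi_pmf[OF assms(2)] PiE_dflt_def by auto

text \<open>Given the first \<open>J\<close> draws, a further one lowers the trace by at least 3/4 p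
  \<kappa> v^T T^p v with p = 2 k. The mean of v^T T^p v is at least \<mu> times the trace, so the
  expected trace contracts by a fixed factor.\<close>

lemma expectation_trace_step:
  fixes L \<kappa> :: real
  assumes q: "finite (set_pmf q)" "\<And>i. i \<in> set_pmf q \<Longrightarrow> ip r (v i) (v i) \<le> L"
    and cov: "\<And>x. \<mu> * ip r x x \<le> mean q (\<lambda>i. (ip r (v i) x)\<^sup>2)"
    and p: "0 < k" "0 < \<kappa>" "2 * real (2 * k) * \<kappa> * L \<le> 1 / 4" "\<kappa> * real (Suc J) * L \<le> 1 / 2"
    and f: "\<And>j. j < J \<Longrightarrow> f j \<in> set_pmf q"
  shows "mean q (\<lambda>i. op_trace r (downdates \<kappa> r (Suc J) v (f(J := i)) ^^ (2 * k)))
    \<le> (1 - 3 / 4 * real (2 * k) * \<kappa> * \<mu>) * op_trace r (downdates \<kappa> r J v f ^^ (2 * k))"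
proof -
  let ?T = "downdates \<kappa> r J v f" and ?p = "2 * k"
  obtain i0 where "i0 \<in> set_pmf q" using set_pmf_not_empty[of q] by blast
  then have L: "0 \<le> L" using q(2)[of i0] ip_self_nonneg[of r "v i0"] by linarith
  have "\<kappa> * real J * L \<le> \<kappa> * real (Suc J) * L"
    using p L by (intro mult_right_mono mult_left_mono) auto
  then have "\<kappa> * real J * L \<le> 1 / 2" using p by linarith
  then have T: "half_op r ?T"
    using p f q by (intro half_op_downdates[where L = L]) auto
  then interpret half_op r ?T .
  have step: "op_trace r (downdates \<kappa> r (Suc J) v (f(J := i)) ^^ ?p)
      \<le> op_trace r (?T ^^ ?p) - 3 / 4 * real ?p * \<kappa> * ip r (v i) ((?T ^^ ?p) (v i))"
    if i: "i \<in> set_pmf q" for i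
  proof -
    define T' where "T' = downdates \<kappa> r (Suc J) v (f(J := i))"
    \<comment> \<open>The square root absorbs the step size, so that the new operator is the old one
      minus u u^T.\<close>
    define u where "u = (\<lambda>l. sqrt \<kappa> * v i l)"
    have "half_op r T'"
      unfolding T'_def using p f q i by (intro half_op_downdates[where L = L]) (auto simp: less_Suc_eq)
    then interpret dd: half_op r T' .
    interpret rank_one_downdate r ?T T' u
    proof
      fix x
      have "ip r u x * u l = \<kappa> * (ip r (v i) x * v i l)" for l
        using p(2) by (simp add: u_def ip_scale)
      moreover have "(\<Sum>j<J. ip r (v ((f(J := i)) j)) x * v ((f(J := i)) j) l)
          = (\<Sum>j<J. ip r (v (f j)) x * v (f j) l)" for l
        by (intro sum.cong) auto
      ultimately show "T' x = (\<lambda>l. ?T x l - ip r u x * u l)"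
        unfolding T'_def downdates_def sum.lessThan_Suc by (simp add: algebra_simps)
    qed
    have u: "ip r u u = \<kappa> * ip r (v i) (v i)"
      using p(2) by (simp add: u_def ip_scale)
    have "2 * real ?p * ip r u u \<le> 2 * real ?p * (\<kappa> * L)"
      unfolding u using p q(2)[OF i] by (intro mult_left_mono) auto
    also have "\<dots> = 2 * real ?p * \<kappa> * L" by simp
    finally have "2 * real ?p * ip r u u \<le> 1 / 4" using p(3) by linarith
    then have "op_trace r (T' ^^ ?p) \<le> op_trace r (?T ^^ ?p) - 3 / 4 * real ?p * mom u (?p - 1)"
      by (rule trace_downdate)
    note trace = this
    \<comment> \<open>Exchanges the odd moment of the downdate for the even one, whose mean is
      bounded below by the trace.\<close>
    have "mom u (2 * k) \<le> mom u (?p - 1)"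
      using mom_even_le[of u "k - 1"] p(1) by simp
    moreover have "mom u (2 * k) = \<kappa> * mom (v i) (2 * k)"
    proof -
      have "(?T ^^ ?p) u = (\<lambda>l. sqrt \<kappa> * (?T ^^ ?p) (v i) l)"
        using pow_lin[of ?p "sqrt \<kappa>" "v i" 0 "v i"] by (simp add: u_def)
      then show ?thesis using p(2) by (simp add: u_def ip_scale)
    qed
    ultimately have "\<kappa> * ip r (v i) ((?T ^^ ?p) (v i)) \<le> mom u (?p - 1)" by linarith
    then have "3 / 4 * real ?p * (\<kappa> * ip r (v i) ((?T ^^ ?p) (v i))) \<le> 3 / 4 * real ?p * mom u (?p - 1)"
      by (intro mult_left_mono) auto
    then show ?thesis
      using trace unfolding T'_def by (simp only: mult.assoc)
  qed
  let ?E = "mean q (\<lambda>i. ip r (v i) ((?T ^^ ?p) (v i)))"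
  have "mean q (\<lambda>i. op_trace r (downdates \<kappa> r (Suc J) v (f(J := i)) ^^ ?p))
      \<le> mean q
          (\<lambda>i. op_trace r (?T ^^ ?p) - 3 / 4 * real ?p * \<kappa> * ip r (v i) ((?T ^^ ?p) (v i)))"
    by (intro expectation_mono_pmf q step)
  also have "\<dots> = op_trace r (?T ^^ ?p) - 3 / 4 * real ?p * \<kappa> * ?E"
    by (subst Bochner_Integration.integral_diff) (auto intro: integrable_measure_pmf_finite q)
  also have "\<dots> \<le> op_trace r (?T ^^ ?p) - 3 / 4 * real ?p * \<kappa> * (\<mu> * op_trace r (?T ^^ ?p))"
  proof -
    have "\<mu> * op_trace r (?T ^^ ?p) \<le> ?E"
      by (intro expectation_quadratic_even_pow T q cov)
    then show ?thesis using p by (intro diff_left_mono mult_left_mono) auto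
  qed
  finally show ?thesis by (simp add: algebra_simps)
qed

lemma expectation_trace_downdates:
  fixes L \<kappa> \<mu> :: real
  assumes q: "finite (set_pmf q)" "\<And>i. i \<in> set_pmf q \<Longrightarrow> ip r (v i) (v i) \<le> L"
    and cov: "\<And>x. \<mu> * ip r x x \<le> mean q (\<lambda>i. (ip r (v i) x)\<^sup>2)"
    and p: "0 < k" "0 < \<kappa>" "2 * real (2 * k) * \<kappa> * L \<le> 1 / 4"
    and J: "\<kappa> * real J * L \<le> 1 / 2" and pos: "3 / 4 * real (2 * k) * \<kappa> * \<mu> \<le> 1"
  shows "mean (Pi_pmf {..<J} 0 (\<lambda>_. q))
      (\<lambda>f. op_trace r (downdates \<kappa> r J v f ^^ (2 * k)))
    \<le> real r * (1 - 3 / 4 * real (2 * k) * \<kappa> * \<mu>) ^ J"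
  using J
proof (induction J)
  case 0
  have "(downdates \<kappa> r 0 v f ^^ m) x = x" for f m x
    by (induction m) (simp_all add: downdates_def)
  then show ?case by (simp add: op_trace_def unitv_def)
next
  case (Suc J)
  let ?g = "1 - 3 / 4 * real (2 * k) * \<kappa> * \<mu>"
  let ?P = "Pi_pmf {..<J} 0 (\<lambda>_. q)"
  let ?tr = "\<lambda>J f. op_trace r (downdates \<kappa> r J v f ^^ (2 * k))"
  obtain i0 where "i0 \<in> set_pmf q" using set_pmf_not_empty[of q] by blast
  then have L: "0 \<le> L" using q(2)[of i0] ip_self_nonneg[of r "v i0"] by linarith
  have fin: "finite (set_pmf ?P)" by (intro finite_set_Pi_pmf q) auto
  have le: "\<kappa> * real J * L \<le> 1 / 2"
  proof -
    have "\<kappa> * real J * L \<le> \<kappa> * real (Suc J) * L"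
      using p L by (intro mult_right_mono mult_left_mono) auto
    then show ?thesis using Suc.prems by linarith
  qed
  have "mean (Pi_pmf {..<Suc J} 0 (\<lambda>_. q)) (?tr (Suc J))
      = mean (pair_pmf q ?P) (\<lambda>(i, f). ?tr (Suc J) (f(J := i)))"
    unfolding lessThan_Suc by (subst Pi_pmf_insert) (auto simp: case_prod_unfold)
  also have "\<dots> = mean ?P
      (\<lambda>f. mean q (\<lambda>i. ?tr (Suc J) (f(J := i))))"
    using expectation_pair_pmf_finite[OF q(1) fin] by simp
  also have "\<dots> \<le> mean ?P (\<lambda>f. ?g * ?tr J f)"
    using Suc.prems by (intro expectation_mono_pmf fin expectation_trace_step[where L = L] q cov p)
      (auto dest!: Pi_pmf_range)
  also have "\<dots> = ?g * mean ?P (?tr J)" by simp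
  also have "\<dots> \<le> ?g * (real r * ?g ^ J)"
    using pos Suc.IH[OF le] by (intro mult_left_mono) auto
  finally show ?case by (simp add: mult_ac)
qed

text \<open>A direction whose sampled sum of squares is below J/4 |x|^2, against a mean of at least
  2/3 J |x|^2, has Rayleigh quotient at least 1 - \<theta>/8, which makes the trace of the power 2 J
  at least \<tau>. The mean of that trace is at most r (1 - \<theta>/2)^J, and Markov's inequality
  compares the two.\<close>

lemma matrix_chernoff_lower:
  fixes L :: real and v :: "nat \<Rightarrow> nat \<Rightarrow> real"
  assumes q: "finite (set_pmf q)" "\<And>i. i \<in> set_pmf q \<Longrightarrow> ip r (v i) (v i) \<le> L"
    and cov: "\<And>x. 2 / 3 * ip r x x \<le> mean q (\<lambda>i. (ip r (v i) x)\<^sup>2)"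
    and L: "1 / 2 \<le> L" and J: "0 < J"
  shows "measure_pmf.prob (Pi_pmf {..<J} 0 (\<lambda>_. q))
      {f. \<exists>x. (\<Sum>j<J. (ip r (v (f j)) x)\<^sup>2) < real J / 4 * ip r x x}
    \<le> real r * exp (- real J / (32 * L))"
proof -
  let ?P = "Pi_pmf {..<J} 0 (\<lambda>_. q)"
  \<comment> \<open>With p = 2 J and \<theta> = p \<kappa>, this value gives equality in the
    downdate condition 2 p \<kappa> L \<le> 1/4. Taking p proportional to J makes \<kappa> J
    constant, so the operator stays above half the identity through all J draws.\<close>
  define \<theta> where "\<theta> = 1 / (8 * L)"
  define \<kappa> where "\<kappa> = \<theta> / real (2 * J)"
  have \<theta>: "0 < \<theta>" "\<theta> \<le> 1 / 4" "\<theta> * L = 1 / 8" using L by (simp_all add: \<theta>_def field_simps)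
  have \<kappa>: "0 < \<kappa>" "real (2 * J) * \<kappa> = \<theta>" using \<theta> J by (simp_all add: \<kappa>_def)
  have \<kappa>L: "2 * real (2 * J) * \<kappa> * L \<le> 1 / 4" "\<kappa> * real J * L \<le> 1 / 2"
    using \<theta>(3) unfolding \<kappa>(2)[symmetric] by (simp_all add: mult_ac)
  let ?tr = "\<lambda>f. op_trace r (downdates \<kappa> r J v f ^^ (2 * J))"
  define \<tau> where "\<tau> = (1 - \<theta> / 8) ^ (2 * J)"
  have \<tau>: "0 < \<tau>" unfolding \<tau>_def using \<theta> by (intro zero_less_power) auto
  have fin: "finite (set_pmf ?P)" by (intro finite_set_Pi_pmf q) auto
  have T: "half_op r (downdates \<kappa> r J v f)" if "f \<in> set_pmf ?P" for f
    using \<kappa> \<kappa>L q Pi_pmf_range[OF that] by (intro half_op_downdates[where L = L]) auto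
  have big: "\<tau> \<le> ?tr f"
    if f: "f \<in> set_pmf ?P" and x: "(\<Sum>j<J. (ip r (v (f j)) x)\<^sup>2) < real J / 4 * ip r x x" for f x
  proof -
    interpret half_op r "downdates \<kappa> r J v f" by (rule T[OF f])
    have "0 \<le> (\<Sum>j<J. (ip r (v (f j)) x)\<^sup>2)" by (intro sum_nonneg) auto
    then have "0 < real J / 4 * ip r x x" using x by linarith
    then have xx: "0 < ip r x x" using J by (simp add: zero_less_mult_iff)
    have "\<kappa> * (\<Sum>j<J. (ip r (v (f j)) x)\<^sup>2) \<le> \<kappa> * (real J / 4 * ip r x x)"
      using x \<kappa> by (intro mult_left_mono) auto
    also have "\<dots> = \<theta> / 8 * ip r x x" unfolding \<kappa>(2)[symmetric] by simp
    finally have "(1 - \<theta> / 8) * ip r x x \<le> ip r x (downdates \<kappa> r J v f x)"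
      by (simp add: ip_downdates power2_eq_square algebra_simps)
    then have "1 - \<theta> / 8 \<le> ip r x (downdates \<kappa> r J v f x) / ip r x x"
      using xx by (simp add: field_simps)
    then have "\<tau> \<le> (ip r x (downdates \<kappa> r J v f x) / ip r x x) ^ (2 * J)"
      unfolding \<tau>_def using \<theta> by (intro power_mono) auto
    then have "ip r x x * \<tau> \<le> ip r x x * (ip r x (downdates \<kappa> r J v f x) / ip r x x) ^ (2 * J)"
      using xx by (intro mult_left_mono) auto
    also have "\<dots> \<le> mom x (2 * J)" by (rule mom_ge_power[OF xx])
    also have "\<dots> \<le> ip r x x * ?tr f" by (rule mom_even_le_trace)
    finally show ?thesis using xx by simp
  qed
  have tr_nonneg: "0 \<le> ?tr f" if "f \<in> set_pmf ?P" for f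
  proof -
    interpret half_op r "downdates \<kappa> r J v f" by (rule T[OF that])
    show ?thesis unfolding trace_even by (intro sum_nonneg ip_self_nonneg)
  qed
  have rate: "3 / 4 * real (2 * J) * \<kappa> * (2 / 3) = \<theta> / 2"
    unfolding \<kappa>(2)[symmetric] by simp
  let ?B = "{f. \<exists>x. (\<Sum>j<J. (ip r (v (f j)) x)\<^sup>2) < real J / 4 * ip r x x}"
  have "measure_pmf.prob ?P ?B * \<tau> = mean ?P (\<lambda>f. indicator ?B f * \<tau>)"
    by simp
  also have "\<dots> \<le> mean ?P ?tr"
  proof (rule expectation_mono_pmf[OF fin])
    fix f assume f: "f \<in> set_pmf ?P"
    then show "indicator ?B f * \<tau> \<le> ?tr f"
      using big[OF f] tr_nonneg[OF f] by (auto simp: indicator_def)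
  qed
  also have "\<dots> \<le> real r * (1 - \<theta> / 2) ^ J"
  proof -
    have "3 / 4 * real (2 * J) * \<kappa> * (2 / 3) \<le> 1"
      unfolding rate using \<theta> by simp
    from expectation_trace_downdates[OF q cov J \<kappa>(1) \<kappa>L this]
    have "mean ?P ?tr \<le> real r * (1 - 3 / 4 * real (2 * J) * \<kappa> * (2 / 3)) ^ J" by simp
    then show ?thesis unfolding rate .
  qed
  also have "\<dots> \<le> real r * ((1 - \<theta> / 4) ^ J * \<tau>)"
  proof -
    \<comment> \<open>One factor 1 - \<theta>/4 is at most (1 - \<theta>/8)^2 and pays for \<tau>;
      the other is the rate that remains.\<close>
    have "1 - \<theta> / 2 \<le> (1 - \<theta> / 4) * (1 - \<theta> / 4)" by (simp add: algebra_simps)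
    also have "1 - \<theta> / 4 \<le> (1 - \<theta> / 8)\<^sup>2"
      by (simp add: power2_eq_square algebra_simps)
    then have "(1 - \<theta> / 4) * (1 - \<theta> / 4) \<le> (1 - \<theta> / 4) * (1 - \<theta> / 8)\<^sup>2"
      using \<theta> by (intro mult_left_mono) auto
    finally have "(1 - \<theta> / 2) ^ J \<le> ((1 - \<theta> / 4) * (1 - \<theta> / 8)\<^sup>2) ^ J"
      using \<theta> by (intro power_mono) auto
    then show ?thesis
      unfolding \<tau>_def power_mult_distrib power_mult[of _ 2 J] by (intro mult_left_mono) auto
  qed
  finally have "measure_pmf.prob ?P ?B * \<tau> \<le> (real r * (1 - \<theta> / 4) ^ J) * \<tau>"
    by (simp only: mult.assoc)
  then have "measure_pmf.prob ?P ?B \<le> real r * (1 - \<theta> / 4) ^ J"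
    using \<tau> by (simp only: mult_le_cancel_right_pos)
  also have "\<dots> \<le> real r * exp (- (\<theta> / 4)) ^ J"
    using \<theta> exp_ge_add_one_self[of "- (\<theta> / 4)"] by (intro mult_left_mono power_mono) auto
  also have "exp (- (\<theta> / 4)) ^ J = exp (- real J / (32 * L))"
    unfolding exp_of_nat_mult[symmetric] \<theta>_def by (simp add: mult.commute)
  finally show ?thesis .
qed

section \<open>Random matrices preserving inner products\<close>

lemma expectation_cong_pmf:
  fixes f g :: "'a \<Rightarrow> real"
  assumes "\<And>x. x \<in> set_pmf p \<Longrightarrow> f x = g x"
  shows "mean p f = mean p g"
  using assms by (intro integral_cong_AE) (auto simp: AE_measure_pmf_iff)

lemma expectation_Cauchy_Schwarz:
  fixes f g :: "'a \<Rightarrow> real"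
  assumes "finite (set_pmf p)"
  shows "(mean p (\<lambda>x. f x * g x))\<^sup>2
    \<le> mean p (\<lambda>x. (f x)\<^sup>2) * mean p (\<lambda>x. (g x)\<^sup>2)"
proof (rule discriminant_bound)
  note int = integrable_measure_pmf_finite[OF assms]
  fix t :: real
  have "0 \<le> mean p (\<lambda>x. (f x + t * g x)\<^sup>2)" by simp
  also have "(\<lambda>x. (f x + t * g x)\<^sup>2) = (\<lambda>x. (f x)\<^sup>2 + (2 * t) * (f x * g x) + t\<^sup>2 * (g x)\<^sup>2)"
    by (simp add: power2_eq_square algebra_simps)
  also have "mean p \<dots> = mean p (\<lambda>x. (f x)\<^sup>2)
      + 2 * t * mean p (\<lambda>x. f x * g x) + t\<^sup>2 * mean p (\<lambda>x. (g x)\<^sup>2)"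
    by (simp add: int)
  finally show "0 \<le> mean p (\<lambda>x. (f x)\<^sup>2)
      + 2 * t * mean p (\<lambda>x. f x * g x) + t\<^sup>2 * mean p (\<lambda>x. (g x)\<^sup>2)" .
qed simp

lemma expectation_mult_le:
  fixes f g :: "'a \<Rightarrow> real"
  assumes "finite (set_pmf p)"
    and "mean p (\<lambda>x. (f x)\<^sup>2) \<le> c * a\<^sup>2" "mean p (\<lambda>x. (g x)\<^sup>2) \<le> c * b\<^sup>2"
    and "0 \<le> a" "0 \<le> b" "0 \<le> c"
  shows "mean p (\<lambda>x. f x * g x) \<le> c * (a * b)"
proof (rule power2_le_imp_le)
  have "(mean p (\<lambda>x. f x * g x))\<^sup>2 \<le> (c * a\<^sup>2) * (c * b\<^sup>2)"
    by (rule order_trans[OF expectation_Cauchy_Schwarz[OF assms(1)] mult_mono]) (use assms in auto)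
  then show "(mean p (\<lambda>x. f x * g x))\<^sup>2 \<le> (c * (a * b))\<^sup>2"
    by (simp add: power2_eq_square mult_ac)
qed (use assms in simp)

abbreviation sqn :: "real Matrix.vec \<Rightarrow> real" where
  "sqn x \<equiv> scalar_prod x x"

lemma sqn_nonneg: "0 \<le> sqn x"
  unfolding scalar_prod_def by (intro sum_nonneg) simp

definition dot_err :: "real mat \<Rightarrow> real Matrix.vec \<Rightarrow> real Matrix.vec \<Rightarrow> real" where
  "dot_err S x y = scalar_prod (S *\<^sub>v x) (S *\<^sub>v y) - scalar_prod x y"

text \<open>Keeping \<open>b - 1\<close> rather than \<open>b\<close> as the variance bound makes \<open>b\<close> multiplicative under
  composition.\<close>

definition dot_preserving :: "nat \<Rightarrow> nat \<Rightarrow> real \<Rightarrow> real mat pmf \<Rightarrow> bool" where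
  "dot_preserving m n b P \<longleftrightarrow> finite (set_pmf P) \<and> set_pmf P \<subseteq> carrier_mat m n \<and> 1 \<le> b \<and>
     (\<forall>x\<in>carrier_vec n. \<forall>y\<in>carrier_vec n.
        mean P (\<lambda>S. dot_err S x y) = 0 \<and>
        mean P (\<lambda>S. (dot_err S x y)\<^sup>2) \<le> (b - 1) * (sqn x * sqn y))"

lemma dot_preservingD:
  assumes "dot_preserving m n b P"
  shows "finite (set_pmf P)" "S \<in> set_pmf P \<Longrightarrow> S \<in> carrier_mat m n" "1 \<le> b"
    and "x \<in> carrier_vec n \<Longrightarrow> y \<in> carrier_vec n \<Longrightarrow> mean P (\<lambda>S. dot_err S x y) = 0"
    and "x \<in> carrier_vec n \<Longrightarrow> y \<in> carrier_vec n \<Longrightarrow>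
      mean P (\<lambda>S. (dot_err S x y)\<^sup>2) \<le> (b - 1) * (sqn x * sqn y)"
  using assms unfolding dot_preserving_def by auto

lemma dot_preserving_mono:
  assumes "dot_preserving m n b P" "b \<le> b'"
  shows "dot_preserving m n b' P"
proof -
  have "(b - 1) * (sqn x * sqn y) \<le> (b' - 1) * (sqn x * sqn y)" for x y
    using assms(2) by (intro mult_right_mono mult_nonneg_nonneg sqn_nonneg) auto
  then show ?thesis
    using assms unfolding dot_preserving_def by (meson order_trans)
qed

lemma dot_preserving_return:
  assumes "A \<in> carrier_mat m n"
    and "\<And>x y. x \<in> carrier_vec n \<Longrightarrow> y \<in> carrier_vec n \<Longrightarrow>
      scalar_prod (A *\<^sub>v x) (A *\<^sub>v y) = scalar_prod x y"
  shows "dot_preserving m n 1 (return_pmf A)"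
  using assms unfolding dot_preserving_def dot_err_def by simp

text \<open>The error has mean zero, so the second moment of |S x|^2 is the variance plus |x|^4.
  This is where \<open>b\<close> itself, not \<open>b - 1\<close>, appears.\<close>

lemma dot_preserving_sqn2:
  assumes P: "dot_preserving m n b P" and x: "x \<in> carrier_vec n"
  shows "mean P (\<lambda>S. (sqn (S *\<^sub>v x))\<^sup>2) \<le> b * (sqn x)\<^sup>2"
proof -
  note int = integrable_measure_pmf_finite[OF dot_preservingD(1)[OF P]]
  have "(\<lambda>S. (sqn (S *\<^sub>v x))\<^sup>2) = (\<lambda>S. (dot_err S x x)\<^sup>2 + (2 * sqn x) * dot_err S x x + (sqn x)\<^sup>2)"
    by (simp add: dot_err_def power2_eq_square algebra_simps)
  then have "mean P (\<lambda>S. (sqn (S *\<^sub>v x))\<^sup>2)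
      = mean P (\<lambda>S. (dot_err S x x)\<^sup>2) + (sqn x)\<^sup>2"
    by (simp add: int dot_preservingD(4)[OF P x x])
  then show ?thesis
    using dot_preservingD(5)[OF P x x] by (simp add: power2_eq_square algebra_simps)
qed

text \<open>The error of B A at x, y is the error of B at A x, A y plus the error of A at x, y.
  Given A the first has mean zero, so no cross term survives and the variances add up to (b - 1) c +
  (c - 1) = b c - 1.\<close>

lemma dot_preserving_mult:
  assumes P: "dot_preserving l m b P" and Q: "dot_preserving m n c Q"
  shows "dot_preserving l n (b * c) (map_pmf (\<lambda>(B, A). B * A) (pair_pmf P Q))"
proof -
  note fin = dot_preservingD(1)[OF P] dot_preservingD(1)[OF Q]
  note int = integrable_measure_pmf_finite[OF fin(1)] integrable_measure_pmf_finite[OF fin(2)]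
  let ?E = "\<lambda>f. mean (map_pmf (\<lambda>(B, A). B * A) (pair_pmf P Q)) f"
  have E: "?E f = mean Q (\<lambda>A. mean P (\<lambda>B. f (B * A)))"
    for f :: "real mat \<Rightarrow> real"
    using fin by (simp add: expectation_pair_pmf_finite)
  have b: "1 \<le> b" and c: "1 \<le> c" using dot_preservingD(3)[OF P] dot_preservingD(3)[OF Q] .
  have bc: "1 \<le> b * c" using mult_mono[of 1 b 1 c] b c by simp
  have moments: "?E (\<lambda>S. dot_err S x y) = 0 \<and> ?E (\<lambda>S. (dot_err S x y)\<^sup>2) \<le> (b * c - 1) * (sqn x * sqn y)"
    if x: "x \<in> carrier_vec n" and y: "y \<in> carrier_vec n" for x y
  proof
    have split: "dot_err (B * A) x y = dot_err B (A *\<^sub>v x) (A *\<^sub>v y) + dot_err A x y"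
      if "B \<in> set_pmf P" "A \<in> set_pmf Q" for A B
      using assoc_mult_mat_vec[of B l m A n] dot_preservingD(2)[OF P] dot_preservingD(2)[OF Q] that x y
      by (simp add: dot_err_def)
    have Ax: "A *\<^sub>v x \<in> carrier_vec m" "A *\<^sub>v y \<in> carrier_vec m" if "A \<in> set_pmf Q" for A
      using dot_preservingD(2)[OF Q that] x y by auto
    have "mean P (\<lambda>B. dot_err (B * A) x y) = dot_err A x y" if A: "A \<in> set_pmf Q" for A
    proof -
      have "mean P (\<lambda>B. dot_err (B * A) x y)
          = mean P (\<lambda>B. dot_err B (A *\<^sub>v x) (A *\<^sub>v y) + dot_err A x y)"
        by (rule expectation_cong_pmf) (use split A in auto)
      then show ?thesis by (simp add: int dot_preservingD(4)[OF P Ax[OF A]])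
    qed
    then show "?E (\<lambda>S. dot_err S x y) = 0"
      unfolding E using dot_preservingD(4)[OF Q x y]
      by (simp cong: expectation_cong_pmf)
    have "mean P (\<lambda>B. (dot_err (B * A) x y)\<^sup>2)
        \<le> (b - 1) * (sqn (A *\<^sub>v x) * sqn (A *\<^sub>v y)) + (dot_err A x y)\<^sup>2" if A: "A \<in> set_pmf Q" for A
    proof -
      have "mean P (\<lambda>B. (dot_err (B * A) x y)\<^sup>2)
          = mean P (\<lambda>B. (dot_err B (A *\<^sub>v x) (A *\<^sub>v y))\<^sup>2
              + (2 * dot_err A x y) * dot_err B (A *\<^sub>v x) (A *\<^sub>v y) + (dot_err A x y)\<^sup>2)"
        by (rule expectation_cong_pmf) (use split A in \<open>auto simp: power2_eq_square algebra_simps\<close>)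
      also have "\<dots> = mean P (\<lambda>B. (dot_err B (A *\<^sub>v x) (A *\<^sub>v y))\<^sup>2) + (dot_err A x y)\<^sup>2"
        by (simp add: int dot_preservingD(4)[OF P Ax[OF A]])
      finally show ?thesis using dot_preservingD(5)[OF P Ax[OF A]] by simp
    qed
    then have "?E (\<lambda>S. (dot_err S x y)\<^sup>2) \<le> mean Q
        (\<lambda>A. (b - 1) * (sqn (A *\<^sub>v x) * sqn (A *\<^sub>v y)) + (dot_err A x y)\<^sup>2)"
      unfolding E by (intro expectation_mono_pmf fin)
    also have "\<dots> = (b - 1) * mean Q (\<lambda>A. sqn (A *\<^sub>v x) * sqn (A *\<^sub>v y))
        + mean Q (\<lambda>A. (dot_err A x y)\<^sup>2)"
      by (simp add: int)
    also have "\<dots> \<le> (b - 1) * (c * (sqn x * sqn y)) + (c - 1) * (sqn x * sqn y)"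
      using b c by (intro add_mono mult_left_mono expectation_mult_le fin dot_preserving_sqn2[OF Q]
          dot_preservingD(5)[OF Q] x y sqn_nonneg) auto
    also have "\<dots> = (b * c - 1) * (sqn x * sqn y)" by (simp add: algebra_simps)
    finally show "?E (\<lambda>S. (dot_err S x y)\<^sup>2) \<le> (b * c - 1) * (sqn x * sqn y)" .
  qed
  have "B * A \<in> carrier_mat l n" if "B \<in> set_pmf P" "A \<in> set_pmf Q" for A B
    by (rule mult_carrier_mat[OF dot_preservingD(2)[OF P that(1)] dot_preservingD(2)[OF Q that(2)]])
  then show ?thesis
    unfolding dot_preserving_def using bc moments fin by auto
qed

text \<open>Covers block matrices that apply one and the same \<open>S\<close> to \<open>k\<close>
  slices of a vector. The slice errors are dependent, but Cauchy-Schwarz in expectation and then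
  over the slices controls every cross term, so the variance constant does not grow with
  \<open>k\<close>.\<close>

lemma dot_preserving_slices:
  assumes P: "dot_preserving m n b P"
    and F: "\<And>S. S \<in> set_pmf P \<Longrightarrow> F S \<in> carrier_mat m' n'"
    and sl: "\<And>x a. sl x a \<in> carrier_vec n"
    and img: "\<And>S x y. S \<in> set_pmf P \<Longrightarrow> x \<in> carrier_vec n' \<Longrightarrow> y \<in> carrier_vec n' \<Longrightarrow>
      scalar_prod (F S *\<^sub>v x) (F S *\<^sub>v y) = (\<Sum>a<k. scalar_prod (S *\<^sub>v sl x a) (S *\<^sub>v sl y a))"
    and dom: "\<And>x y. x \<in> carrier_vec n' \<Longrightarrow> y \<in> carrier_vec n' \<Longrightarrow>
      scalar_prod x y = (\<Sum>a<k. scalar_prod (sl x a) (sl y a))"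
  shows "dot_preserving m' n' b (map_pmf F P)"
proof -
  note fin = dot_preservingD(1)[OF P]
  note int = integrable_measure_pmf_finite[OF fin]
  have b: "1 \<le> b" using dot_preservingD(3)[OF P] .
  have moments: "mean P (\<lambda>S. dot_err (F S) x y) = 0 \<and>
      mean P (\<lambda>S. (dot_err (F S) x y)\<^sup>2) \<le> (b - 1) * (sqn x * sqn y)"
    if x: "x \<in> carrier_vec n'" and y: "y \<in> carrier_vec n'" for x y
  proof
    have split: "dot_err (F S) x y = (\<Sum>a<k. dot_err S (sl x a) (sl y a))" if "S \<in> set_pmf P" for S
      by (simp add: dot_err_def img[OF that x y] dom[OF x y] sum_subtractf)
    have "mean P (\<lambda>S. dot_err (F S) x y)
        = mean P (\<lambda>S. \<Sum>a<k. dot_err S (sl x a) (sl y a))"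
      by (rule expectation_cong_pmf) (rule split)
    also have "\<dots> = 0"
      by (subst Bochner_Integration.integral_sum) (auto simp: dot_preservingD(4)[OF P sl sl] int)
    finally show "mean P (\<lambda>S. dot_err (F S) x y) = 0" .
    let ?D = "\<lambda>a S. dot_err S (sl x a) (sl y a)" and ?s = "\<lambda>a. sqrt (sqn (sl x a)) * sqrt (sqn (sl y a))"
    have sq: "(?s a)\<^sup>2 = sqn (sl x a) * sqn (sl y a)" for a
      by (simp add: power_mult_distrib sqn_nonneg)
    have s0: "0 \<le> ?s a" for a by (simp add: sqn_nonneg)
    have le: "mean P (\<lambda>S. (?D a S)\<^sup>2) \<le> (b - 1) * (?s a)\<^sup>2" for a
      unfolding sq by (rule dot_preservingD(5)[OF P sl sl])
    have sqs: "(\<Sum>a<k. ?s a)\<^sup>2 = (\<Sum>a<k. \<Sum>a'<k. ?s a * ?s a')"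
      by (simp only: power2_eq_square sum_product)
    have "mean P (\<lambda>S. (dot_err (F S) x y)\<^sup>2)
        = mean P (\<lambda>S. \<Sum>a<k. \<Sum>a'<k. ?D a S * ?D a' S)"
      by (rule expectation_cong_pmf) (simp add: split power2_eq_square sum_product)
    also have "\<dots> = (\<Sum>a<k. \<Sum>a'<k. mean P (\<lambda>S. ?D a S * ?D a' S))"
      by (subst Bochner_Integration.integral_sum, simp add: int)+ simp
    also have "\<dots> \<le> (\<Sum>a<k. \<Sum>a'<k. (b - 1) * (?s a * ?s a'))"
      using b by (intro sum_mono expectation_mult_le fin le s0) auto
    also have "\<dots> = (b - 1) * (\<Sum>a<k. ?s a)\<^sup>2"
      by (simp only: sqs sum_distrib_left)
    also have "\<dots> \<le> (b - 1) * ((\<Sum>a<k. (sqrt (sqn (sl x a)))\<^sup>2) * (\<Sum>a<k. (sqrt (sqn (sl y a)))\<^sup>2))"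
      using b by (intro mult_left_mono Cauchy_Schwarz_ineq_sum) auto
    also have "\<dots> = (b - 1) * (sqn x * sqn y)"
      by (simp add: dom[OF x x] dom[OF y y] sqn_nonneg)
    finally show "mean P (\<lambda>S. (dot_err (F S) x y)\<^sup>2) \<le> (b - 1) * (sqn x * sqn y)" .
  qed
  show ?thesis unfolding dot_preserving_def using fin b F moments by auto
qed

section \<open>Kronecker products of random matrices\<close>

lemma sum_lessThan_mult:
  fixes f :: "nat \<Rightarrow> 'a :: comm_monoid_add"
  shows "(\<Sum>i<k * m. f i) = (\<Sum>a<k. \<Sum>j<m. f (a * m + j))"
proof -
  have "(\<Sum>j<m. f (a * m + j)) = sum f {a * m..<a * m + m}" for a
    using sum.shift_bounds_nat_ivl[of f 0 "a * m" m] by (simp add: atLeast0LessThan add.commute)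
  then show ?thesis by (simp add: sum.nat_group)
qed

lemma kron_carrier:
  assumes "A \<in> carrier_mat m n" "B \<in> carrier_mat p q"
  shows "kron A B \<in> carrier_mat (m * p) (n * q)"
  using assms by (auto simp: kron_def)

lemma mult_add_less: "a < k \<Longrightarrow> i < m \<Longrightarrow> a * m + i < k * (m :: nat)"
  using mult_le_mono1[of "Suc a" k m] by simp

lemma kron_index:
  assumes "A \<in> carrier_mat m n" "B \<in> carrier_mat p q" "a < m" "i < p" "c < n" "j < q"
  shows "kron A B $$ (a * p + i, c * q + j) = A $$ (a, c) * B $$ (i, j)"
  using assms mult_add_less[of a m i p] mult_add_less[of c n j q] by (simp add: kron_def)

lemma kron_mult_vec_index:
  assumes "A \<in> carrier_mat m n" "B \<in> carrier_mat p q" "a < m" "i < p" "x \<in> carrier_vec (n * q)"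
  shows "(kron A B *\<^sub>v x) $ (a * p + i) = (\<Sum>c<n. \<Sum>j<q. A $$ (a, c) * B $$ (i, j) * x $ (c * q + j))"
proof -
  have "(kron A B *\<^sub>v x) $ (a * p + i) = (\<Sum>t<n * q. kron A B $$ (a * p + i, t) * x $ t)"
    using assms kron_carrier[OF assms(1,2)] mult_add_less[of a m i p]
    by (simp add: scalar_prod_def atLeast0LessThan)
  also have "\<dots> = (\<Sum>c<n. \<Sum>j<q. kron A B $$ (a * p + i, c * q + j) * x $ (c * q + j))"
    by (rule sum_lessThan_mult)
  also have "\<dots> = (\<Sum>c<n. \<Sum>j<q. A $$ (a, c) * B $$ (i, j) * x $ (c * q + j))"
    using assms by (intro sum.cong refl) (simp add: kron_index)
  finally show ?thesis .
qed

lemma scalar_prod_mult_index: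
  assumes "dim_vec y = k * m"
  shows "scalar_prod x y = (\<Sum>a<k. \<Sum>i<m. x $ (a * m + i) * y $ (a * m + i))"
  unfolding scalar_prod_def atLeast0LessThan assms by (rule sum_lessThan_mult)

lemma dot_preserving_kron_one_left:
  assumes P: "dot_preserving m n b P"
  shows "dot_preserving (k * m) (k * n) b (map_pmf (kron (1\<^sub>m k)) P)"
proof (rule dot_preserving_slices[OF P, where k = k and sl = "\<lambda>x a. Matrix.vec n (\<lambda>j. x $ (a * n + j))"])
  fix S assume "S \<in> set_pmf P"
  then have S: "S \<in> carrier_mat m n" by (rule dot_preservingD(2)[OF P])
  show "kron (1\<^sub>m k) S \<in> carrier_mat (k * m) (k * n)" by (rule kron_carrier[OF one_carrier_mat S])
  fix x y :: "real Matrix.vec" assume x: "x \<in> carrier_vec (k * n)" and y: "y \<in> carrier_vec (k * n)"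
  have row: "(kron (1\<^sub>m k) S *\<^sub>v z) $ (a * m + i) = (S *\<^sub>v Matrix.vec n (\<lambda>j. z $ (a * n + j))) $ i"
    if "z \<in> carrier_vec (k * n)" "a < k" "i < m" for z a i
  proof -
    have "(kron (1\<^sub>m k) S *\<^sub>v z) $ (a * m + i)
        = (\<Sum>c<k. \<Sum>j<n. 1\<^sub>m k $$ (a, c) * S $$ (i, j) * z $ (c * n + j))"
      using that by (intro kron_mult_vec_index[OF one_carrier_mat S])
    also have "\<dots> = (\<Sum>c<k. if a = c then (\<Sum>j<n. S $$ (i, j) * z $ (a * n + j)) else 0)"
      using that by (intro sum.cong refl) auto
    also have "\<dots> = (S *\<^sub>v Matrix.vec n (\<lambda>j. z $ (a * n + j))) $ i"
      using that S by (simp add: scalar_prod_def atLeast0LessThan)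
    finally show ?thesis .
  qed
  show "scalar_prod (kron (1\<^sub>m k) S *\<^sub>v x) (kron (1\<^sub>m k) S *\<^sub>v y) =
      (\<Sum>a<k. scalar_prod (S *\<^sub>v Matrix.vec n (\<lambda>j. x $ (a * n + j))) (S *\<^sub>v Matrix.vec n (\<lambda>j. y $ (a * n + j))))"
  proof -
    have "dim_vec (kron (1\<^sub>m k) S *\<^sub>v y) = k * m"
      using kron_carrier[OF one_carrier_mat[of k] S] by simp
    then show ?thesis
      using S by (simp add: scalar_prod_mult_index row x y scalar_prod_def[of "S *\<^sub>v _"] atLeast0LessThan
          del: index_mult_mat_vec)
  qed
next
  fix x y :: "real Matrix.vec" assume "x \<in> carrier_vec (k * n)" "y \<in> carrier_vec (k * n)"
  then show "scalar_prod x y = (\<Sum>a<k. scalar_prod (Matrix.vec n (\<lambda>j. x $ (a * n + j)))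
      (Matrix.vec n (\<lambda>j. y $ (a * n + j))))"
    by (subst scalar_prod_mult_index[where k = k and m = n])
      (auto simp: scalar_prod_def[of "Matrix.vec n _"] atLeast0LessThan)
qed auto

text \<open>The last factor of a Kronecker index varies fastest, so here a slice consists of every
  \<open>k\<close>-th entry, whereas an identity on the left gives contiguous blocks.\<close>

lemma dot_preserving_kron_one_right:
  assumes P: "dot_preserving m n b P"
  shows "dot_preserving (m * k) (n * k) b (map_pmf (\<lambda>A. kron A (1\<^sub>m k)) P)"
proof (rule dot_preserving_slices[OF P, where k = k and sl = "\<lambda>x a. Matrix.vec n (\<lambda>j. x $ (j * k + a))"])
  fix S assume "S \<in> set_pmf P"
  then have S: "S \<in> carrier_mat m n" by (rule dot_preservingD(2)[OF P])
  show "kron S (1\<^sub>m k) \<in> carrier_mat (m * k) (n * k)" by (rule kron_carrier[OF S one_carrier_mat])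
  fix x y :: "real Matrix.vec" assume x: "x \<in> carrier_vec (n * k)" and y: "y \<in> carrier_vec (n * k)"
  have row: "(kron S (1\<^sub>m k) *\<^sub>v z) $ (i * k + a) = (S *\<^sub>v Matrix.vec n (\<lambda>j. z $ (j * k + a))) $ i"
    if "z \<in> carrier_vec (n * k)" "a < k" "i < m" for z a i
  proof -
    have "(kron S (1\<^sub>m k) *\<^sub>v z) $ (i * k + a)
        = (\<Sum>c<n. \<Sum>j<k. S $$ (i, c) * 1\<^sub>m k $$ (a, j) * z $ (c * k + j))"
      using that by (intro kron_mult_vec_index[OF S one_carrier_mat])
    also have "\<dots> = (\<Sum>c<n. \<Sum>j<k. if a = j then S $$ (i, c) * z $ (c * k + a) else 0)"
      using that by (intro sum.cong refl) auto
    also have "\<dots> = (S *\<^sub>v Matrix.vec n (\<lambda>j. z $ (j * k + a))) $ i"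
      using that S by (simp add: scalar_prod_def atLeast0LessThan)
    finally show ?thesis .
  qed
  have "scalar_prod (kron S (1\<^sub>m k) *\<^sub>v x) (kron S (1\<^sub>m k) *\<^sub>v y) =
      (\<Sum>i<m. \<Sum>a<k. (S *\<^sub>v Matrix.vec n (\<lambda>j. x $ (j * k + a))) $ i * (S *\<^sub>v Matrix.vec n (\<lambda>j. y $ (j * k + a))) $ i)"
  proof -
    have "dim_vec (kron S (1\<^sub>m k) *\<^sub>v y) = m * k"
      using kron_carrier[OF S one_carrier_mat[of k]] by simp
    then show ?thesis by (simp add: scalar_prod_mult_index row x y del: index_mult_mat_vec)
  qed
  then show "scalar_prod (kron S (1\<^sub>m k) *\<^sub>v x) (kron S (1\<^sub>m k) *\<^sub>v y) =
      (\<Sum>a<k. scalar_prod (S *\<^sub>v Matrix.vec n (\<lambda>j. x $ (j * k + a))) (S *\<^sub>v Matrix.vec n (\<lambda>j. y $ (j * k + a))))"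
    using S by (subst (asm) sum.swap) (simp add: scalar_prod_def[of "S *\<^sub>v _"] atLeast0LessThan del: index_mult_mat_vec)
next
  fix x y :: "real Matrix.vec" assume "x \<in> carrier_vec (n * k)" "y \<in> carrier_vec (n * k)"
  then show "scalar_prod x y = (\<Sum>a<k. scalar_prod (Matrix.vec n (\<lambda>j. x $ (j * k + a)))
      (Matrix.vec n (\<lambda>j. y $ (j * k + a))))"
    by (subst scalar_prod_mult_index[where k = n and m = k], simp, subst sum.swap)
      (auto simp: scalar_prod_def[of "Matrix.vec n _"] atLeast0LessThan)
qed auto

text \<open>Reduces Kronecker products to ordinary ones: both factors on the right are block
  matrices covered by the slice lemma.\<close>

lemma kron_eq_mult:
  assumes A: "A \<in> carrier_mat m n" and B: "B \<in> carrier_mat p q"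
  shows "kron A B = kron A (1\<^sub>m p) * kron (1\<^sub>m n) B"
proof (rule eq_matI)
  note c1 = kron_carrier[OF A one_carrier_mat[of p]] and c2 = kron_carrier[OF one_carrier_mat[of n] B]
  note c = kron_carrier[OF A B]
  fix s t assume "s < dim_row (kron A (1\<^sub>m p) * kron (1\<^sub>m n) B)" "t < dim_col (kron A (1\<^sub>m p) * kron (1\<^sub>m n) B)"
  then have st: "s < m * p" "t < n * q" using c1 c2 by auto
  define a i d j where "a = s div p" and "i = s mod p" and "d = t div q" and "j = t mod q"
  have pq: "0 < p" "0 < q" using st by (auto intro: gr0I)
  have lt: "a < m" "i < p" "d < n" "j < q"
    using st pq by (simp_all add: a_def i_def d_def j_def less_mult_imp_div_less)
  have s: "s = a * p + i" and t: "t = d * q + j" by (simp_all add: a_def i_def d_def j_def)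
  have "(kron A (1\<^sub>m p) * kron (1\<^sub>m n) B) $$ (s, t)
      = (\<Sum>u<n * p. kron A (1\<^sub>m p) $$ (s, u) * kron (1\<^sub>m n) B $$ (u, t))"
    using st c1 c2 by (simp add: scalar_prod_def atLeast0LessThan)
  also have "\<dots> = (\<Sum>e<n. \<Sum>l<p. kron A (1\<^sub>m p) $$ (s, e * p + l) * kron (1\<^sub>m n) B $$ (e * p + l, t))"
    by (rule sum_lessThan_mult)
  also have "\<dots> = (\<Sum>e<n. \<Sum>l<p. if i = l then (if e = d then A $$ (a, d) * B $$ (i, j) else 0) else 0)"
    unfolding s t using lt
    by (intro sum.cong refl) (auto simp: kron_index[OF A one_carrier_mat] kron_index[OF one_carrier_mat B])
  also have "\<dots> = A $$ (a, d) * B $$ (i, j)" using lt by simp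
  finally show "kron A B $$ (s, t) = (kron A (1\<^sub>m p) * kron (1\<^sub>m n) B) $$ (s, t)"
    unfolding s t using lt by (simp only: kron_index[OF A B])
qed (use kron_carrier[OF A one_carrier_mat[of p]] kron_carrier[OF one_carrier_mat[of n] B] kron_carrier[OF A B] in auto)

lemma dot_preserving_kron:
  assumes P: "dot_preserving m n b P" and Q: "dot_preserving p q c Q"
  shows "dot_preserving (m * p) (n * q) (b * c) (map_pmf (\<lambda>(A, B). kron A B) (pair_pmf P Q))"
proof -
  have "map_pmf (\<lambda>(A, B). kron A B) (pair_pmf P Q)
      = map_pmf (\<lambda>(A, B). kron A (1\<^sub>m p) * kron (1\<^sub>m n) B) (pair_pmf P Q)"
    using dot_preservingD(2)[OF P] dot_preservingD(2)[OF Q]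
    by (intro map_pmf_cong refl) (auto intro!: kron_eq_mult)
  also have "\<dots> = map_pmf (\<lambda>(B, A). B * A)
      (map_pmf (\<lambda>(A, B). (kron A (1\<^sub>m p), kron (1\<^sub>m n) B)) (pair_pmf P Q))"
    by (simp add: map_pmf_comp case_prod_unfold)
  also have "\<dots> = map_pmf (\<lambda>(B, A). B * A)
      (pair_pmf (map_pmf (\<lambda>A. kron A (1\<^sub>m p)) P) (map_pmf (kron (1\<^sub>m n)) Q))"
    by (simp only: map_pair)
  finally show ?thesis
    using dot_preserving_mult[OF dot_preserving_kron_one_right[OF P] dot_preserving_kron_one_left[OF Q]]
    by simp
qed

text \<open>Splitting the head key off the independent family makes its factor independent of the
  remaining Kronecker product, so the constants multiply.\<close>

lemma dot_preserving_kron_list: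
  assumes "distinct ks" "set ks \<subseteq> A" "finite A"
    and "\<And>k. k \<in> set ks \<Longrightarrow> dot_preserving (m k) (n k) b (P k)"
  shows "dot_preserving (prod_list (map m ks)) (prod_list (map n ks)) (b ^ length ks)
    (map_pmf (\<lambda>C. kron_list (map C ks)) (Pi_pmf A d P))"
  using assms
proof (induction ks arbitrary: A)
  case Nil
  then show ?case
    by (auto simp: kron_list_def intro!: dot_preserving_return)
next
  case (Cons k ks)
  have A: "A = insert k (A - {k})" using Cons.prems by auto
  have Pi: "Pi_pmf A d P = map_pmf (\<lambda>(y, f). f(k := y)) (pair_pmf (P k) (Pi_pmf (A - {k}) d P))"
    by (subst A, rule Pi_pmf_insert) (use Cons.prems in auto)
  have upd: "map (f(k := y)) ks = map f ks" for f :: "_ \<Rightarrow> real mat" and y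
    using Cons.prems by auto
  have "map_pmf (\<lambda>C. kron_list (map C (k # ks))) (Pi_pmf A d P)
      = map_pmf (\<lambda>(y, f). kron y (kron_list (map f ks))) (pair_pmf (P k) (Pi_pmf (A - {k}) d P))"
    unfolding Pi map_pmf_comp
    by (intro map_pmf_cong refl) (auto simp: kron_list_def upd simp del: map_fun_upd)
  also have "\<dots> = map_pmf (\<lambda>(y, B). kron y B)
      (map_pmf (\<lambda>(y, f). (y, kron_list (map f ks))) (pair_pmf (P k) (Pi_pmf (A - {k}) d P)))"
    by (simp add: map_pmf_comp case_prod_unfold)
  also have "\<dots> = map_pmf (\<lambda>(y, B). kron y B)
      (pair_pmf (P k) (map_pmf (\<lambda>C. kron_list (map C ks)) (Pi_pmf (A - {k}) d P)))"
    by (simp only: map_pair[where f = "\<lambda>y. y"] map_pmf_ident)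
  finally have eq: "map_pmf (\<lambda>C. kron_list (map C (k # ks))) (Pi_pmf A d P)
      = map_pmf (\<lambda>(y, B). kron y B)
      (pair_pmf (P k) (map_pmf (\<lambda>C. kron_list (map C ks)) (Pi_pmf (A - {k}) d P)))" .
  have "dot_preserving (prod_list (map m ks)) (prod_list (map n ks)) (b ^ length ks)
      (map_pmf (\<lambda>C. kron_list (map C ks)) (Pi_pmf (A - {k}) d P))"
    using Cons.prems by (intro Cons.IH) auto
  from dot_preserving_kron[OF Cons.prems(4)[of k] this]
  show ?case unfolding eq by simp
qed

section \<open>Moments of hash and sign functions\<close>

text \<open>The definition speaks of sets of exactly \<open>min k I\<close> arguments; a smaller
  \<open>T\<close> is enlarged to such a set and inherits independence and uniform marginals from
  it.\<close>

lemma k_wise_indep_expectation_prod: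
  fixes g :: "nat \<Rightarrow> 'b \<Rightarrow> real"
  assumes P: "k_wise_indep k I B P" and B: "finite B" "B \<noteq> {}"
    and T: "T \<subseteq> {..<I}" "card T \<le> k"
  shows "mean P (\<lambda>f. \<Prod>i\<in>T. g i (f i)) = (\<Prod>i\<in>T. (\<Sum>v\<in>B. g i v) / real (card B))"
proof -
  have "card T \<le> I" using card_mono[OF _ T(1)] by simp
  then obtain A where A: "T \<subseteq> A" "A \<subseteq> {..<I}" "card A = min k I"
    using exists_subset_between[of T "min k I" "{..<I}"] T by auto
  have ind: "prob_space.indep_vars (measure_pmf P) (\<lambda>_. count_space UNIV) (\<lambda>i f. f i) T"
    and marg: "\<And>i. i \<in> T \<Longrightarrow> map_pmf (\<lambda>f. f i) P = pmf_of_set B"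
    using P A unfolding k_wise_indep_def
    by (blast intro: prob_space.indep_vars_subset[OF prob_space_measure_pmf])+
  have ind': "prob_space.indep_vars (measure_pmf P) (\<lambda>_. borel) (\<lambda>i f. g i (f i)) T"
    by (rule prob_space.indep_vars_compose2[OF prob_space_measure_pmf ind]) auto
  have int: "integrable (measure_pmf P) (\<lambda>f. g i (f i))" if "i \<in> T" for i
  proof -
    have "integrable (map_pmf (\<lambda>f. f i) P) (g i)"
      unfolding marg[OF that] using B by (intro integrable_measure_pmf_finite) auto
    then show ?thesis by simp
  qed
  have "mean P (\<lambda>f. g i (f i)) = (\<Sum>v\<in>B. g i v) / real (card B)" if "i \<in> T" for i
  proof -
    have "mean P (\<lambda>f. g i (f i)) = mean (map_pmf (\<lambda>f. f i) P) (g i)"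
      by simp
    then show ?thesis unfolding marg[OF that] using B by (simp add: integral_pmf_of_set)
  qed
  moreover have "finite T" using T(1) finite_subset by blast
  ultimately show ?thesis
    using prob_space.indep_vars_lebesgue_integral[OF prob_space_measure_pmf _ ind' int] by simp
qed

lemma k_wise_indep_range:
  assumes P: "k_wise_indep k I B P" and B: "finite B" "B \<noteq> {}" and k: "0 < k"
    and f: "f \<in> set_pmf P" and i: "i < I"
  shows "f i \<in> B"
proof -
  obtain A where "{i} \<subseteq> A" "A \<subseteq> {..<I}" "card A = min k I"
    using exists_subset_between[of "{i}" "min k I" "{..<I}"] i k by auto
  then have "map_pmf (\<lambda>f. f i) P = pmf_of_set B"
    using P unfolding k_wise_indep_def by blast
  then have "set_pmf (map_pmf (\<lambda>f. f i) P) = B" using B by simp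
  then show ?thesis using f by auto
qed

text \<open>The laws leave the values at arguments outside the domain unrestricted, so their
  supports can be infinite. Resetting these values makes the supports finite, hence all expectations
  finite sums, and does not change the sketch matrices.\<close>

definition zero_beyond :: "nat \<Rightarrow> (nat \<Rightarrow> 'a :: zero) \<Rightarrow> nat \<Rightarrow> 'a" where
  "zero_beyond n f = (\<lambda>i. if i < n then f i else 0)"

lemma finite_zero_beyond:
  assumes "finite B" "\<And>f i. f \<in> set_pmf P \<Longrightarrow> i < n \<Longrightarrow> f i \<in> B"
  shows "finite (set_pmf (map_pmf (zero_beyond n) P))"
proof (rule finite_subset)
  show "set_pmf (map_pmf (zero_beyond n) P) \<subseteq> PiE_dflt {..<n} 0 (\<lambda>_. B)"
    using assms(2) by (auto simp: PiE_dflt_def zero_beyond_def)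
  show "finite (PiE_dflt {..<n} 0 (\<lambda>_. B))" using assms(1) by (intro finite_PiE_dflt) auto
qed

text \<open>The shifts serve TensorSketch, where the hash of the other coordinate adds possibly
  different amounts at the two arguments.\<close>

definition pairwise_hash :: "nat \<Rightarrow> nat \<Rightarrow> (nat \<Rightarrow> nat) pmf \<Rightarrow> bool" where
  "pairwise_hash I J H \<longleftrightarrow> finite (set_pmf H) \<and> (\<forall>h\<in>set_pmf H. \<forall>a<I. h a < J) \<and>
     (\<forall>a<I. \<forall>b<I. \<forall>t t'. a \<noteq> b \<longrightarrow>
        mean H (\<lambda>h. of_bool ((h a + t) mod J = (h b + t') mod J)) \<le> 1 / real J)"

lemma card_mod_shift_le_1:
  fixes J t w :: nat
  shows "(\<Sum>u<J. of_bool ((u + t) mod J = w)) \<le> (1 :: real)"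
proof -
  have le: "u = v" if "u < J" "v < J" "(u + t) mod J = (v + t) mod J" "u \<le> v" for u v :: nat
  proof -
    have "J dvd (v + t) - (u + t)"
      using mod_eq_dvd_iff_nat[of "u + t" "v + t" J] that by simp
    then have "J dvd v - u" by simp
    then show ?thesis using dvd_imp_le[of J "v - u"] that by (cases "v - u = 0") auto
  qed
  have "u = v" if "u < J" "v < J" "(u + t) mod J = (v + t) mod J" for u v
    using le[of u v] le[of v u] that by (cases "u \<le> v") auto
  then have "card {u. u < J \<and> (u + t) mod J = w} \<le> 1"
    by (simp add: card_le_Suc0_iff_eq)
  moreover have "(\<Sum>u<J. of_bool ((u + t) mod J = w)) = real (card {u. u < J \<and> (u + t) mod J = w})"
    by (simp add: of_bool_def sum.If_cases Int_def)
  ultimately show ?thesis by simp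
qed

text \<open>The two hash values are uniform on J^2 pairs, and for each second value at most one
  first value solves the congruence, which leaves at most J pairs.\<close>

lemma is_hash_zero_beyond:
  assumes H: "is_hash I J H" and J: "0 < J"
  shows "pairwise_hash I J (map_pmf (zero_beyond I) H)"
proof -
  have k: "k_wise_indep 3 I {..<J} H" using H unfolding is_hash_def .
  have B: "{..<J} \<noteq> {}" using J by auto
  have rng: "h a < J" if "h \<in> set_pmf H" "a < I" for h a
    using k_wise_indep_range[OF k _ B _ that] by simp
  have fin: "finite (set_pmf (map_pmf (zero_beyond I) H))"
    by (rule finite_zero_beyond[of "{..<J}"]) (use rng in auto)
  have coll: "mean (map_pmf (zero_beyond I) H)
      (\<lambda>h. of_bool ((h a + t) mod J = (h b + t') mod J)) \<le> 1 / real J"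
    if ab: "a < I" "b < I" "a \<noteq> b" for a b t t'
  proof -
    let ?\<phi> = "\<lambda>u v. of_bool ((u + t) mod J = (v + t') mod J) :: real"
    let ?g = "\<lambda>u v i x. of_bool (x = (if i = a then u else v)) :: real"
    have prod: "mean H (\<lambda>h. of_bool (h a = u) * of_bool (h b = v)) = 1 / (real J)\<^sup>2"
      if uv: "u < J" "v < J" for u v
    proof -
      have "mean H (\<lambda>h. \<Prod>i\<in>{a, b}. ?g u v i (h i))
          = (\<Prod>i\<in>{a, b}. (\<Sum>x<J. ?g u v i x) / real (card {..<J}))"
        by (rule k_wise_indep_expectation_prod[OF k _ B]) (use ab in auto)
      then show ?thesis using ab uv by (simp add: power2_eq_square of_bool_def)
    qed
    have int: "integrable (measure_pmf H) (\<lambda>h. of_bool (h a = u) * of_bool (h b = v) :: real)" for u v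
      by (rule measure_pmf.integrable_const_bound[where B = 1]) auto
    have "mean (map_pmf (zero_beyond I) H) (\<lambda>h. ?\<phi> (h a) (h b))
        = mean H (\<lambda>h. ?\<phi> (h a) (h b))"
      using ab by (simp add: zero_beyond_def)
    also have "\<dots> = mean H (\<lambda>h. \<Sum>v<J. \<Sum>u<J. ?\<phi> u v * (of_bool (h a = u) * of_bool (h b = v)))"
    proof (rule expectation_cong_pmf)
      fix h assume "h \<in> set_pmf H"
      then have "h a < J" "h b < J" using rng ab by auto
      moreover have "(\<Sum>v<J. \<Sum>u<J. ?\<phi> u v * (of_bool (h a = u) * of_bool (h b = v)))
          = (\<Sum>v<J. if h b = v then (\<Sum>u<J. if h a = u then ?\<phi> u v else 0) else 0)"
        by (auto intro!: sum.cong)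
      ultimately show "?\<phi> (h a) (h b) = (\<Sum>v<J. \<Sum>u<J. ?\<phi> u v * (of_bool (h a = u) * of_bool (h b = v)))"
        by simp
    qed
    also have "\<dots> = (\<Sum>v<J. \<Sum>u<J. ?\<phi> u v * mean H (\<lambda>h. of_bool (h a = u) * of_bool (h b = v)))"
      by (simp only: Bochner_Integration.integral_sum[OF Bochner_Integration.integrable_sum[OF integrable_mult_right[OF int]]]
          Bochner_Integration.integral_sum[OF integrable_mult_right[OF int]] integral_mult_right_zero)
    also have "\<dots> = (\<Sum>v<J. (\<Sum>u<J. ?\<phi> u v) * (1 / (real J)\<^sup>2))"
      unfolding sum_distrib_right by (intro sum.cong refl) (simp add: prod)
    also have "\<dots> \<le> (\<Sum>v<J. 1 * (1 / (real J)\<^sup>2))"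
      by (intro sum_mono mult_right_mono card_mod_shift_le_1) auto
    also have "\<dots> = 1 / real J" using J by (simp add: power2_eq_square)
    finally show ?thesis .
  qed
  show ?thesis
    unfolding pairwise_hash_def using fin coll rng by (auto simp: zero_beyond_def[of I])
qed

section \<open>Fourth moments of signs and pairings of indices\<close>

definition paired :: "'a \<Rightarrow> 'a \<Rightarrow> 'a \<Rightarrow> 'a \<Rightarrow> bool" where
  "paired a b c d \<longleftrightarrow> a = b \<and> c = d \<or> a = c \<and> b = d \<or> a = d \<and> b = c"

definition sign_moments :: "nat \<Rightarrow> (nat \<Rightarrow> real) pmf \<Rightarrow> bool" where
  "sign_moments I Q \<longleftrightarrow> finite (set_pmf Q) \<and> (\<forall>s\<in>set_pmf Q. \<forall>a<I. (s a)\<^sup>2 = 1) \<and>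
     (\<forall>a<I. \<forall>b<I. \<forall>c<I. \<forall>d<I.
        \<bar>mean Q (\<lambda>s. s a * s b * s c * s d)\<bar> \<le> of_bool (paired a b c d))"

text \<open>If four indices do not fall into two pairs of equals, one of them occurs with odd
  multiplicity m, and its factor (-1)^m + 1^m vanishes. Otherwise the trivial bound 1
  applies.\<close>

lemma is_sign_zero_beyond:
  assumes Q: "is_sign I Q"
  shows "sign_moments I (map_pmf (zero_beyond I) Q)"
proof -
  have k: "k_wise_indep 4 I {-1, 1} Q" using Q unfolding is_sign_def .
  have rng: "s a \<in> {-1, 1}" if "s \<in> set_pmf Q" "a < I" for s a
    using k_wise_indep_range[OF k _ _ _ that] by simp
  have fin: "finite (set_pmf (map_pmf (zero_beyond I) Q))"
    by (rule finite_zero_beyond[of "{-1, 1}"]) (use rng in auto)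
  have four: "\<bar>mean Q (\<lambda>s. s a * s b * s c * s d)\<bar> \<le> of_bool (paired a b c d)"
    if lt: "a < I" "b < I" "c < I" "d < I" for a b c d
  proof (cases "paired a b c d")
    case True
    have "\<bar>s a\<bar> = 1" if "s \<in> set_pmf Q" "a < I" for s a
      using rng[OF that] by auto
    then have "mean Q (\<lambda>s. \<bar>s a * s b * s c * s d\<bar>) = mean Q (\<lambda>_. 1)"
      using lt by (intro expectation_cong_pmf) (simp add: abs_mult)
    then have "\<bar>mean Q (\<lambda>s. s a * s b * s c * s d)\<bar> \<le> 1"
      using integral_abs_bound[of "measure_pmf Q" "\<lambda>s. s a * s b * s c * s d"] by simp
    then show ?thesis using True by simp
  next
    case False
    \<comment> \<open>The multiplicity of \<open>i\<close> in the quadruple turns the product into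
      one over the set of distinct indices, to which independence applies.\<close>
    define m where "m i = of_bool (i = a) + of_bool (i = b) + of_bool (i = c) + (of_bool (i = d) :: nat)" for i
    let ?T = "{a, b, c, d}"
    have one: "(\<Prod>i\<in>?T. s i ^ of_bool (i = e)) = s e" if "e \<in> ?T" for e and s :: "nat \<Rightarrow> real"
    proof -
      have "(\<Prod>i\<in>?T. s i ^ of_bool (i = e)) = (\<Prod>i\<in>?T. if i = e then s i else 1)"
        by (intro prod.cong) auto
      also have "\<dots> = s e" using that by (subst prod.delta) auto
      finally show ?thesis .
    qed
    have prod: "s a * s b * s c * s d = (\<Prod>i\<in>?T. s i ^ m i)" for s :: "nat \<Rightarrow> real"
      unfolding m_def power_add prod.distrib by (subst one, simp)+ simp
    obtain i where i: "i \<in> ?T" "odd (m i)"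
    proof -
      have "\<exists>i\<in>?T. odd (m i)"
      proof (rule ccontr)
        assume "\<not> ?thesis"
        then have "even (m a)" "even (m b)" "even (m c)" "even (m d)" by auto
        note even = this[unfolded m_def]
        have "a = b \<or> a = c \<or> a = d"
          using even(1) by (cases "a = b"; cases "a = c"; cases "a = d") simp_all
        then have "paired a b c d"
        proof (elim disjE)
          assume "a = b"
          then have "c = d" using even(3) by (cases "c = b"; cases "c = d") simp_all
          with \<open>a = b\<close> show ?thesis by (simp add: paired_def)
        next
          assume "a = c"
          then have "b = d" using even(2) by (cases "b = c"; cases "b = d") simp_all
          with \<open>a = c\<close> show ?thesis by (simp add: paired_def)
        next
          assume "a = d"
          then have "b = c" using even(2) by (cases "b = c"; cases "b = d") simp_all
          with \<open>a = d\<close> show ?thesis by (simp add: paired_def)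
        qed
        with False show False ..
      qed
      then show ?thesis using that by blast
    qed
    have card: "card ?T \<le> 4"
      by (simp add: card_insert_if)
    have "mean Q (\<lambda>s. \<Prod>i\<in>?T. s i ^ m i)
        = (\<Prod>i\<in>?T. (\<Sum>v\<in>{-1, 1}. v ^ m i) / real (card {-1, 1 :: real}))"
      by (rule k_wise_indep_expectation_prod[OF k]) (use lt card in auto)
    also have "\<dots> = 0"
      using i by (intro prod_zero) (auto intro!: bexI[of _ i])
    finally show ?thesis unfolding prod by simp
  qed
  have sq: "s a * s a = 1" if "s \<in> set_pmf Q" "a < I" for s a
    using rng[OF that] by auto
  show ?thesis
    unfolding sign_moments_def using fin four sq
    by (auto simp: zero_beyond_def[of I] power2_eq_square)
qed

text \<open>Since (s b)^2 = 1, the second moment equals a fourth one at the quadruple a, b, b, b,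
  which is not paired.\<close>

lemma sign_moments_two:
  assumes Q: "sign_moments I Q" and ab: "a < I" "b < I" "a \<noteq> b"
  shows "mean Q (\<lambda>s. s a * s b) = 0"
proof -
  have "mean Q (\<lambda>s. s a * s b) = mean Q (\<lambda>s. s a * s b * s b * s b)"
  proof (rule expectation_cong_pmf)
    fix s assume "s \<in> set_pmf Q"
    then have "(s b)\<^sup>2 = 1" using Q ab unfolding sign_moments_def by blast
    then show "s a * s b = s a * s b * s b * s b" by (simp add: power2_eq_square mult.assoc)
  qed
  moreover have "\<bar>mean Q (\<lambda>s. s a * s b * s b * s b)\<bar> \<le> of_bool (paired a b b b)"
    using Q ab(1,2) unfolding sign_moments_def by blast
  moreover have "\<not> paired a b b b" using ab by (auto simp: paired_def)
  ultimately show ?thesis by simp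
qed

text \<open>\<open>g\<close> numbers the three ways of splitting four positions into two pairs.
  Naming one splitting at a time lets the joint condition for two sign functions be summed over 3 *
  3 cases.\<close>

definition match :: "nat \<Rightarrow> 'a \<Rightarrow> 'a \<Rightarrow> 'a \<Rightarrow> 'a \<Rightarrow> bool" where
  "match g a b c d \<longleftrightarrow> (if g = 1 then a = b \<and> c = d else if g = 2 then a = c \<and> b = d else a = d \<and> b = c)"

lemma paired_le_matches: "of_bool (paired a b c d) \<le> (\<Sum>g\<in>{1, 2, 3}. of_bool (match g a b c d) :: real)"
proof (cases "paired a b c d")
  case True
  then have "match 1 a b c d \<or> match 2 a b c d \<or> match 3 a b c d"
    unfolding paired_def by (elim disjE) (simp_all add: match_def)
  then obtain g where g: "g \<in> {1, 2, 3}" "match g a b c d" by blast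
  then have "of_bool (match g a b c d) \<le> (\<Sum>g\<in>{1, 2, 3}. of_bool (match g a b c d) :: real)"
    by (intro member_le_sum) auto
  then show ?thesis using g True by simp
next
  case False
  then show ?thesis by (simp only: of_bool_eq) (intro sum_nonneg; simp)
qed

text \<open>By injectivity each term of the full sums of squares is used at most once, so both
  restricted sums are bounded by the full ones.\<close>

lemma sum_inj_Cauchy_Schwarz:
  fixes f :: "'b \<Rightarrow> real" and g :: "'c \<Rightarrow> real"
  assumes "inj_on p \<Omega>" "inj_on q \<Omega>" "p ` \<Omega> \<subseteq> A" "q ` \<Omega> \<subseteq> B" "finite A" "finite B"
    and "(\<Sum>i\<in>A. (f i)\<^sup>2) * (\<Sum>i\<in>B. (g i)\<^sup>2) = c\<^sup>2" "0 \<le> c"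
  shows "(\<Sum>\<omega>\<in>\<Omega>. f (p \<omega>) * g (q \<omega>)) \<le> c"
proof -
  have "(\<Sum>\<omega>\<in>\<Omega>. (f (p \<omega>))\<^sup>2) = (\<Sum>i\<in>p ` \<Omega>. (f i)\<^sup>2)" "(\<Sum>\<omega>\<in>\<Omega>. (g (q \<omega>))\<^sup>2) = (\<Sum>i\<in>q ` \<Omega>. (g i)\<^sup>2)"
    using assms(1,2) by (simp_all add: sum.reindex)
  moreover have "(\<Sum>i\<in>p ` \<Omega>. (f i)\<^sup>2) \<le> (\<Sum>i\<in>A. (f i)\<^sup>2)" "(\<Sum>i\<in>q ` \<Omega>. (g i)\<^sup>2) \<le> (\<Sum>i\<in>B. (g i)\<^sup>2)"
    using assms by (auto intro!: sum_mono2)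
  ultimately have "(\<Sum>\<omega>\<in>\<Omega>. (f (p \<omega>))\<^sup>2) * (\<Sum>\<omega>\<in>\<Omega>. (g (q \<omega>))\<^sup>2) \<le> c\<^sup>2"
    unfolding assms(7)[symmetric] by (intro mult_mono) (auto intro!: sum_nonneg)
  then have "(\<Sum>\<omega>\<in>\<Omega>. f (p \<omega>) * g (q \<omega>))\<^sup>2 \<le> c\<^sup>2"
    using Cauchy_Schwarz_ineq_sum[of "\<lambda>\<omega>. f (p \<omega>)" "\<lambda>\<omega>. g (q \<omega>)" \<Omega>] by linarith
  then show ?thesis using assms(8) by (rule power2_le_imp_le)
qed

text \<open>A splitting other than {a, b}, {c, d} links each of a, b to one of c, d, so either half
  determines the other. The next two lemmas do the same for the halves of the other two
  splittings.\<close>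

lemma match_determined_1:
  assumes "g \<noteq> 1" "match g a b c d"
  shows "match g a b c' d' \<Longrightarrow> c = c' \<and> d = d'" "match g a' b' c d \<Longrightarrow> a = a' \<and> b = b'"
  using assms by (cases "g = 2"; simp add: match_def)+

lemma match_determined_2:
  assumes "g \<noteq> 2" "match g a b c d"
  shows "match g a b' c d' \<Longrightarrow> b = b' \<and> d = d'" "match g a' b c' d \<Longrightarrow> a = a' \<and> c = c'"
  using assms by (cases "g = 1"; simp add: match_def)+

lemma match_determined_3:
  assumes "g \<in> {1, 2}" "match g a b c d"
  shows "match g a b' c' d \<Longrightarrow> b = b' \<and> c = c'" "match g a' b c d' \<Longrightarrow> a = a' \<and> d = d'"
  using assms by (elim insertE; simp add: match_def)+

text \<open>For two pairings there is a third one none of whose pairs occurs in them. Each of its two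
  pairs then determines the whole quadruple, so Cauchy--Schwarz with the terms grouped along the
  third pairing loses nothing.\<close>

lemma sum_two_matches_le:
  fixes x y :: "nat \<Rightarrow> real"
  assumes D: "finite D" and inj: "\<And>c c'. c \<in> D \<Longrightarrow> c' \<in> D \<Longrightarrow> m1 c = m1 c' \<Longrightarrow> m2 c = m2 c' \<Longrightarrow> c = c'"
    and g: "g \<in> {1, 2, 3}" "g' \<in> {1, 2, 3}"
  shows "(\<Sum>((a, b), (c, d))\<in>{((a, b), (c, d)) \<in> (D \<times> D) \<times> (D \<times> D).
      match g (m1 a) (m1 b) (m1 c) (m1 d) \<and> match g' (m2 a) (m2 b) (m2 c) (m2 d)}. x a * y b * (x c * y d))
    \<le> (\<Sum>a\<in>D. (x a)\<^sup>2) * (\<Sum>b\<in>D. (y b)\<^sup>2)" (is "sum ?F ?\<Omega> \<le> ?X * ?Y")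
proof -
  have prod: "(\<Sum>p\<in>D \<times> D. (u (fst p) * v (snd p))\<^sup>2) = (\<Sum>a\<in>D. (u a)\<^sup>2) * (\<Sum>b\<in>D. (v b)\<^sup>2)"
    for u v :: "nat \<Rightarrow> real"
    by (simp add: sum_product sum.cartesian_product case_prod_unfold power_mult_distrib)
  have nn: "0 \<le> ?X * ?Y" by (intro mult_nonneg_nonneg sum_nonneg) auto
  have fin: "finite (D \<times> D)" using D by simp
  have "g \<noteq> 1 \<and> g' \<noteq> 1 \<or> g \<noteq> 2 \<and> g' \<noteq> 2 \<or> g \<noteq> 3 \<and> g' \<noteq> 3"
    using g by (elim insertE emptyE; hypsubst; simp)
  then consider "g \<noteq> 1" "g' \<noteq> 1" | "g \<noteq> 2" "g' \<noteq> 2" | "g \<noteq> 3" "g' \<noteq> 3"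
    by argo
  then show ?thesis
  proof cases
    case G: 1
    let ?p = "\<lambda>((a, b), (c, d)). (a, b)" and ?q = "\<lambda>((a, b), (c, d)). (c, d)"
    have "(\<Sum>\<omega>\<in>?\<Omega>. (\<lambda>p. x (fst p) * y (snd p)) (?p \<omega>) * (\<lambda>p. x (fst p) * y (snd p)) (?q \<omega>)) \<le> ?X * ?Y"
    proof (rule sum_inj_Cauchy_Schwarz[OF _ _ _ _ fin fin _ nn])
      show "inj_on ?p ?\<Omega>"
      proof (rule inj_onI, clarsimp)
        fix a b c d c' d'
        assume D: "c \<in> D" "d \<in> D" "c' \<in> D" "d' \<in> D"
          and m: "match g (m1 a) (m1 b) (m1 c) (m1 d)" "match g' (m2 a) (m2 b) (m2 c) (m2 d)"
            "match g (m1 a) (m1 b) (m1 c') (m1 d')" "match g' (m2 a) (m2 b) (m2 c') (m2 d')"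
        show "c = c' \<and> d = d'"
          using match_determined_1(1)[OF G(1) m(1) m(3)] match_determined_1(1)[OF G(2) m(2) m(4)] D
            inj[of c c'] inj[of d d'] by simp
      qed
      show "inj_on ?q ?\<Omega>"
      proof (rule inj_onI, clarsimp)
        fix a b c d a' b'
        assume D: "a \<in> D" "b \<in> D" "a' \<in> D" "b' \<in> D"
          and m: "match g (m1 a) (m1 b) (m1 c) (m1 d)" "match g' (m2 a) (m2 b) (m2 c) (m2 d)"
            "match g (m1 a') (m1 b') (m1 c) (m1 d)" "match g' (m2 a') (m2 b') (m2 c) (m2 d)"
        show "a = a' \<and> b = b'"
          using match_determined_1(2)[OF G(1) m(1) m(3)] match_determined_1(2)[OF G(2) m(2) m(4)] D
            inj[of a a'] inj[of b b'] by simp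
      qed
      show "(\<Sum>p\<in>D \<times> D. (x (fst p) * y (snd p))\<^sup>2) * (\<Sum>p\<in>D \<times> D. (x (fst p) * y (snd p))\<^sup>2) = (?X * ?Y)\<^sup>2"
        unfolding prod by (simp only: power2_eq_square[of "?X * ?Y"] mult_ac)
    qed auto
    then show ?thesis by (simp add: case_prod_unfold)
  next
    case G: 2
    let ?p = "\<lambda>((a, b), (c, d)). (a, c)" and ?q = "\<lambda>((a, b), (c, d)). (b, d)"
    have "(\<Sum>\<omega>\<in>?\<Omega>. (\<lambda>p. x (fst p) * x (snd p)) (?p \<omega>) * (\<lambda>p. y (fst p) * y (snd p)) (?q \<omega>)) \<le> ?X * ?Y"
    proof (rule sum_inj_Cauchy_Schwarz[OF _ _ _ _ fin fin _ nn])
      show "inj_on ?p ?\<Omega>"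
      proof (rule inj_onI, clarsimp)
        fix a b c d b' d'
        assume D: "b \<in> D" "d \<in> D" "b' \<in> D" "d' \<in> D"
          and m: "match g (m1 a) (m1 b) (m1 c) (m1 d)" "match g' (m2 a) (m2 b) (m2 c) (m2 d)"
            "match g (m1 a) (m1 b') (m1 c) (m1 d')" "match g' (m2 a) (m2 b') (m2 c) (m2 d')"
        show "b = b' \<and> d = d'"
          using match_determined_2(1)[OF G(1) m(1) m(3)] match_determined_2(1)[OF G(2) m(2) m(4)] D
            inj[of b b'] inj[of d d'] by simp
      qed
      show "inj_on ?q ?\<Omega>"
      proof (rule inj_onI, clarsimp)
        fix a b c d a' c'
        assume D: "a \<in> D" "c \<in> D" "a' \<in> D" "c' \<in> D"
          and m: "match g (m1 a) (m1 b) (m1 c) (m1 d)" "match g' (m2 a) (m2 b) (m2 c) (m2 d)"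
            "match g (m1 a') (m1 b) (m1 c') (m1 d)" "match g' (m2 a') (m2 b) (m2 c') (m2 d)"
        show "a = a' \<and> c = c'"
          using match_determined_2(2)[OF G(1) m(1) m(3)] match_determined_2(2)[OF G(2) m(2) m(4)] D
            inj[of a a'] inj[of c c'] by simp
      qed
      show "(\<Sum>p\<in>D \<times> D. (x (fst p) * x (snd p))\<^sup>2) * (\<Sum>p\<in>D \<times> D. (y (fst p) * y (snd p))\<^sup>2) = (?X * ?Y)\<^sup>2"
        unfolding prod by (simp only: power2_eq_square[of "?X * ?Y"] mult_ac)
    qed auto
    then show ?thesis by (simp add: case_prod_unfold mult_ac)
  next
    case 3
    then have G: "g \<in> {1, 2}" "g' \<in> {1, 2}" using g by auto
    let ?p = "\<lambda>((a, b), (c, d)). (a, d)" and ?q = "\<lambda>((a, b), (c, d)). (b, c)"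
    have "(\<Sum>\<omega>\<in>?\<Omega>. (\<lambda>p. x (fst p) * y (snd p)) (?p \<omega>) * (\<lambda>p. y (fst p) * x (snd p)) (?q \<omega>)) \<le> ?X * ?Y"
    proof (rule sum_inj_Cauchy_Schwarz[OF _ _ _ _ fin fin _ nn])
      show "inj_on ?p ?\<Omega>"
      proof (rule inj_onI, clarsimp)
        fix a b c d b' c'
        assume D: "b \<in> D" "c \<in> D" "b' \<in> D" "c' \<in> D"
          and m: "match g (m1 a) (m1 b) (m1 c) (m1 d)" "match g' (m2 a) (m2 b) (m2 c) (m2 d)"
            "match g (m1 a) (m1 b') (m1 c') (m1 d)" "match g' (m2 a) (m2 b') (m2 c') (m2 d)"
        show "b = b' \<and> c = c'"
          using match_determined_3(1)[OF G(1) m(1) m(3)] match_determined_3(1)[OF G(2) m(2) m(4)] D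
            inj[of b b'] inj[of c c'] by simp
      qed
      show "inj_on ?q ?\<Omega>"
      proof (rule inj_onI, clarsimp)
        fix a b c d a' d'
        assume D: "a \<in> D" "d \<in> D" "a' \<in> D" "d' \<in> D"
          and m: "match g (m1 a) (m1 b) (m1 c) (m1 d)" "match g' (m2 a) (m2 b) (m2 c) (m2 d)"
            "match g (m1 a') (m1 b) (m1 c) (m1 d')" "match g' (m2 a') (m2 b) (m2 c) (m2 d')"
        show "a = a' \<and> d = d'"
          using match_determined_3(2)[OF G(1) m(1) m(3)] match_determined_3(2)[OF G(2) m(2) m(4)] D
            inj[of a a'] inj[of d d'] by simp
      qed
      show "(\<Sum>p\<in>D \<times> D. (x (fst p) * y (snd p))\<^sup>2) * (\<Sum>p\<in>D \<times> D. (y (fst p) * x (snd p))\<^sup>2) = (?X * ?Y)\<^sup>2"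
        unfolding prod by (simp only: power2_eq_square[of "?X * ?Y"] mult_ac)
    qed auto
    then show ?thesis by (simp add: case_prod_unfold mult_ac)
  qed
qed

text \<open>\<open>m1\<close> and \<open>m2\<close> are the arguments of two sign functions and
  together determine the index. Three splittings for each give the factor 9, the origin of 1 + 9 /
  J.\<close>

lemma sum_paired_le:
  fixes x y :: "nat \<Rightarrow> real"
  assumes D: "finite D" and inj: "\<And>c c'. c \<in> D \<Longrightarrow> c' \<in> D \<Longrightarrow> m1 c = m1 c' \<Longrightarrow> m2 c = m2 c' \<Longrightarrow> c = c'"
    and nn: "\<And>a. 0 \<le> x a" "\<And>a. 0 \<le> y a"
  shows "(\<Sum>((a, b), (c, d))\<in>(D \<times> D) \<times> (D \<times> D).
      of_bool (paired (m1 a) (m1 b) (m1 c) (m1 d)) * of_bool (paired (m2 a) (m2 b) (m2 c) (m2 d))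
        * (x a * y b * (x c * y d)))
    \<le> 9 * ((\<Sum>a\<in>D. (x a)\<^sup>2) * (\<Sum>b\<in>D. (y b)\<^sup>2))"
proof -
  let ?Q = "(D \<times> D) \<times> (D \<times> D)" and ?X = "\<Sum>a\<in>D. (x a)\<^sup>2" and ?Y = "\<Sum>b\<in>D. (y b)\<^sup>2"
  let ?M = "\<lambda>g g' ((a, b), (c, d)). match g (m1 a) (m1 b) (m1 c) (m1 d) \<and> match g' (m2 a) (m2 b) (m2 c) (m2 d)"
  let ?F = "\<lambda>((a, b), (c, d)). x a * y b * (x c * y d)"
  have "(\<Sum>((a, b), (c, d))\<in>?Q.
      of_bool (paired (m1 a) (m1 b) (m1 c) (m1 d)) * of_bool (paired (m2 a) (m2 b) (m2 c) (m2 d))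
        * (x a * y b * (x c * y d)))
    \<le> (\<Sum>\<omega>\<in>?Q. \<Sum>g\<in>{1, 2, 3}. \<Sum>g'\<in>{1, 2, 3}. if ?M g g' \<omega> then ?F \<omega> else 0)"
  proof (rule sum_mono)
    fix \<omega> :: "(nat \<times> nat) \<times> (nat \<times> nat)"
    obtain a b c d where \<omega>: "\<omega> = ((a, b), (c, d))" by (metis surj_pair)
    have "of_bool (paired (m1 a) (m1 b) (m1 c) (m1 d)) * of_bool (paired (m2 a) (m2 b) (m2 c) (m2 d))
        * (x a * y b * (x c * y d))
      \<le> (\<Sum>g\<in>{1, 2, 3}. of_bool (match g (m1 a) (m1 b) (m1 c) (m1 d)))
        * (\<Sum>g'\<in>{1, 2, 3}. of_bool (match g' (m2 a) (m2 b) (m2 c) (m2 d))) * (x a * y b * (x c * y d))"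
      by (intro mult_right_mono mult_mono paired_le_matches mult_nonneg_nonneg nn sum_nonneg) auto
    also have "\<dots> = (\<Sum>g\<in>{1, 2, 3}. \<Sum>g'\<in>{1, 2, 3}.
        if ?M g g' ((a, b), (c, d)) then ?F ((a, b), (c, d)) else 0)"
      unfolding sum_product sum_distrib_right by (intro sum.cong refl) auto
    finally show "(case \<omega> of (p, p') \<Rightarrow> (case p of (a, b) \<Rightarrow> \<lambda>(c, d).
        of_bool (paired (m1 a) (m1 b) (m1 c) (m1 d)) * of_bool (paired (m2 a) (m2 b) (m2 c) (m2 d))
          * (x a * y b * (x c * y d))) p')
      \<le> (\<Sum>g\<in>{1, 2, 3}. \<Sum>g'\<in>{1, 2, 3}. if ?M g g' \<omega> then ?F \<omega> else 0)"
      unfolding \<omega> by (simp only: prod.case)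
  qed
  also have "\<dots> = (\<Sum>g\<in>{1, 2, 3}. \<Sum>g'\<in>{1, 2, 3}. \<Sum>\<omega>\<in>?Q. if ?M g g' \<omega> then ?F \<omega> else 0)"
    by (subst sum.swap, intro sum.cong refl, rule sum.swap)
  also have "\<dots> = (\<Sum>g\<in>{1, 2, 3}. \<Sum>g'\<in>{1, 2, 3}. sum ?F {\<omega> \<in> ?Q. ?M g g' \<omega>})"
    using D by (intro sum.cong refl sum.inter_filter[symmetric]) simp
  also have "\<dots> \<le> (\<Sum>g\<in>{1, 2, 3 :: nat}. \<Sum>g'\<in>{1, 2, 3 :: nat}. ?X * ?Y)"
  proof (intro sum_mono)
    fix g g' :: nat assume g: "g \<in> {1, 2, 3}" "g' \<in> {1, 2, 3}"
    have eq: "{\<omega> \<in> ?Q. ?M g g' \<omega>} = {((a, b), (c, d)) \<in> ?Q.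
        match g (m1 a) (m1 b) (m1 c) (m1 d) \<and> match g' (m2 a) (m2 b) (m2 c) (m2 d)}"
      by auto
    show "sum ?F {\<omega> \<in> ?Q. ?M g g' \<omega>} \<le> ?X * ?Y"
      unfolding eq by (rule sum_two_matches_le[OF D inj g])
  qed
  also have "\<dots> = 9 * (?X * ?Y)" by simp
  finally show ?thesis .
qed

section \<open>Matrices given by one hash and one sign per column\<close>

definition hash_sign_mat :: "nat \<Rightarrow> nat \<Rightarrow> (nat \<Rightarrow> nat) \<times> (nat \<Rightarrow> real) \<Rightarrow> real mat" where
  "hash_sign_mat J n = (\<lambda>(h, s). Matrix.mat J n (\<lambda>(j, c). s c * of_bool (h c = j)))"

text \<open>The diagonal of the double sum reproduces the inner product because signs square to 1;
  what remains are collisions of distinct columns.\<close>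

lemma dot_err_hash_sign:
  assumes x: "x \<in> carrier_vec n" and y: "y \<in> carrier_vec n"
    and h: "\<And>c. c < n \<Longrightarrow> h c < J" and s: "\<And>c. c < n \<Longrightarrow> (s c)\<^sup>2 = 1"
  shows "dot_err (hash_sign_mat J n (h, s)) x y
    = (\<Sum>(a, b)\<in>{..<n} \<times> {..<n}. of_bool (a \<noteq> b \<and> h a = h b) * (x $ a * y $ b) * (s a * s b))"
proof -
  let ?S = "hash_sign_mat J n (h, s)"
  have entry: "(?S *\<^sub>v z) $ j = (\<Sum>c<n. s c * of_bool (h c = j) * z $ c)"
    if "z \<in> carrier_vec n" "j < J" for z j
    using that by (simp add: hash_sign_mat_def scalar_prod_def atLeast0LessThan)
  have "scalar_prod (?S *\<^sub>v x) (?S *\<^sub>v y)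
      = (\<Sum>j<J. (\<Sum>a<n. s a * of_bool (h a = j) * x $ a) * (\<Sum>b<n. s b * of_bool (h b = j) * y $ b))"
  proof -
    have "scalar_prod (?S *\<^sub>v x) (?S *\<^sub>v y) = (\<Sum>j<J. (?S *\<^sub>v x) $ j * (?S *\<^sub>v y) $ j)"
      by (simp add: scalar_prod_def hash_sign_mat_def atLeast0LessThan del: index_mult_mat_vec)
    also have "\<dots> = (\<Sum>j<J. (\<Sum>a<n. s a * of_bool (h a = j) * x $ a) * (\<Sum>b<n. s b * of_bool (h b = j) * y $ b))"
      by (rule sum.cong) (simp_all only: entry[OF x] entry[OF y] lessThan_iff)
    finally show ?thesis .
  qed
  also have "\<dots> = (\<Sum>j<J. \<Sum>(a, b)\<in>{..<n} \<times> {..<n}.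
      if j = h a then of_bool (h a = h b) * (x $ a * y $ b) * (s a * s b) else 0)"
    unfolding sum_product sum.cartesian_product by (intro sum.cong refl) auto
  also have "\<dots> = (\<Sum>(a, b)\<in>{..<n} \<times> {..<n}. \<Sum>j<J.
      if j = h a then of_bool (h a = h b) * (x $ a * y $ b) * (s a * s b) else 0)"
    by (subst sum.swap) (simp add: case_prod_unfold)
  also have "\<dots> = (\<Sum>(a, b)\<in>{..<n} \<times> {..<n}. of_bool (h a = h b) * (x $ a * y $ b) * (s a * s b))"
    using h by (intro sum.cong refl) auto
  finally have 1: "scalar_prod (?S *\<^sub>v x) (?S *\<^sub>v y)
      = (\<Sum>(a, b)\<in>{..<n} \<times> {..<n}. of_bool (h a = h b) * (x $ a * y $ b) * (s a * s b))" .
  have "scalar_prod x y = (\<Sum>a<n. \<Sum>b<n. if b = a then x $ a * y $ b else 0)"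
    using y by (simp add: scalar_prod_def atLeast0LessThan)
  also have "\<dots> = (\<Sum>(a, b)\<in>{..<n} \<times> {..<n}. of_bool (a = b) * (x $ a * y $ b) * (s a * s b))"
    unfolding sum.cartesian_product using s
    by (intro sum.cong refl) (auto simp: power2_eq_square)
  finally have 2: "scalar_prod x y
      = (\<Sum>(a, b)\<in>{..<n} \<times> {..<n}. of_bool (a = b) * (x $ a * y $ b) * (s a * s b))" .
  show ?thesis
    unfolding dot_err_def 1 2 sum_subtractf[symmetric] by (intro sum.cong refl) auto
qed

lemma expectation_pair_pmf_prod:
  fixes f :: "'a \<Rightarrow> real" and g :: "'b \<Rightarrow> real"
  assumes "finite (set_pmf p)" "finite (set_pmf q)"
  shows "mean (pair_pmf p q) (\<lambda>(x, y). f x * g y)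
    = mean p f * mean q g"
  using assms by (simp add: expectation_pair_pmf_finite)

text \<open>Hash and signs are independent, so every term of the second moment factors. The hash
  factor is at most 1 / J by the collision of the first pair, and the sign factor restricts the sum
  to paired quadruples.\<close>

lemma dot_preserving_hash_sign:
  assumes H: "finite (set_pmf H)" "\<And>h c. h \<in> set_pmf H \<Longrightarrow> c < n \<Longrightarrow> h c < J"
      "\<And>a b. a < n \<Longrightarrow> b < n \<Longrightarrow> a \<noteq> b \<Longrightarrow> mean H (\<lambda>h. of_bool (h a = h b)) \<le> 1 / real J"
    and Q: "finite (set_pmf Q)" "\<And>s c. s \<in> set_pmf Q \<Longrightarrow> c < n \<Longrightarrow> (s c)\<^sup>2 = 1"
      "\<And>a b. a < n \<Longrightarrow> b < n \<Longrightarrow> a \<noteq> b \<Longrightarrow> mean Q (\<lambda>s. s a * s b) = 0"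
      "\<And>a b c d. a < n \<Longrightarrow> b < n \<Longrightarrow> c < n \<Longrightarrow> d < n \<Longrightarrow>
        \<bar>mean Q (\<lambda>s. s a * s b * s c * s d)\<bar>
          \<le> of_bool (paired (m1 a) (m1 b) (m1 c) (m1 d)) * of_bool (paired (m2 a) (m2 b) (m2 c) (m2 d))"
    and inj: "\<And>c c'. c < n \<Longrightarrow> c' < n \<Longrightarrow> m1 c = m1 c' \<Longrightarrow> m2 c = m2 c' \<Longrightarrow> c = c'"
  shows "dot_preserving J n (1 + 9 / real J) (map_pmf (hash_sign_mat J n) (pair_pmf H Q))"
proof -
  let ?D = "{..<n} \<times> {..<n}"
  have moments: "mean (pair_pmf H Q) (\<lambda>w. dot_err (hash_sign_mat J n w) x y) = 0 \<and>
      mean (pair_pmf H Q) (\<lambda>w. (dot_err (hash_sign_mat J n w) x y)\<^sup>2)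
        \<le> 9 / real J * (sqn x * sqn y)"
    if x: "x \<in> carrier_vec n" and y: "y \<in> carrier_vec n" for x y
  proof
    have intHQ: "integrable (measure_pmf (pair_pmf H Q)) f" for f :: "_ \<Rightarrow> real"
      using H(1) Q(1) by (intro integrable_measure_pmf_finite) simp
    define z where "z p h = of_bool (fst p \<noteq> snd p \<and> h (fst p) = h (snd p)) * (x $ fst p * y $ snd p)"
      for p :: "nat \<times> nat" and h :: "nat \<Rightarrow> nat"
    define \<sigma> where "\<sigma> p s = s (fst p) * s (snd p)" for p :: "nat \<times> nat" and s :: "nat \<Rightarrow> real"
    have err: "dot_err (hash_sign_mat J n w) x y = (\<Sum>p\<in>?D. z p (fst w) * \<sigma> p (snd w))"
      if "w \<in> set_pmf (pair_pmf H Q)" for w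
      using dot_err_hash_sign[OF x y, of "fst w" J "snd w"] that H(2) Q(2)
      by (auto simp: z_def \<sigma>_def case_prod_unfold)
    have "mean (pair_pmf H Q) (\<lambda>w. dot_err (hash_sign_mat J n w) x y)
        = mean (pair_pmf H Q) (\<lambda>w. \<Sum>p\<in>?D. z p (fst w) * \<sigma> p (snd w))"
      by (rule expectation_cong_pmf) (rule err)
    also have "\<dots> = (\<Sum>p\<in>?D. mean (pair_pmf H Q) (\<lambda>w. z p (fst w) * \<sigma> p (snd w)))"
      by (rule Bochner_Integration.integral_sum) (rule intHQ)
    also have "\<dots> = (\<Sum>p\<in>?D. mean H (z p) * mean Q (\<sigma> p))"
      using expectation_pair_pmf_prod[OF H(1) Q(1)] by (simp add: case_prod_unfold)
    also have "\<dots> = 0"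
    proof (rule sum.neutral, rule ballI)
      fix p assume "p \<in> ?D"
      then show "mean H (z p) * mean Q (\<sigma> p) = 0"
        by (cases "fst p = snd p") (auto simp: z_def[abs_def] \<sigma>_def[abs_def] Q(3))
    qed
    finally show "mean (pair_pmf H Q) (\<lambda>w. dot_err (hash_sign_mat J n w) x y) = 0" .
    let ?x = "\<lambda>a. \<bar>x $ a\<bar>" and ?y = "\<lambda>b. \<bar>y $ b\<bar>"
    let ?pp = "\<lambda>p p'. of_bool (paired (m1 (fst p)) (m1 (snd p)) (m1 (fst p')) (m1 (snd p')))
        * of_bool (paired (m2 (fst p)) (m2 (snd p)) (m2 (fst p')) (m2 (snd p'))) :: real"
    have zz: "\<bar>mean H (\<lambda>h. z p h * z p' h)\<bar>
        \<le> 1 / real J * (?x (fst p) * ?y (snd p) * (?x (fst p') * ?y (snd p')))" if "p \<in> ?D" for p p'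
    proof -
      have "\<bar>mean H (\<lambda>h. z p h * z p' h)\<bar> \<le> mean H (\<lambda>h. \<bar>z p h * z p' h\<bar>)"
        by (rule integral_abs_bound)
      also have "\<dots> \<le> mean H (\<lambda>h. of_bool (fst p \<noteq> snd p \<and> h (fst p) = h (snd p))
          * (?x (fst p) * ?y (snd p) * (?x (fst p') * ?y (snd p'))))"
        by (rule expectation_mono_pmf[OF H(1)]) (auto simp: z_def abs_mult)
      also have "\<dots> = mean H (\<lambda>h. of_bool (fst p \<noteq> snd p \<and> h (fst p) = h (snd p)))
          * (?x (fst p) * ?y (snd p) * (?x (fst p') * ?y (snd p')))"
        by simp
      also have "\<dots> \<le> 1 / real J * (?x (fst p) * ?y (snd p) * (?x (fst p') * ?y (snd p')))"
        using H(3)[of "fst p" "snd p"] that by (intro mult_right_mono) (cases "fst p = snd p"; auto)+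
      finally show ?thesis .
    qed
    have \<sigma>\<sigma>: "\<bar>mean Q (\<lambda>s. \<sigma> p s * \<sigma> p' s)\<bar> \<le> ?pp p p'" if "p \<in> ?D" "p' \<in> ?D" for p p'
      using Q(4)[of "fst p" "snd p" "fst p'" "snd p'"] that by (auto simp: \<sigma>_def mult.assoc)
    have factor: "mean (pair_pmf H Q) (\<lambda>w. (z p (fst w) * z p' (fst w)) * (\<sigma> p (snd w) * \<sigma> p' (snd w)))
        = mean H (\<lambda>h. z p h * z p' h) * mean Q (\<lambda>s. \<sigma> p s * \<sigma> p' s)" for p p'
      using expectation_pair_pmf_prod[OF H(1) Q(1), of "\<lambda>h. z p h * z p' h" "\<lambda>s. \<sigma> p s * \<sigma> p' s"]
      by (simp only: case_prod_unfold)
    have "mean (pair_pmf H Q) (\<lambda>w. (dot_err (hash_sign_mat J n w) x y)\<^sup>2)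
        = mean (pair_pmf H Q)
            (\<lambda>w. \<Sum>(p, p')\<in>?D \<times> ?D. (z p (fst w) * z p' (fst w)) * (\<sigma> p (snd w) * \<sigma> p' (snd w)))"
      by (rule expectation_cong_pmf)
        (simp add: err power2_eq_square sum_product sum.cartesian_product mult_ac)
    also have "\<dots> = (\<Sum>(p, p')\<in>?D \<times> ?D. mean (pair_pmf H Q)
        (\<lambda>w. (z p (fst w) * z p' (fst w)) * (\<sigma> p (snd w) * \<sigma> p' (snd w))))"
      unfolding case_prod_unfold by (rule Bochner_Integration.integral_sum) (rule intHQ)
    also have "\<dots> = (\<Sum>(p, p')\<in>?D \<times> ?D. mean H (\<lambda>h. z p h * z p' h)
        * mean Q (\<lambda>s. \<sigma> p s * \<sigma> p' s))"
      by (simp only: factor)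
    also have "\<dots> \<le> (\<Sum>(p, p')\<in>?D \<times> ?D.
        1 / real J * (?x (fst p) * ?y (snd p) * (?x (fst p') * ?y (snd p'))) * ?pp p p')"
      unfolding case_prod_unfold
    proof (rule sum_mono)
      fix w assume "w \<in> ?D \<times> ?D"
      then obtain p p' where w: "w = (p, p')" and p: "p \<in> ?D" "p' \<in> ?D" by blast
      have "mean H (\<lambda>h. z p h * z p' h) * mean Q (\<lambda>s. \<sigma> p s * \<sigma> p' s)
          \<le> \<bar>mean H (\<lambda>h. z p h * z p' h)\<bar> * \<bar>mean Q (\<lambda>s. \<sigma> p s * \<sigma> p' s)\<bar>"
        unfolding abs_mult[symmetric] by simp
      also have "\<dots> \<le> 1 / real J * (?x (fst p) * ?y (snd p) * (?x (fst p') * ?y (snd p'))) * ?pp p p'"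
        by (intro mult_mono zz \<sigma>\<sigma> p) auto
      finally show "mean H (\<lambda>h. z (fst w) h * z (snd w) h)
            * mean Q (\<lambda>s. \<sigma> (fst w) s * \<sigma> (snd w) s)
          \<le> 1 / real J * (?x (fst (fst w)) * ?y (snd (fst w)) * (?x (fst (snd w)) * ?y (snd (snd w))))
            * ?pp (fst w) (snd w)"
        unfolding w fst_conv snd_conv .
    qed
    also have "\<dots> = 1 / real J * (\<Sum>((a, b), (c, d))\<in>?D \<times> ?D.
        of_bool (paired (m1 a) (m1 b) (m1 c) (m1 d)) * of_bool (paired (m2 a) (m2 b) (m2 c) (m2 d))
          * (?x a * ?y b * (?x c * ?y d)))"
      unfolding sum_distrib_left by (intro sum.cong refl) (simp only: case_prod_unfold mult_ac)
    also have "\<dots> \<le> 1 / real J * (9 * ((\<Sum>a<n. (?x a)\<^sup>2) * (\<Sum>b<n. (?y b)\<^sup>2)))"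
      using inj by (intro mult_left_mono sum_paired_le) simp_all
    also have "\<dots> = 9 / real J * (sqn x * sqn y)"
      using x y by (simp add: scalar_prod_def atLeast0LessThan power2_eq_square)
    finally show "mean (pair_pmf H Q) (\<lambda>w. (dot_err (hash_sign_mat J n w) x y)\<^sup>2)
        \<le> 9 / real J * (sqn x * sqn y)" .
  qed
  have carrier: "hash_sign_mat J n w \<in> carrier_mat J n" for w
    by (simp add: hash_sign_mat_def case_prod_unfold)
  show ?thesis
    unfolding dot_preserving_def using moments H(1) Q(1) carrier by (simp add: image_subset_iff)
qed

section \<open>CountSketch, TensorSketch and the recursive sketch\<close>

lemma hash_sign_mat_zero_beyond:
  "hash_sign_mat J n (zero_beyond n h, zero_beyond n s) = hash_sign_mat J n (h, s)"
  by (rule eq_matI) (simp_all add: hash_sign_mat_def zero_beyond_def)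

lemma pairwise_hash_collision:
  assumes H: "pairwise_hash I J H" and ab: "a < I" "b < I" "a \<noteq> b"
  shows "mean H (\<lambda>h. of_bool (h a = h b)) \<le> 1 / real J"
proof -
  have "mean H (\<lambda>h. of_bool (h a = h b))
      = mean H (\<lambda>h. of_bool ((h a + 0) mod J = (h b + 0) mod J) :: real)"
  proof (rule expectation_cong_pmf)
    fix h assume "h \<in> set_pmf H"
    then have "h a < J" "h b < J" using H ab unfolding pairwise_hash_def by blast+
    then show "of_bool (h a = h b) = (of_bool ((h a + 0) mod J = (h b + 0) mod J) :: real)" by simp
  qed
  also have "\<dots> \<le> 1 / real J"
    using H ab unfolding pairwise_hash_def by blast
  finally show ?thesis .
qed

lemma sign_moments_four:
  assumes "sign_moments I Q" "a < I" "b < I" "c < I" "d < I"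
  shows "\<bar>mean Q (\<lambda>s. s a * s b * s c * s d)\<bar> \<le> of_bool (paired a b c d)"
  using assms unfolding sign_moments_def by blast

lemma dot_preserving_count_sketch:
  assumes P: "count_sketch J I P" and J: "0 < J"
  shows "dot_preserving J I (1 + 9 / real J) P"
proof -
  obtain h s where h: "is_hash I J h" and s: "is_sign I s"
    and P_eq: "P = map_pmf (count_sketch_mat J I) (pair_pmf h s)"
    using P unfolding count_sketch_def by blast
  let ?h = "map_pmf (zero_beyond I) h" and ?s = "map_pmf (zero_beyond I) s"
  have H: "pairwise_hash I J ?h" by (rule is_hash_zero_beyond[OF h J])
  have S: "sign_moments I ?s" by (rule is_sign_zero_beyond[OF s])
  have "map_pmf (hash_sign_mat J I) (pair_pmf ?h ?s) = map_pmf (hash_sign_mat J I) (pair_pmf h s)"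
    unfolding map_pair[symmetric] map_pmf_comp
    by (simp add: case_prod_unfold hash_sign_mat_zero_beyond)
  then have P_eq': "P = map_pmf (hash_sign_mat J I) (pair_pmf ?h ?s)"
    unfolding P_eq count_sketch_mat_def hash_sign_mat_def by simp
  show ?thesis
    unfolding P_eq'
  \<comment> \<open>With a constant second coordinate its pairing condition always holds, and the
    identity alone separates the columns.\<close>
  proof (rule dot_preserving_hash_sign[where ?m1.0 = "\<lambda>c. c" and ?m2.0 = "\<lambda>_. ()"])
    show "finite (set_pmf ?h)" "\<And>f c. f \<in> set_pmf ?h \<Longrightarrow> c < I \<Longrightarrow> f c < J"
      using H unfolding pairwise_hash_def by blast+
    show "finite (set_pmf ?s)" "\<And>f c. f \<in> set_pmf ?s \<Longrightarrow> c < I \<Longrightarrow> (f c)\<^sup>2 = 1"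
      using S unfolding sign_moments_def by blast+
    fix a b assume ab: "a < I" "b < I" "a \<noteq> b"
    show "mean ?h (\<lambda>h. of_bool (h a = h b)) \<le> 1 / real J"
      by (rule pairwise_hash_collision[OF H ab])
    show "mean ?s (\<lambda>s. s a * s b) = 0"
      by (rule sign_moments_two[OF S ab])
  next
    fix a b c d assume "a < I" "b < I" "c < I" "d < I"
    then have "\<bar>mean ?s (\<lambda>s. s a * s b * s c * s d)\<bar> \<le> of_bool (paired a b c d)"
      by (rule sign_moments_four[OF S])
    then show "\<bar>mean ?s (\<lambda>s. s a * s b * s c * s d)\<bar>
        \<le> of_bool (paired a b c d) * of_bool (paired () () () ())"
      by (simp add: paired_def)
  qed
qed

definition sum_hash :: "nat \<Rightarrow> nat \<Rightarrow> (nat \<Rightarrow> nat) \<times> (nat \<Rightarrow> nat) \<Rightarrow> nat \<Rightarrow> nat" where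
  "sum_hash J I = (\<lambda>(h1, h2) c. (Suc (h1 (c mod I)) + Suc (h2 (c div I))) mod J)"

definition prod_sign :: "nat \<Rightarrow> (nat \<Rightarrow> real) \<times> (nat \<Rightarrow> real) \<Rightarrow> nat \<Rightarrow> real" where
  "prod_sign I = (\<lambda>(s1, s2) c. s1 (c mod I) * s2 (c div I))"

text \<open>TensorSketch draws a hash and a sign for each coordinate; the variance bound wants the
  two hashes together and the two signs together.\<close>

lemma pair_pmf_middle_swap:
  "map_pmf (\<lambda>((a, b), (c, d)). ((a, c), (b, d))) (pair_pmf (pair_pmf A B) (pair_pmf C D))
    = pair_pmf (pair_pmf A C) (pair_pmf B D)"
  unfolding pair_pmf_def map_bind_pmf bind_assoc_pmf bind_return_pmf map_return_pmf prod.case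
  by (subst (2) bind_commute_pmf) (rule refl)

lemma tensor_sketch_mat_eq:
  assumes "0 < I"
  shows "tensor_sketch_mat J I ((h1, s1), (h2, s2)) = hash_sign_mat J (I\<^sup>2)
    (sum_hash J I (zero_beyond I h1, zero_beyond I h2), prod_sign I (zero_beyond I s1, zero_beyond I s2))"
proof (rule eq_matI)
  fix i c assume ic: "i < dim_row (hash_sign_mat J (I\<^sup>2)
      (sum_hash J I (zero_beyond I h1, zero_beyond I h2), prod_sign I (zero_beyond I s1, zero_beyond I s2)))"
    "c < dim_col (hash_sign_mat J (I\<^sup>2)
      (sum_hash J I (zero_beyond I h1, zero_beyond I h2), prod_sign I (zero_beyond I s1, zero_beyond I s2)))"
  then have "i < J" "c < I * I" by (simp_all add: hash_sign_mat_def power2_eq_square)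
  moreover from this have "c mod I < I" "c div I < I"
    using assms by (simp_all add: less_mult_imp_div_less)
  ultimately show "tensor_sketch_mat J I ((h1, s1), (h2, s2)) $$ (i, c) = hash_sign_mat J (I\<^sup>2)
      (sum_hash J I (zero_beyond I h1, zero_beyond I h2), prod_sign I (zero_beyond I s1, zero_beyond I s2)) $$ (i, c)"
    by (simp add: tensor_sketch_mat_def hash_sign_mat_def sum_hash_def prod_sign_def zero_beyond_def
        power2_eq_square)
qed (simp_all add: tensor_sketch_mat_def hash_sign_mat_def)

text \<open>Distinct columns differ in some coordinate. Once the hash of the other coordinate is
  fixed, its values act as shifts and the collision probability is at most 1 / J.\<close>

lemma sum_hash_collision:
  assumes H1: "pairwise_hash I J H1" and H2: "pairwise_hash I J H2" and I: "0 < I"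
    and ab: "a < I\<^sup>2" "b < I\<^sup>2" "a \<noteq> b"
  shows "mean (map_pmf (sum_hash J I) (pair_pmf H1 H2)) (\<lambda>h. of_bool (h a = h b)) \<le> 1 / real J"
proof -
  have fin: "finite (set_pmf H1)" "finite (set_pmf H2)"
    using H1 H2 unfolding pairwise_hash_def by blast+
  have lt: "c mod I < I" "c div I < I" if "c < I\<^sup>2" for c
    using that I by (simp_all add: less_mult_imp_div_less power2_eq_square)
  have coll: "mean H (\<lambda>h. of_bool ((h u + t) mod J = (h v + t') mod J)) \<le> 1 / real J"
    if "pairwise_hash I J H" "u < I" "v < I" "u \<noteq> v" for H u v t t'
    using that unfolding pairwise_hash_def by blast
  have const: "mean H (\<lambda>h. mean H' (\<lambda>h'. F h h')) \<le> 1 / real J"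
    if "finite (set_pmf H)" "\<And>h. mean H' (\<lambda>h'. F h h') \<le> 1 / real J"
    for H H' :: "(nat \<Rightarrow> nat) pmf" and F :: "(nat \<Rightarrow> nat) \<Rightarrow> (nat \<Rightarrow> nat) \<Rightarrow> real"
  proof -
    have "mean H (\<lambda>h. mean H' (\<lambda>h'. F h h'))
        \<le> mean H (\<lambda>_. 1 / real J)"
      by (rule expectation_mono_pmf[OF that])
    then show ?thesis by simp
  qed
  show ?thesis
  proof (cases "a mod I = b mod I")
    case False
    have "mean (map_pmf (sum_hash J I) (pair_pmf H1 H2)) (\<lambda>h. of_bool (h a = h b) :: real)
        = mean H2 (\<lambda>h2. mean H1 (\<lambda>h1.
            of_bool ((h1 (a mod I) + Suc (Suc (h2 (a div I)))) mod J
              = (h1 (b mod I) + Suc (Suc (h2 (b div I)))) mod J)))"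
      using fin by (simp add: expectation_pair_pmf_finite sum_hash_def)
    also have "\<dots> \<le> 1 / real J"
      by (intro const fin coll[OF H1] lt ab False)
    finally show ?thesis .
  next
    case True
    have neq: "a div I \<noteq> b div I"
      using True ab(3) by (metis div_mult_mod_eq)
    have "mean (map_pmf (sum_hash J I) (pair_pmf H1 H2)) (\<lambda>h. of_bool (h a = h b) :: real)
        = mean (pair_pmf H2 H1) (\<lambda>(h2, h1).
            of_bool ((h2 (a div I) + Suc (Suc (h1 (a mod I)))) mod J
              = (h2 (b div I) + Suc (Suc (h1 (b mod I)))) mod J))"
      by (subst pair_commute_pmf) (simp add: sum_hash_def case_prod_unfold add.commute)
    also have "\<dots> = mean H1 (\<lambda>h1. mean H2 (\<lambda>h2.
            of_bool ((h2 (a div I) + Suc (Suc (h1 (a mod I)))) mod J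
              = (h2 (b div I) + Suc (Suc (h1 (b mod I)))) mod J)))"
      using fin by (simp add: expectation_pair_pmf_finite)
    also have "\<dots> \<le> 1 / real J"
      by (intro const fin coll[OF H2] lt ab neq)
    finally show ?thesis .
  qed
qed

lemma dot_preserving_tensor_sketch:
  assumes P: "tensor_sketch J I P" and J: "0 < J" and I: "0 < I"
  shows "dot_preserving J (I\<^sup>2) (1 + 9 / real J) P"
proof -
  obtain h1 s1 h2 s2 where h: "is_hash I J h1" "is_hash I J h2" and s: "is_sign I s1" "is_sign I s2"
    and P_eq: "P = map_pmf (tensor_sketch_mat J I) (pair_pmf (pair_pmf h1 s1) (pair_pmf h2 s2))"
    using P unfolding tensor_sketch_def by blast
  let ?h1 = "map_pmf (zero_beyond I) h1" and ?h2 = "map_pmf (zero_beyond I) h2"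
  let ?s1 = "map_pmf (zero_beyond I) s1" and ?s2 = "map_pmf (zero_beyond I) s2"
  let ?H = "map_pmf (sum_hash J I) (pair_pmf ?h1 ?h2)" and ?S = "map_pmf (prod_sign I) (pair_pmf ?s1 ?s2)"
  note H = is_hash_zero_beyond[OF h(1) J] is_hash_zero_beyond[OF h(2) J]
  note S = is_sign_zero_beyond[OF s(1)] is_sign_zero_beyond[OF s(2)]
  have finS: "finite (set_pmf ?s1)" "finite (set_pmf ?s2)"
    using S unfolding sign_moments_def by blast+
  have finH: "finite (set_pmf ?h1)" "finite (set_pmf ?h2)"
    using H unfolding pairwise_hash_def by blast+
  have P_swap: "pair_pmf (pair_pmf h1 s1) (pair_pmf h2 s2)
      = map_pmf (\<lambda>((a, b), (c, d)). ((a, c), (b, d))) (pair_pmf (pair_pmf h1 h2) (pair_pmf s1 s2))"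
    by (rule pair_pmf_middle_swap[symmetric])
  have "pair_pmf ?H ?S = map_pmf (\<lambda>((a, b), (c, d)). (sum_hash J I (zero_beyond I a, zero_beyond I b),
      prod_sign I (zero_beyond I c, zero_beyond I d))) (pair_pmf (pair_pmf h1 h2) (pair_pmf s1 s2))"
    unfolding map_pair[symmetric] map_pmf_comp by (simp add: case_prod_unfold)
  then have P_eq': "P = map_pmf (hash_sign_mat J (I\<^sup>2)) (pair_pmf ?H ?S)"
    unfolding P_eq P_swap
    by (simp add: map_pmf_comp case_prod_unfold tensor_sketch_mat_eq[OF I])
  have lt: "c mod I < I" "c div I < I" if "c < I\<^sup>2" for c
    using that I by (simp_all add: less_mult_imp_div_less power2_eq_square)
  show ?thesis
    unfolding P_eq'
  proof (rule dot_preserving_hash_sign[where ?m1.0 = "\<lambda>c. c mod I" and ?m2.0 = "\<lambda>c. c div I"])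
    show "finite (set_pmf ?H)" "finite (set_pmf ?S)"
      using finH finS by simp_all
    show "f c < J" if "f \<in> set_pmf ?H" for f c
      using that J by (auto simp: sum_hash_def)
    show "(f c)\<^sup>2 = 1" if f: "f \<in> set_pmf ?S" and c: "c < I\<^sup>2" for f c
    proof -
      obtain f1 f2 where f12: "f1 \<in> set_pmf ?s1" "f2 \<in> set_pmf ?s2" "f = prod_sign I (f1, f2)"
        using f unfolding set_map_pmf set_pair_pmf by blast
      then have "(f1 (c mod I))\<^sup>2 = 1" "(f2 (c div I))\<^sup>2 = 1"
        using S lt[OF c] unfolding sign_moments_def by blast+
      then show ?thesis unfolding f12(3) by (simp add: prod_sign_def power_mult_distrib)
    qed
    show "mean ?H (\<lambda>h. of_bool (h a = h b)) \<le> 1 / real J"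
      if "a < I\<^sup>2" "b < I\<^sup>2" "a \<noteq> b" for a b
      by (rule sum_hash_collision[OF H I that])
    have E: "mean ?S F = mean ?s1 f * mean ?s2 g"
      if "\<And>s1 s2. F (prod_sign I (s1, s2)) = f s1 * g s2" for F :: "(nat \<Rightarrow> real) \<Rightarrow> real" and f g
    proof -
      have "mean ?S F = mean (pair_pmf ?s1 ?s2) (\<lambda>(s1, s2). f s1 * g s2)"
        by (simp add: case_prod_unfold that[symmetric])
      then show ?thesis using expectation_pair_pmf_prod[OF finS] by simp
    qed
    show "mean ?S (\<lambda>s. s a * s b) = 0"
      if ab: "a < I\<^sup>2" "b < I\<^sup>2" "a \<noteq> b" for a b
    proof -
      have "mean ?S (\<lambda>s. s a * s b)
          = mean ?s1 (\<lambda>s. s (a mod I) * s (b mod I))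
            * mean ?s2 (\<lambda>s. s (a div I) * s (b div I))"
        by (rule E) (simp add: prod_sign_def)
      moreover have "a mod I \<noteq> b mod I \<or> a div I \<noteq> b div I"
        using ab(3) by (metis div_mult_mod_eq)
      ultimately show ?thesis
        using sign_moments_two[OF S(1) lt(1)[OF ab(1)] lt(1)[OF ab(2)]]
          sign_moments_two[OF S(2) lt(2)[OF ab(1)] lt(2)[OF ab(2)]] by auto
    qed
    show "\<bar>mean ?S (\<lambda>s. s a * s b * s c * s d)\<bar>
        \<le> of_bool (paired (a mod I) (b mod I) (c mod I) (d mod I))
          * of_bool (paired (a div I) (b div I) (c div I) (d div I))"
      if abcd: "a < I\<^sup>2" "b < I\<^sup>2" "c < I\<^sup>2" "d < I\<^sup>2" for a b c d
    proof -
      have "mean ?S (\<lambda>s. s a * s b * s c * s d)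
          = mean ?s1 (\<lambda>s. s (a mod I) * s (b mod I) * s (c mod I) * s (d mod I))
            * mean ?s2 (\<lambda>s. s (a div I) * s (b div I) * s (c div I) * s (d div I))"
        by (rule E) (simp add: prod_sign_def)
      then show ?thesis
        using sign_moments_four[OF S(1) abcd[THEN lt(1)]] sign_moments_four[OF S(2) abcd[THEN lt(2)]]
        by (simp only: abs_mult) (rule mult_mono, simp_all)
    qed
    show "c = c'" if "c mod I = c' mod I" "c div I = c' div I" for c c'
      using that by (metis div_mult_mod_eq)
  qed
qed

section \<open>The layered sketch and its padding\<close>

lemma pair_pmf_rotate:
  "map_pmf (\<lambda>(x, (y, z)). (z, (x, y))) (pair_pmf X (pair_pmf Y Z)) = pair_pmf Z (pair_pmf X Y)"
  by (subst pair_commute_pmf[of Z]) (simp add: pair_pair_pmf map_pmf_comp case_prod_unfold)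

lemma sketch_tree_cong:
  assumes "\<And>x. x \<in> (SIGMA m:{1..l}. {1..2 ^ (q - m)}) \<Longrightarrow> T x = T' x"
  shows "sketch_tree q C T l = sketch_tree q C T' l"
  using assms
proof (induction l)
  case (Suc l)
  have "map (\<lambda>k. T (Suc l, k)) [1..<Suc (2 ^ (q - Suc l))] = map (\<lambda>k. T' (Suc l, k)) [1..<Suc (2 ^ (q - Suc l))]"
    using Suc.prems by (intro map_cong refl) auto
  moreover have "sketch_tree q C T l = sketch_tree q C T' l"
    using Suc.prems by (intro Suc.IH) auto
  ultimately show ?case by (simp only: sketch_tree.simps)
qed simp

text \<open>The exponent counts random factors: 2^q CountSketches and 2^(q-m) TensorSketches in each
  layer m \<le> l, altogether 2^(q+1) - 2^(q-l). Layer m maps J^(2^(q-m+1)) coordinates to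
  J^(2^(q-m)).\<close>

lemma dot_preserving_sketch_tree:
  assumes J: "0 < J" and len: "length Is = 2 ^ q"
    and C: "\<And>k. k \<in> {1..2 ^ q} \<Longrightarrow> count_sketch J (Is ! (k - 1)) (PC k)"
    and T: "\<And>x. x \<in> (SIGMA m:{1..q}. {1..2 ^ (q - m)}) \<Longrightarrow> tensor_sketch J J (PT x)"
    and l: "l \<le> q"
  shows "dot_preserving (J ^ 2 ^ (q - l)) (prod_list Is) ((1 + 9 / real J) ^ (2 ^ Suc q - 2 ^ (q - l)))
    (map_pmf (\<lambda>(C, T). sketch_tree q C T l)
      (pair_pmf (Pi_pmf {1..2 ^ q} D PC) (Pi_pmf (SIGMA m:{1..l}. {1..2 ^ (q - m)}) D PT)))"
  using l
proof (induction l)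
  case 0
  let ?ks = "[1..<Suc (2 ^ q)]"
  have "dot_preserving (prod_list (map (\<lambda>_. J) ?ks)) (prod_list (map (\<lambda>k. Is ! (k - 1)) ?ks))
      ((1 + 9 / real J) ^ length ?ks)
      (map_pmf (\<lambda>C. kron_list (map C ?ks)) (Pi_pmf {1..2 ^ q} D PC))"
    using C J by (intro dot_preserving_kron_list dot_preserving_count_sketch) auto
  moreover have "map (\<lambda>k. Is ! (k - 1)) ?ks = Is"
    using len by (intro nth_equalityI) (simp_all del: upt_Suc)
  moreover have "prod_list (map (\<lambda>_. J) ?ks) = J ^ 2 ^ q"
    by (simp add: map_replicate_const del: upt_Suc)
  ultimately show ?case
    by (simp add: pair_return_pmf2 map_pmf_comp del: upt_Suc)
next
  case (Suc l)
  let ?b = "1 + 9 / real J" and ?m = "2 ^ (q - Suc l) :: nat"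
  let ?A = "SIGMA m:{1..l}. {1..2 ^ (q - m)} :: (nat \<times> nat) set" and ?B = "{Suc l} \<times> {1..?m}"
  let ?ks = "map (Pair (Suc l)) [1..<Suc ?m]"
  let ?X = "Pi_pmf {1..2 ^ q} D PC" and ?Y = "Pi_pmf ?A D PT" and ?Z = "Pi_pmf ?B D PT"
  let ?K = "\<lambda>g. kron_list (map g ?ks)" and ?tree = "\<lambda>(C, T). sketch_tree q C T l"
  have IH: "dot_preserving (J ^ 2 ^ (q - l)) (prod_list Is) (?b ^ (2 ^ Suc q - 2 ^ (q - l)))
      (map_pmf ?tree (pair_pmf ?X ?Y))"
    using Suc by simp
  have m2: "2 ^ (q - l) = 2 * ?m"
    using Suc.prems by (simp add: Suc_diff_Suc[symmetric] power_Suc[symmetric] del: power_Suc)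
  have "dot_preserving (prod_list (map (\<lambda>_. J) ?ks)) (prod_list (map (\<lambda>_. J\<^sup>2) ?ks)) (?b ^ length ?ks) (map_pmf ?K ?Z)"
    using T J Suc.prems
    by (intro dot_preserving_kron_list dot_preserving_tensor_sketch) (auto simp: distinct_map inj_on_def)
  then have top: "dot_preserving (J ^ ?m) (J ^ 2 ^ (q - l)) (?b ^ ?m) (map_pmf ?K ?Z)"
    by (simp add: map_replicate_const comp_def m2 power_mult del: upt_Suc)
  \<comment> \<open>Separating the keys of the top layer shows that layer to be independent of the
    tree below it.\<close>
  have "(SIGMA m:{1..Suc l}. {1..2 ^ (q - m)}) = ?A \<union> ?B"
    by (auto simp: le_Suc_eq)
  then have split: "Pi_pmf (SIGMA m:{1..Suc l}. {1..2 ^ (q - m)}) D PT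
      = map_pmf (\<lambda>(f, g) x. if x \<in> ?A then f x else g x) (pair_pmf ?Y ?Z)"
    by (simp only:) (rule Pi_pmf_union; auto)
  have tree: "sketch_tree q C (\<lambda>x. if x \<in> ?A then f x else g x) (Suc l) = ?K g * sketch_tree q C f l" for C f g
  proof -
    have "sketch_tree q C (\<lambda>x. if x \<in> ?A then f x else g x) l = sketch_tree q C f l"
      by (rule sketch_tree_cong) simp
    moreover have "map (\<lambda>k. if (Suc l, k) \<in> ?A then f (Suc l, k) else g (Suc l, k)) [1..<Suc ?m] = map g ?ks"
      by simp
    ultimately show ?thesis by (simp only: sketch_tree.simps)
  qed
  have "map_pmf (\<lambda>(C, T). sketch_tree q C T (Suc l))
      (pair_pmf ?X (Pi_pmf (SIGMA m:{1..Suc l}. {1..2 ^ (q - m)}) D PT))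
    = map_pmf (\<lambda>(C, T). sketch_tree q C T (Suc l))
      (map_pmf (\<lambda>(C, (f, g)). (C, \<lambda>x. if x \<in> ?A then f x else g x)) (pair_pmf ?X (pair_pmf ?Y ?Z)))"
    unfolding split using map_pair[of "\<lambda>x. x" "\<lambda>(f, g) x. if x \<in> ?A then f x else g x" ?X "pair_pmf ?Y ?Z"]
    by (simp only: map_pmf_ident case_prod_unfold)
  also have "\<dots> = map_pmf (\<lambda>(C, (f, g)). ?K g * sketch_tree q C f l) (pair_pmf ?X (pair_pmf ?Y ?Z))"
    unfolding map_pmf_comp case_prod_unfold fst_conv snd_conv tree ..
  also have "\<dots> = map_pmf (\<lambda>(g, (C, f)). ?K g * sketch_tree q C f l) (pair_pmf ?Z (pair_pmf ?X ?Y))"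
    unfolding pair_pmf_rotate[of ?X ?Y ?Z, symmetric] map_pmf_comp by (simp only: case_prod_unfold fst_conv snd_conv)
  also have "\<dots> = map_pmf (\<lambda>(B, A). B * A) (pair_pmf (map_pmf ?K ?Z) (map_pmf ?tree (pair_pmf ?X ?Y)))"
    unfolding map_pair[symmetric] map_pmf_comp by (simp only: case_prod_unfold fst_conv snd_conv)
  finally have eq: "map_pmf (\<lambda>(C, T). sketch_tree q C T (Suc l))
      (pair_pmf ?X (Pi_pmf (SIGMA m:{1..Suc l}. {1..2 ^ (q - m)}) D PT))
    = map_pmf (\<lambda>(B, A). B * A) (pair_pmf (map_pmf ?K ?Z) (map_pmf ?tree (pair_pmf ?X ?Y)))" .
  have "2 ^ (q - l) \<le> (2 :: nat) ^ Suc q" by (intro power_increasing) auto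
  then have "?m + (2 ^ Suc q - 2 ^ (q - l)) = 2 ^ Suc q - ?m"
    unfolding m2 by simp
  then show ?case
    unfolding eq using dot_preserving_mult[OF top IH] by (simp only: power_add[symmetric])
qed

lemma dot_preserving_recursive_sketch_pow2:
  assumes P: "recursive_sketch_pow2 J Is P" and J: "0 < J"
  shows "dot_preserving J (prod_list Is) ((1 + 9 / real J) ^ (2 * length Is)) P"
proof -
  obtain q PC PT where len: "length Is = 2 ^ q"
    and C: "\<forall>k\<in>{1..2 ^ q}. count_sketch J (Is ! (k - 1)) (PC k)"
    and T: "\<forall>x\<in>(SIGMA m:{1..q}. {1..2 ^ (q - m)}). tensor_sketch J J (PT x)"
    and P_eq: "P = map_pmf (\<lambda>(C, T). sketch_tree q C T q)
      (pair_pmf (Pi_pmf {1..2 ^ q} (0\<^sub>m 0 0) PC) (Pi_pmf (SIGMA m:{1..q}. {1..2 ^ (q - m)}) (0\<^sub>m 0 0) PT))"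
    using P unfolding recursive_sketch_pow2_def by blast
  have "dot_preserving (J ^ 2 ^ (q - q)) (prod_list Is) ((1 + 9 / real J) ^ (2 ^ Suc q - 2 ^ (q - q))) P"
    unfolding P_eq using C T by (intro dot_preserving_sketch_tree J len) auto
  moreover have "(1 + 9 / real J) ^ (2 ^ Suc q - 2 ^ (q - q)) \<le> (1 + 9 / real J) ^ (2 * length Is)"
    using len by (intro power_increasing) auto
  ultimately show ?thesis by (auto intro: dot_preserving_mono)
qed

lemma dot_preserving_unit_column:
  assumes "0 < n"
  shows "dot_preserving n 1 1 (return_pmf (mat_of_cols n [unit_vec n 0]))"
proof (rule dot_preserving_return)
  let ?E = "mat_of_cols n [unit_vec n 0] :: real mat"
  show "?E \<in> carrier_mat n 1" by (simp add: mat_of_cols_def)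
  fix x y :: "real Matrix.vec" assume x: "x \<in> carrier_vec 1" and y: "y \<in> carrier_vec 1"
  have E: "(?E *\<^sub>v z) $ i = (if i = 0 then z $ 0 else 0)" if "z \<in> carrier_vec 1" "i < n" for z i
    using that by (simp add: mat_of_cols_def scalar_prod_def)
  have "scalar_prod (?E *\<^sub>v x) (?E *\<^sub>v y) = (\<Sum>i<n. (?E *\<^sub>v x) $ i * (?E *\<^sub>v y) $ i)"
    by (simp add: scalar_prod_def mat_of_cols_def atLeast0LessThan del: index_mult_mat_vec)
  also have "\<dots> = (\<Sum>i<n. if i = 0 then x $ 0 * y $ 0 else 0)"
    by (intro sum.cong refl) (simp add: E[OF x] E[OF y] del: index_mult_mat_vec)
  also have "\<dots> = scalar_prod x y"
    using assms y by (simp add: scalar_prod_def)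
  finally show "scalar_prod (?E *\<^sub>v x) (?E *\<^sub>v y) = scalar_prod x y" .
qed

lemma dot_preserving_kron_list_replicate:
  assumes "dot_preserving n 1 1 (return_pmf E)"
  shows "dot_preserving (n ^ d) 1 1 (return_pmf (kron_list (replicate d E)))"
proof (induction d)
  case 0
  then show ?case by (auto simp: kron_list_def intro!: dot_preserving_return)
next
  case (Suc d)
  have "dot_preserving (n * n ^ d) (1 * 1) (1 * 1)
      (map_pmf (\<lambda>(A, B). kron A B) (pair_pmf (return_pmf E) (return_pmf (kron_list (replicate d E)))))"
    by (rule dot_preserving_kron[OF assms Suc])
  then show ?case by (simp add: kron_list_def)
qed

text \<open>Padding composes the sketch with a deterministic isometry, whose constant is 1. Rounding
  the number of modes up to a power of two at most doubles it, hence 4 in place of 2 in the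
  exponent.\<close>

lemma dot_preserving_recursive_sketch:
  assumes P: "recursive_sketch J Is P" and J: "0 < J" and Is: "Is \<noteq> []" "\<And>i. i \<in> set Is \<Longrightarrow> 0 < i"
  shows "dot_preserving J (prod_list Is) ((1 + 9 / real J) ^ (4 * length Is)) P"
proof (cases "\<exists>q. length Is = 2 ^ q")
  case True
  then have "recursive_sketch_pow2 J Is P" using P unfolding recursive_sketch_def by (simp add: Let_def)
  from dot_preserving_recursive_sketch_pow2[OF this J]
  show ?thesis by (rule dot_preserving_mono) (intro power_increasing; simp)
next
  case False
  define d where "d = 2 ^ nat \<lceil>log 2 (real (length Is))\<rceil> - length Is"
  define n where "n = Max (set Is)"
  define e where "e = kron_list (replicate d (mat_of_cols n [unit_vec n 0 :: real Matrix.vec]))"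
  obtain P' where P': "recursive_sketch_pow2 J (Is @ replicate d n) P'"
    and P_eq: "P = map_pmf (\<lambda>\<Psi>. \<Psi> * kron (1\<^sub>m (prod_list Is)) e) P'"
    using P False unfolding recursive_sketch_def d_def n_def e_def by (auto simp: Let_def)
  have n: "0 < n" unfolding n_def using Is by (intro Is(2) Max_in) auto
  have "d + length Is \<le> 2 * length Is"
  proof -
    have len: "0 < length Is" using Is(1) by simp
    have "real (nat \<lceil>log 2 (real (length Is))\<rceil>) \<le> log 2 (real (length Is)) + 1"
    proof -
      have "0 \<le> log 2 (real (length Is))" using len by (simp add: Suc_le_eq)
      then have "0 \<le> \<lceil>log 2 (real (length Is))\<rceil>" by linarith
      then show ?thesis
        using of_int_ceiling_le_add_one[of "log 2 (real (length Is))"] by (simp add: of_nat_nat)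
    qed
    then have "2 powr real (nat \<lceil>log 2 (real (length Is))\<rceil>) \<le> 2 powr (log 2 (real (length Is)) + 1)"
      by simp
    also have "\<dots> = 2 * real (length Is)" using len by (simp add: powr_add)
    finally have "real (2 ^ nat \<lceil>log 2 (real (length Is))\<rceil>) \<le> real (2 * length Is)"
      by (simp add: powr_realpow)
    then have "2 ^ nat \<lceil>log 2 (real (length Is))\<rceil> \<le> 2 * length Is" by (simp only: of_nat_le_iff)
    then show ?thesis unfolding d_def by linarith
  qed
  then have le: "2 * length (Is @ replicate d n) \<le> 4 * length Is" by simp
  have A: "dot_preserving J (prod_list Is * n ^ d) ((1 + 9 / real J) ^ (2 * length (Is @ replicate d n))) P'"
    using dot_preserving_recursive_sketch_pow2[OF P' J] by simp
  have "dot_preserving (n ^ d) 1 1 (return_pmf e)"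
    unfolding e_def by (intro dot_preserving_kron_list_replicate dot_preserving_unit_column n)
  from dot_preserving_kron_one_left[OF this, of "prod_list Is"]
  have B: "dot_preserving (prod_list Is * n ^ d) (prod_list Is * 1) 1 (return_pmf (kron (1\<^sub>m (prod_list Is)) e))"
    by simp
  have "P = map_pmf (\<lambda>(B, A). B * A) (pair_pmf P' (return_pmf (kron (1\<^sub>m (prod_list Is)) e)))"
    by (simp add: P_eq pair_return_pmf2 map_pmf_comp)
  then have "dot_preserving J (prod_list Is) ((1 + 9 / real J) ^ (2 * length (Is @ replicate d n))) P"
    using dot_preserving_mult[OF A B] by simp
  then show ?thesis
    by (rule dot_preserving_mono) (intro power_increasing le; simp)
qed

section \<open>Subspace embeddings\<close>

text \<open>Gram-Schmidt that skips a column lying in the span of its predecessors. Keeping both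
  coefficient arrays shows that the orthonormal system spans exactly the column space;
  \<open>c\<close> later turns coordinates in that system into coefficients of the given
  columns.\<close>

lemma gram_schmidt_functions:
  fixes K n :: nat and g :: "nat \<Rightarrow> nat \<Rightarrow> real"
  shows "\<exists>m\<le>n. \<exists>(q :: nat \<Rightarrow> nat \<Rightarrow> real) (b :: nat \<Rightarrow> nat \<Rightarrow> real) (c :: nat \<Rightarrow> nat \<Rightarrow> real).
     (\<forall>a<m. \<forall>a'<m. ip K (q a) (q a') = of_bool (a = a')) \<and>
     (\<forall>j<n. \<forall>i<K. g j i = (\<Sum>a<m. q a i * b a j)) \<and>
     (\<forall>a<m. \<forall>i<K. q a i = (\<Sum>j<n. g j i * c j a))"
proof (induction n)
  case 0
  show ?case by (intro exI[of _ 0]) auto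
next
  case (Suc n)
  then obtain m q b c where m: "m \<le> n" and orth: "\<And>a a'. a < m \<Longrightarrow> a' < m \<Longrightarrow> ip K (q a) (q a') = of_bool (a = a')"
    and g: "\<And>j i. j < n \<Longrightarrow> i < K \<Longrightarrow> g j i = (\<Sum>a<m. q a i * b a j)"
    and q: "\<And>a i. a < m \<Longrightarrow> i < K \<Longrightarrow> q a i = (\<Sum>j<n. g j i * c j a)"
    by blast
  define p where "p a = ip K (q a) (g n)" for a
  \<comment> \<open>The factor 1 matches the shape of \<open>ip_sub_right\<close>.\<close>
  define e where "e i = g n i - 1 * (\<Sum>a<m. p a * q a i)" for i
  define N where "N = ip K e e"
  have qe: "ip K (q a) e = 0" if "a < m" for a
  proof -
    have "ip K (q a) (\<lambda>i. \<Sum>a'<m. p a' * q a' i) = (\<Sum>a'<m. ip K (\<lambda>i. p a' * q a' i) (q a))"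
      unfolding ip_commute[of K "q a"] by (rule ip_sum_left)
    also have "\<dots> = (\<Sum>a'<m. if a' = a then p a else 0)"
      using that by (intro sum.cong refl) (simp add: ip_scale orth)
    also have "\<dots> = p a" using that by simp
    finally show ?thesis unfolding e_def ip_sub_right by (simp add: p_def)
  qed
  have gn: "g n i = (\<Sum>a<m. q a i * p a) + e i" for i by (simp add: e_def mult.commute)
  show ?case
  proof (cases "N = 0")
    case True
    have "\<forall>i\<in>{..<K}. e i * e i = 0"
      using True unfolding N_def ip_def by (subst (asm) sum_nonneg_eq_0_iff) auto
    then have e0: "e i = 0" if "i < K" for i using that by simp
    have "\<forall>j<Suc n. \<forall>i<K. g j i = (\<Sum>a<m. q a i * (if j = n then p a else b a j))"
      using g gn e0 by (simp add: less_Suc_eq)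
    moreover have "\<forall>a<m. \<forall>i<K. q a i = (\<Sum>j<Suc n. g j i * (if j = n then 0 else c j a))"
      using q by simp
    moreover have "m \<le> Suc n" "\<forall>a<m. \<forall>a'<m. ip K (q a) (q a') = of_bool (a = a')"
      using m orth by simp_all
    ultimately show ?thesis by (intro exI conjI)
  next
    case False
    then have N: "0 < N" using ip_self_nonneg[of K e] unfolding N_def by linarith
    define q' where "q' a = (if a = m then (\<lambda>i. 1 / sqrt N * e i) else q a)" for a
    define b' where "b' a j = (if j = n then (if a = m then sqrt N else p a) else (if a = m then 0 else b a j))" for a j
    define c' where "c' j a = (if a = m then (if j = n then 1 / sqrt N else - (\<Sum>a'<m. p a' * c j a') / sqrt N)
        else (if j = n then 0 else c j a))" for j a
    have orth': "ip K (q' a) (q' a') = of_bool (a = a')" if "a < Suc m" "a' < Suc m" for a a'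
    proof -
      have "ip K (\<lambda>i. 1 / sqrt N * e i) (\<lambda>i. 1 / sqrt N * e i) = 1"
        using N by (simp only: ip_scale N_def[symmetric]) (simp add: field_simps)
      moreover have "ip K (\<lambda>i. 1 / sqrt N * e i) (q a) = 0" "ip K (q a) (\<lambda>i. 1 / sqrt N * e i) = 0" if "a < m" for a
        using qe[OF that] ip_commute[of K e "q a"] by (simp_all only: ip_scale mult_zero_right)
      ultimately show ?thesis
        using that orth qe by (cases "a = m"; cases "a' = m") (simp_all add: q'_def ip_scale less_Suc_eq)
    qed
    have g': "g j i = (\<Sum>a<Suc m. q' a i * b' a j)" if "j < Suc n" "i < K" for j i
    proof (cases "j = n")
      case True
      have "(\<Sum>a<m. q' a i * b' a j) = (\<Sum>a<m. q a i * p a)"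
        using True by (intro sum.cong refl) (simp add: q'_def b'_def)
      moreover have "q' m i * b' m j = e i"
        using True N by (simp add: q'_def b'_def)
      ultimately show ?thesis using True gn[of i] by simp
    next
      case False
      have "(\<Sum>a<m. q' a i * b' a j) = (\<Sum>a<m. q a i * b a j)"
        using False by (intro sum.cong refl) (simp add: q'_def b'_def)
      moreover have "q' m i * b' m j = 0" using False by (simp add: b'_def)
      ultimately show ?thesis using False that g by simp
    qed
    have q'': "q' a i = (\<Sum>j<Suc n. g j i * c' j a)" if "a < Suc m" "i < K" for a i
    proof (cases "a = m")
      case True
      have "(\<Sum>a<m. p a * q a i) = (\<Sum>a<m. \<Sum>j<n. g j i * (p a * c j a))"
        using q that by (simp add: sum_distrib_left mult_ac)
      also have "\<dots> = (\<Sum>j<n. g j i * (\<Sum>a<m. p a * c j a))"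
        unfolding sum_distrib_left by (rule sum.swap)
      finally have "q' a i = (g n i - (\<Sum>j<n. g j i * (\<Sum>a<m. p a * c j a))) / sqrt N"
        using True by (simp add: q'_def e_def)
      moreover have "(\<Sum>j<n. g j i * c' j a) = - (\<Sum>j<n. g j i * (\<Sum>a<m. p a * c j a)) / sqrt N"
        unfolding minus_divide_left[symmetric] sum_divide_distrib sum_negf[symmetric]
        using True by (intro sum.cong refl) (simp add: c'_def)
      ultimately show ?thesis
        using True by (simp add: c'_def diff_divide_distrib)
    next
      case False
      then have "(\<Sum>j<n. g j i * c' j a) = (\<Sum>j<n. g j i * c j a)"
        by (intro sum.cong refl) (simp add: c'_def)
      then show ?thesis using False that q[of a i] by (simp add: q'_def c'_def)
    qed
    have "\<forall>a<Suc m. \<forall>a'<Suc m. ip K (q' a) (q' a') = of_bool (a = a')"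
      "\<forall>j<Suc n. \<forall>i<K. g j i = (\<Sum>a<Suc m. q' a i * b' a j)"
      "\<forall>a<Suc m. \<forall>i<K. q' a i = (\<Sum>j<Suc n. g j i * c' j a)"
      using orth' g' q'' by blast+
    moreover have "Suc m \<le> Suc n" using m by simp
    ultimately show ?thesis by (intro exI conjI)
  qed
qed

lemma orthonormal_factorization:
  fixes G :: "real mat"
  assumes G: "G \<in> carrier_mat K n"
  obtains m Q B C where "m \<le> n" "Q \<in> carrier_mat K m" "B \<in> carrier_mat m n" "C \<in> carrier_mat n m"
    "Q\<^sup>T * Q = 1\<^sub>m m" "G = Q * B" "Q = G * C"
proof -
  obtain m q b c where m: "m \<le> n" and orth: "\<And>a a'. a < m \<Longrightarrow> a' < m \<Longrightarrow> ip K (q a) (q a') = of_bool (a = a')"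
    and g: "\<And>j i. j < n \<Longrightarrow> i < K \<Longrightarrow> G $$ (i, j) = (\<Sum>a<m. q a i * b a j)"
    and q: "\<And>a i. a < m \<Longrightarrow> i < K \<Longrightarrow> q a i = (\<Sum>j<n. G $$ (i, j) * c j a)"
    using gram_schmidt_functions[of n K "\<lambda>j i. G $$ (i, j)"] by blast
  let ?Q = "Matrix.mat K m (\<lambda>(i, a). q a i)" and ?B = "Matrix.mat m n (\<lambda>(a, j). b a j)"
    and ?C = "Matrix.mat n m (\<lambda>(j, a). c j a)"
  show ?thesis
  proof (rule that[of m ?Q ?B ?C])
    show "?Q\<^sup>T * ?Q = 1\<^sub>m m"
      by (rule eq_matI) (simp_all add: scalar_prod_def atLeast0LessThan orth[unfolded ip_def])
    show "G = ?Q * ?B"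
      by (rule eq_matI) (use G in \<open>simp_all add: scalar_prod_def atLeast0LessThan g\<close>)
    show "?Q = G * ?C"
      by (rule eq_matI) (use G in \<open>simp_all add: scalar_prod_def atLeast0LessThan q\<close>)
  qed (use m in auto)
qed

lemma sqn_mult_mat_vec:
  fixes A :: "real mat"
  assumes "A \<in> carrier_mat k m" "z \<in> carrier_vec m"
  shows "sqn (A *\<^sub>v z) = (\<Sum>(a, b)\<in>{..<m} \<times> {..<m}. (z $ a * z $ b) * scalar_prod (Matrix.col A a) (Matrix.col A b))"
proof -
  have "sqn (A *\<^sub>v z) = (\<Sum>i<k. (\<Sum>a<m. A $$ (i, a) * z $ a) * (\<Sum>b<m. A $$ (i, b) * z $ b))"
    using assms by (simp add: scalar_prod_def atLeast0LessThan)
  also have "\<dots> = (\<Sum>i<k. \<Sum>(a, b)\<in>{..<m} \<times> {..<m}. (z $ a * z $ b) * (A $$ (i, a) * A $$ (i, b)))"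
    unfolding sum_product sum.cartesian_product by (intro sum.cong refl) (simp add: case_prod_unfold mult_ac)
  also have "\<dots> = (\<Sum>(a, b)\<in>{..<m} \<times> {..<m}. \<Sum>i<k. (z $ a * z $ b) * (A $$ (i, a) * A $$ (i, b)))"
    by (subst sum.swap) (simp add: case_prod_unfold)
  also have "\<dots> = (\<Sum>(a, b)\<in>{..<m} \<times> {..<m}. (z $ a * z $ b) * scalar_prod (Matrix.col A a) (Matrix.col A b))"
    unfolding sum_distrib_left[symmetric] using assms
    by (intro sum.cong refl) (auto simp: scalar_prod_def atLeast0LessThan)
  finally show ?thesis .
qed

lemma isometry_scalar_prod:
  fixes U :: "real mat"
  assumes "U \<in> carrier_mat k r" "U\<^sup>T * U = 1\<^sub>m r" "s \<in> carrier_vec r" "t \<in> carrier_vec r"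
  shows "scalar_prod (U *\<^sub>v s) (U *\<^sub>v t) = scalar_prod s t"
proof -
  have "scalar_prod (U *\<^sub>v s) (U *\<^sub>v t) = scalar_prod (U\<^sup>T *\<^sub>v (U *\<^sub>v s)) t"
    using assms by (intro transpose_vec_mult_scalar[symmetric]) auto
  also have "U\<^sup>T *\<^sub>v (U *\<^sub>v s) = (U\<^sup>T * U) *\<^sub>v s"
    using assms by (intro assoc_mult_mat_vec[symmetric, of _ r k _ r]) auto
  finally show ?thesis using assms by simp
qed

text \<open>A constant distortion is enough: the sketch only has to yield sampling probabilities
  that are right up to constant factors, so \<epsilon> does not enter \<open>J1\<close>.\<close>

definition embeds :: "real mat \<Rightarrow> real mat \<Rightarrow> bool" where
  "embeds \<Psi> G \<longleftrightarrow> (\<forall>y\<in>carrier_vec (dim_col G).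
     \<bar>sqn ((\<Psi> * G) *\<^sub>v y) - sqn (G *\<^sub>v y)\<bar> \<le> 1 / 2 * sqn (G *\<^sub>v y))"

text \<open>In an orthonormal basis of the column space the distortion is the quadratic form of the
  matrix of errors \<open>dot_err\<close> at pairs of basis vectors. Its Frobenius norm need only be
  at most 1/2; the squared norm has mean at most n^2 (b - 1), and Markov's inequality at 1/4 gives
  the factor 4.\<close>

lemma prob_embeds:
  assumes P: "dot_preserving J K b P" and G: "G \<in> carrier_mat K n"
  shows "measure_pmf.prob P {\<Psi>. embeds \<Psi> G} \<ge> 1 - 4 * (real n)\<^sup>2 * (b - 1)"
proof -
  obtain m Q B C where m: "m \<le> n" and Q: "Q \<in> carrier_mat K m" and B: "B \<in> carrier_mat m n"
    and QQ: "Q\<^sup>T * Q = 1\<^sub>m m" and GQ: "G = Q * B"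
    using orthonormal_factorization[OF G] by metis
  define err where "err \<Psi> = (\<Sum>(a, a')\<in>{..<m} \<times> {..<m}. (dot_err \<Psi> (Matrix.col Q a) (Matrix.col Q a'))\<^sup>2)" for \<Psi>
  have fin: "finite (set_pmf P)" and b: "1 \<le> b" using dot_preservingD[OF P] by auto
  have cols: "scalar_prod (Matrix.col Q a) (Matrix.col Q a') = of_bool (a = a')" if "a < m" "a' < m" for a a'
  proof -
    have "scalar_prod (Matrix.col Q a) (Matrix.col Q a') = (Q\<^sup>T * Q) $$ (a, a')"
      using that Q by simp
    then show ?thesis unfolding QQ using that by simp
  qed
  have colc: "Matrix.col Q a \<in> carrier_vec K" for a using Q by auto
  have "mean P err = (\<Sum>(a, a')\<in>{..<m} \<times> {..<m}.
      mean P (\<lambda>\<Psi>. (dot_err \<Psi> (Matrix.col Q a) (Matrix.col Q a'))\<^sup>2))"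
    unfolding err_def case_prod_unfold
    by (rule Bochner_Integration.integral_sum) (rule integrable_measure_pmf_finite[OF fin])
  also have "\<dots> \<le> (\<Sum>(a, a')\<in>{..<m} \<times> {..<m}. b - 1)"
    unfolding case_prod_unfold
  proof (rule sum_mono)
    fix w assume "w \<in> {..<m} \<times> {..<m}"
    then have "fst w < m" "snd w < m" by auto
    then show "mean P (\<lambda>\<Psi>. (dot_err \<Psi> (Matrix.col Q (fst w)) (Matrix.col Q (snd w)))\<^sup>2) \<le> b - 1"
      using dot_preservingD(5)[OF P colc colc, of "fst w" "snd w"] by (simp add: cols)
  qed
  also have "\<dots> = (real m)\<^sup>2 * (b - 1)" by (simp add: power2_eq_square)
  also have "\<dots> \<le> (real n)\<^sup>2 * (b - 1)" using m b by (intro mult_right_mono power_mono) auto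
  finally have Eerr: "mean P err \<le> (real n)\<^sup>2 * (b - 1)" .
  have good: "embeds \<Psi> G" if \<Psi>: "\<Psi> \<in> set_pmf P" and small: "err \<Psi> \<le> 1 / 4" for \<Psi>
    unfolding embeds_def
  proof
    fix y :: "real Matrix.vec" assume "y \<in> carrier_vec (dim_col G)"
    then have y: "y \<in> carrier_vec n" using G by simp
    have \<Psi>c: "\<Psi> \<in> carrier_mat J K" using dot_preservingD(2)[OF P \<Psi>] .
    define z where "z = B *\<^sub>v y"
    have z: "z \<in> carrier_vec m" using B y by (simp add: z_def)
    have Gy: "G *\<^sub>v y = Q *\<^sub>v z"
      unfolding GQ z_def by (rule assoc_mult_mat_vec[OF Q B y])
    have \<Psi>Gy: "(\<Psi> * G) *\<^sub>v y = (\<Psi> * Q) *\<^sub>v z"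
      using assoc_mult_mat_vec[OF \<Psi>c G y] assoc_mult_mat_vec[OF \<Psi>c Q z] Gy by simp
    have Qz: "sqn (Q *\<^sub>v z) = sqn z" by (rule isometry_scalar_prod[OF Q QQ z z])
    have "sqn ((\<Psi> * Q) *\<^sub>v z) - sqn (Q *\<^sub>v z)
        = (\<Sum>w\<in>{..<m} \<times> {..<m}. (z $ fst w * z $ snd w) * dot_err \<Psi> (Matrix.col Q (fst w)) (Matrix.col Q (snd w)))"
      unfolding sqn_mult_mat_vec[OF mult_carrier_mat[OF \<Psi>c Q] z] sqn_mult_mat_vec[OF Q z] sum_subtractf[symmetric]
      using \<Psi>c Q by (intro sum.cong refl) (auto simp: dot_err_def col_mult2[OF \<Psi>c Q] algebra_simps)
    moreover have "(\<dots>)\<^sup>2 \<le> (1 / 2 * sqn z)\<^sup>2"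
    proof -
      have "(\<Sum>w\<in>{..<m} \<times> {..<m}. (z $ fst w * z $ snd w) * dot_err \<Psi> (Matrix.col Q (fst w)) (Matrix.col Q (snd w)))\<^sup>2
          \<le> (\<Sum>w\<in>{..<m} \<times> {..<m}. (z $ fst w * z $ snd w)\<^sup>2) * err \<Psi>"
        unfolding err_def case_prod_unfold by (rule Cauchy_Schwarz_ineq_sum)
      also have "(\<Sum>w\<in>{..<m} \<times> {..<m}. (z $ fst w * z $ snd w)\<^sup>2) = (sqn z)\<^sup>2"
        using z by (simp add: scalar_prod_def atLeast0LessThan power2_eq_square sum_product
            sum.cartesian_product case_prod_unfold mult_ac)
      also have "(sqn z)\<^sup>2 * err \<Psi> \<le> (sqn z)\<^sup>2 * (1 / 4)"
        using small by (intro mult_left_mono) auto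
      finally show ?thesis by (simp add: power_divide)
    qed
    ultimately have "\<bar>sqn ((\<Psi> * Q) *\<^sub>v z) - sqn (Q *\<^sub>v z)\<bar> \<le> 1 / 2 * sqn z"
      using abs_le_square_iff[of _ "1 / 2 * sqn z"] sqn_nonneg[of z] by simp
    then show "\<bar>sqn ((\<Psi> * G) *\<^sub>v y) - sqn (G *\<^sub>v y)\<bar> \<le> 1 / 2 * sqn (G *\<^sub>v y)"
      unfolding \<Psi>Gy Gy Qz .
  qed
  have err0: "0 \<le> err \<Psi>" for \<Psi> unfolding err_def case_prod_unfold by (intro sum_nonneg) simp
  have "measure_pmf.prob P (- {\<Psi>. embeds \<Psi> G}) = mean P (indicator (- {\<Psi>. embeds \<Psi> G}))"
    by simp
  also have "\<dots> \<le> mean P (\<lambda>\<Psi>. 4 * err \<Psi>)"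
  proof (rule expectation_mono_pmf[OF fin])
    fix \<Psi> assume "\<Psi> \<in> set_pmf P"
    then show "indicator (- {\<Psi>. embeds \<Psi> G}) \<Psi> \<le> 4 * err \<Psi>"
      using good[of \<Psi>] err0[of \<Psi>] by (cases "err \<Psi> \<le> 1 / 4") (auto simp: indicator_def)
  qed
  also have "\<dots> \<le> 4 * ((real n)\<^sup>2 * (b - 1))" using Eerr by simp
  finally have "measure_pmf.prob P (- {\<Psi>. embeds \<Psi> G}) \<le> 4 * (real n)\<^sup>2 * (b - 1)" by simp
  moreover have "measure_pmf.prob P (- {\<Psi>. embeds \<Psi> G}) = 1 - measure_pmf.prob P {\<Psi>. embeds \<Psi> G}"
    using measure_pmf.prob_compl[of "{\<Psi>. embeds \<Psi> G}" P] by (simp add: Compl_eq_Diff_UNIV)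
  ultimately show ?thesis by linarith
qed

section \<open>Sketched least squares\<close>

lemma sqn_eq_0D:
  fixes x :: "real Matrix.vec"
  assumes "x \<in> carrier_vec n" "sqn x \<le> 0"
  shows "x = 0\<^sub>v n"
proof -
  have "(\<Sum>i<n. x $ i * x $ i) = 0"
    using assms sqn_nonneg[of x] by (simp add: scalar_prod_def atLeast0LessThan)
  then have "\<forall>i\<in>{..<n}. x $ i * x $ i = 0"
    by (subst (asm) sum_nonneg_eq_0_iff) auto
  then show ?thesis using assms(1) by (intro eq_vecI) auto
qed

text \<open>\<open>approx_lev\<close> goes through the option-valued \<open>mat_inverse\<close>;
  exhibiting the reciprocal diagonal as an inverse in the matrix ring shows that the option is not
  \<open>None\<close>.\<close>

lemma diagonal_mat_inverse:
  fixes D :: "real mat"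
  assumes D: "D \<in> carrier_mat r r" "diagonal_mat D" "\<And>i. i < r \<Longrightarrow> D $$ (i, i) \<noteq> 0"
  shows "the (mat_inverse D) \<in> carrier_mat r r" "D * the (mat_inverse D) = 1\<^sub>m r" "the (mat_inverse D) * D = 1\<^sub>m r"
proof -
  let ?E = "Matrix.mat r r (\<lambda>(i, j). if i = j then 1 / D $$ (i, i) else 0)"
  have off: "D $$ (i, j) = 0" if "i < r" "j < r" "i \<noteq> j" for i j
    using D that unfolding diagonal_mat_def by auto
  have DE: "D * ?E = 1\<^sub>m r"
  proof (rule eq_matI)
    fix i j assume "i < dim_row (1\<^sub>m r :: real mat)" "j < dim_col (1\<^sub>m r :: real mat)"
    then have ij: "i < r" "j < r" by simp_all
    have "(D * ?E) $$ (i, j) = (\<Sum>k<r. D $$ (i, k) * (if k = j then 1 / D $$ (k, k) else 0))"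
      using ij D(1) by (simp add: scalar_prod_def atLeast0LessThan)
    also have "\<dots> = (\<Sum>k<r. if k = j then D $$ (i, j) / D $$ (j, j) else 0)"
      by (intro sum.cong) auto
    also have "\<dots> = 1\<^sub>m r $$ (i, j)"
      using ij off D(3) by auto
    finally show "(D * ?E) $$ (i, j) = 1\<^sub>m r $$ (i, j)" .
  qed (use D in auto)
  have ED: "?E * D = 1\<^sub>m r"
  proof (rule eq_matI)
    fix i j assume "i < dim_row (1\<^sub>m r :: real mat)" "j < dim_col (1\<^sub>m r :: real mat)"
    then have ij: "i < r" "j < r" by simp_all
    have "(?E * D) $$ (i, j) = (\<Sum>k<r. (if i = k then 1 / D $$ (i, i) else 0) * D $$ (k, j))"
      using ij D(1) by (simp add: scalar_prod_def atLeast0LessThan)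
    also have "\<dots> = (\<Sum>k<r. if k = i then D $$ (i, j) / D $$ (i, i) else 0)"
      by (intro sum.cong) auto
    also have "\<dots> = 1\<^sub>m r $$ (i, j)"
      using ij off D(3) by auto
    finally show "(?E * D) $$ (i, j) = 1\<^sub>m r $$ (i, j)" .
  qed (use D in auto)
  have "D \<in> Units (ring_mat TYPE(real) r ())"
    unfolding Units_def ring_mat_def using D(1) DE ED by (auto intro!: bexI[of _ ?E])
  then obtain B where "mat_inverse D = Some B"
    using mat_inverse(1)[OF D(1), of "()"] by (cases "mat_inverse D") auto
  with mat_inverse(2)[OF D(1) this]
  show "the (mat_inverse D) \<in> carrier_mat r r" "D * the (mat_inverse D) = 1\<^sub>m r" "the (mat_inverse D) * D = 1\<^sub>m r"
    by auto
qed

text \<open>Since the sketch of \<open>W = G V D\<^sup>-\<^sup>1\<close> is \<open>U\<close>, the embedding property makes \<open>W\<close> a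
  well-conditioned basis of the column space of \<open>G\<close>.\<close>

lemma compact_svd_conditioned_basis:
  assumes emb: "embeds \<Psi> G" and \<Psi>: "\<Psi> \<in> carrier_mat J K" and G: "G \<in> carrier_mat K n"
    and svd: "compact_svd (\<Psi> * G) U D V"
  defines "W \<equiv> G * V * the (mat_inverse D)"
  obtains r X Y where "r \<le> n" "X \<in> carrier_mat n r" "Y \<in> carrier_mat r n" "W \<in> carrier_mat K r"
    "W = G * X" "G = W * Y"
    "\<And>t. t \<in> carrier_vec r \<Longrightarrow> sqn (W *\<^sub>v t) \<le> 2 * sqn t"
    "\<And>t. t \<in> carrier_vec r \<Longrightarrow> 2 / 3 * sqn t \<le> sqn (W *\<^sub>v t)"
proof -
  define r where "r = vec_space.rank (dim_row (\<Psi> * G)) (\<Psi> * G)"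
  have \<Psi>G: "\<Psi> * G \<in> carrier_mat J n" using \<Psi> G by simp
  have U: "U \<in> carrier_mat J r" and D: "D \<in> carrier_mat r r" and V: "V \<in> carrier_mat n r"
    and UU: "U\<^sup>T * U = 1\<^sub>m r" and VV: "V\<^sup>T * V = 1\<^sub>m r"
    and diag: "diagonal_mat D" and pos: "\<And>i. i < r \<Longrightarrow> D $$ (i, i) > 0"
    and eq: "\<Psi> * G = U * D * V\<^sup>T"
    using svd \<Psi>G unfolding compact_svd_def Let_def r_def[symmetric] by auto
  have VT: "V\<^sup>T \<in> carrier_mat r n" using V by simp
  have rn: "r \<le> n"
    using vec_space.rank_le_nc[OF \<Psi>G] unfolding r_def carrier_matD(1)[OF \<Psi>G] .
  define Di where "Di = the (mat_inverse D)"
  have Di: "Di \<in> carrier_mat r r" "D * Di = 1\<^sub>m r" "Di * D = 1\<^sub>m r"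
    unfolding Di_def using diagonal_mat_inverse[OF D diag] pos by force+
  define X where "X = V * Di"
  define Y where "Y = D * V\<^sup>T"
  have X: "X \<in> carrier_mat n r" using V Di by (simp add: X_def)
  have Y: "Y \<in> carrier_mat r n" using V D by (simp add: Y_def)
  have W: "W = G * X" unfolding W_def X_def Di_def[symmetric] by (rule assoc_mult_mat[OF G V Di(1)])
  have Wc: "W \<in> carrier_mat K r" unfolding W using G X by simp
  have UD: "U * D \<in> carrier_mat J r" using U D by simp
  have \<Psi>GX: "(\<Psi> * G) * X = U"
  proof -
    have "(\<Psi> * G) * X = (U * D) * (V\<^sup>T * X)"
      unfolding eq by (rule assoc_mult_mat[OF UD VT X])
    also have "V\<^sup>T * X = Di"
      unfolding X_def assoc_mult_mat[OF VT V Di(1), symmetric] VV using Di by simp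
    also have "(U * D) * Di = U"
      unfolding assoc_mult_mat[OF U D Di(1)] Di(2) using U by simp
    finally show ?thesis .
  qed
  have emb': "\<bar>sqn ((\<Psi> * G) *\<^sub>v y) - sqn (G *\<^sub>v y)\<bar> \<le> 1 / 2 * sqn (G *\<^sub>v y)" if "y \<in> carrier_vec n" for y
    using emb that G unfolding embeds_def by auto
  have bounds: "sqn (W *\<^sub>v t) \<le> 2 * sqn t" "2 / 3 * sqn t \<le> sqn (W *\<^sub>v t)" if t: "t \<in> carrier_vec r" for t
  proof -
    have Xt: "X *\<^sub>v t \<in> carrier_vec n" using X t by simp
    have "(\<Psi> * G) *\<^sub>v (X *\<^sub>v t) = U *\<^sub>v t"
      unfolding assoc_mult_mat_vec[OF \<Psi>G X t, symmetric] \<Psi>GX ..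
    then have "sqn ((\<Psi> * G) *\<^sub>v (X *\<^sub>v t)) = sqn t"
      using isometry_scalar_prod[OF U UU t t] by simp
    moreover have "G *\<^sub>v (X *\<^sub>v t) = W *\<^sub>v t"
      unfolding W by (rule assoc_mult_mat_vec[OF G X t, symmetric])
    ultimately have "\<bar>sqn t - sqn (W *\<^sub>v t)\<bar> \<le> 1 / 2 * sqn (W *\<^sub>v t)"
      using emb'[OF Xt] by simp
    \<comment> \<open>Solving the distortion inequality for |W t|^2 gives the constants 2 and
      2/3.\<close>
    then show "sqn (W *\<^sub>v t) \<le> 2 * sqn t" "2 / 3 * sqn t \<le> sqn (W *\<^sub>v t)" by linarith+
  qed
  \<comment> \<open>Here \<Psi> G (X Y - 1) = U Y - \<Psi> G = 0, and the embedding is injective on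
    the column space of \<open>G\<close>, so G (X Y - 1) = 0. Passing to the rank of \<Psi> G thus
    loses no direction of \<open>G\<close>.\<close>
  have GWY: "G = W * Y"
  proof -
    define M where "M = X * Y - 1\<^sub>m n"
    have XY: "X * Y \<in> carrier_mat n n" using X Y by simp
    have M: "M \<in> carrier_mat n n" unfolding M_def by (rule minus_carrier_mat[OF one_carrier_mat])
    have "(\<Psi> * G) * (X * Y) = U * Y"
      unfolding assoc_mult_mat[OF \<Psi>G X Y, symmetric] \<Psi>GX ..
    also have "\<dots> = \<Psi> * G"
      unfolding Y_def eq by (rule assoc_mult_mat[OF U D VT, symmetric])
    finally have 0: "(\<Psi> * G) * M = 0\<^sub>m J n"
      unfolding M_def mult_minus_distrib_mat[OF \<Psi>G XY one_carrier_mat] right_mult_one_mat[OF \<Psi>G]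
      using \<Psi>G by simp
    have "Matrix.col (G * M) k = Matrix.col (0\<^sub>m K n) k" if k: "k < n" for k
    proof -
      have Mk: "Matrix.col M k \<in> carrier_vec n" using M by auto
      have "(\<Psi> * G) *\<^sub>v Matrix.col M k = 0\<^sub>v J"
        unfolding col_mult2[OF \<Psi>G M k, symmetric] 0 using k by simp
      then have "sqn (G *\<^sub>v Matrix.col M k) \<le> 0"
        using emb'[OF Mk] by simp
      then have "G *\<^sub>v Matrix.col M k = 0\<^sub>v K"
        using G Mk by (intro sqn_eq_0D) auto
      then show ?thesis using k by (simp add: col_mult2[OF G M k])
    qed
    then have "G * M = 0\<^sub>m K n" using G M by (intro mat_col_eqI) auto
    then have GM: "G * (X * Y) - G = 0\<^sub>m K n"
      unfolding M_def mult_minus_distrib_mat[OF G XY one_carrier_mat] right_mult_one_mat[OF G] .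
    have GXY: "G * (X * Y) \<in> carrier_mat K n" using G XY by simp
    have "G * (X * Y) = G"
    proof (rule eq_matI)
      fix i j assume ij: "i < dim_row G" "j < dim_col G"
      have "(G * (X * Y) - G) $$ (i, j) = 0" unfolding GM using ij G by simp
      then show "(G * (X * Y)) $$ (i, j) = G $$ (i, j)"
        using ij by (subst (asm) index_minus_mat) auto
    qed (use GXY G in auto)
    then show ?thesis unfolding W assoc_mult_mat[OF G X Y] ..
  qed
  show ?thesis by (rule that[OF rn X Y Wc W GWY bounds])
qed

section \<open>Frobenius inner products and the sketched minimiser\<close>

definition mdot :: "nat \<Rightarrow> nat \<Rightarrow> real mat \<Rightarrow> real mat \<Rightarrow> real" where
  "mdot m n A B = (\<Sum>w\<in>{..<m} \<times> {..<n}. A $$ w * B $$ w)"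

lemma fro_norm_sq:
  assumes "A \<in> carrier_mat m n"
  shows "(fro_norm A)\<^sup>2 = mdot m n A A" "fro_norm A = sqrt (mdot m n A A)"
proof -
  have "(\<Sum>i<dim_row A. \<Sum>j<dim_col A. (A $$ (i, j))\<^sup>2) = mdot m n A A"
    using assms by (simp add: mdot_def sum.cartesian_product power2_eq_square case_prod_unfold)
  moreover have "0 \<le> mdot m n A A" unfolding mdot_def by (intro sum_nonneg) simp
  ultimately show "(fro_norm A)\<^sup>2 = mdot m n A A" "fro_norm A = sqrt (mdot m n A A)"
    unfolding fro_norm_def by simp_all
qed

lemma mdot_self_nonneg: "0 \<le> mdot m n A A"
  unfolding mdot_def by (intro sum_nonneg) simp

lemma mdot_Cauchy_Schwarz: "(mdot m n A B)\<^sup>2 \<le> mdot m n A A * mdot m n B B"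
  unfolding mdot_def
  using Cauchy_Schwarz_ineq_sum[of "\<lambda>w. A $$ w" "\<lambda>w. B $$ w" "{..<m} \<times> {..<n}"]
  by (simp add: power2_eq_square)

lemma mdot_cols:
  assumes "A \<in> carrier_mat m n" "B \<in> carrier_mat m n"
  shows "mdot m n A B = (\<Sum>k<n. scalar_prod (Matrix.col A k) (Matrix.col B k))"
proof -
  have "mdot m n A B = (\<Sum>i<m. \<Sum>k<n. A $$ (i, k) * B $$ (i, k))"
    by (simp add: mdot_def sum.cartesian_product case_prod_unfold)
  also have "\<dots> = (\<Sum>k<n. \<Sum>i<m. A $$ (i, k) * B $$ (i, k))" by (rule sum.swap)
  also have "\<dots> = (\<Sum>k<n. scalar_prod (Matrix.col A k) (Matrix.col B k))"
    using assms by (intro sum.cong refl) (simp add: scalar_prod_def atLeast0LessThan)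
  finally show ?thesis .
qed

lemma mdot_adjoint:
  assumes A: "A \<in> carrier_mat m r" and T: "T \<in> carrier_mat r n" and F: "F \<in> carrier_mat m n"
  shows "mdot m n (A * T) F = mdot r n T (A\<^sup>T * F)"
proof -
  have AT: "A\<^sup>T \<in> carrier_mat r m" using A by simp
  have "scalar_prod (Matrix.col (A * T) k) (Matrix.col F k) = scalar_prod (Matrix.col T k) (Matrix.col (A\<^sup>T * F) k)"
    if k: "k < n" for k
  proof -
    have c: "Matrix.col T k \<in> carrier_vec r" "Matrix.col F k \<in> carrier_vec m" using T F by auto
    have "scalar_prod (Matrix.col F k) (A *\<^sub>v Matrix.col T k) = scalar_prod (A\<^sup>T *\<^sub>v Matrix.col F k) (Matrix.col T k)"
      by (rule transpose_vec_mult_scalar[OF A c, symmetric])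
    then show ?thesis
      unfolding col_mult2[OF A T k] col_mult2[OF AT F k]
      using A c AT by (simp add: comm_scalar_prod[of "A *\<^sub>v Matrix.col T k" m] comm_scalar_prod[of "Matrix.col T k" r])
  qed
  then show ?thesis
    using mdot_cols[OF mult_carrier_mat[OF A T] F] mdot_cols[OF T mult_carrier_mat[OF AT F]] by simp
qed

lemma mdot_lin_comb:
  assumes "\<And>w. w \<in> {..<m} \<times> {..<n} \<Longrightarrow> C $$ w = s * A $$ w - B $$ w"
  shows "mdot m n C C = s\<^sup>2 * mdot m n A A - 2 * s * mdot m n A B + mdot m n B B"
proof -
  have "mdot m n C C = (\<Sum>w\<in>{..<m} \<times> {..<n}. s\<^sup>2 * (A $$ w * A $$ w) - 2 * s * (A $$ w * B $$ w) + B $$ w * B $$ w)"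
    unfolding mdot_def
    by (intro sum.cong refl, simp only: assms) (simp add: power2_eq_square algebra_simps)
  then show ?thesis
    by (simp add: mdot_def sum.distrib sum_subtractf sum_distrib_left)
qed

text \<open>Up to a constant, s^2 a - 2 s c is the sketched objective along a segment. Its value at
  1 is compared with the vertex s = c / a, or with s = 0 when a = 0.\<close>

lemma quadratic_min_at_1:
  fixes a c :: real
  assumes "\<And>s. a - 2 * c \<le> s\<^sup>2 * a - 2 * s * c" "0 \<le> a"
  shows "a \<le> c"
proof (rule ccontr)
  assume "\<not> a \<le> c"
  show False
  proof (cases "a = 0")
    case True
    then show False using assms(1)[of 0] \<open>\<not> a \<le> c\<close> by simp
  next
    case False
    then have a: "0 < a" using assms(2) by simp
    have "a - 2 * c \<le> (c / a)\<^sup>2 * a - 2 * (c / a) * c" by (rule assms(1))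
    also have "\<dots> = - (c * c / a)" using a by (simp add: power2_eq_square field_simps)
    finally have "(a - c)\<^sup>2 \<le> 0" using a by (simp add: field_simps power2_eq_square)
    then show False using \<open>\<not> a \<le> c\<close> by simp
  qed
qed

text \<open>\<open>T\<close> holds the coordinates, in the basis \<open>W\<close>, of the difference between the sketched and
  the exact solution; minimality along the segment between the two gives
  \<open>|SWT|\<^sup>2 \<le> \<langle>SWT, SE\<rangle>\<close>.\<close>

lemma sketched_least_squares:
  assumes G: "G \<in> carrier_mat K n" and W: "W \<in> carrier_mat K r" and X: "X \<in> carrier_mat n r"
    and Y: "Y \<in> carrier_mat r n" and WX: "W = G * X" and GY: "G = W * Y"
    and B: "B \<in> carrier_mat K l" and Z: "Z \<in> carrier_mat n l"
    and orth: "G\<^sup>T * (B - G * Z) = 0\<^sub>m n l"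
    and S: "S \<in> carrier_mat J K"
    and low: "\<And>t. t \<in> carrier_vec r \<Longrightarrow> 1 / 4 * sqn t \<le> sqn ((S * W) *\<^sub>v t)"
    and up: "\<And>t. t \<in> carrier_vec r \<Longrightarrow> sqn (W *\<^sub>v t) \<le> 2 * sqn t"
    and amm: "(fro_norm ((S * W)\<^sup>T * (S * (B - G * Z))))\<^sup>2 \<le> \<epsilon> / 32 * (fro_norm (B - G * Z))\<^sup>2"
    and \<epsilon>: "0 < \<epsilon>"
    and M: "M \<in> carrier_mat n l"
    and minimal: "\<And>H. H \<in> carrier_mat n l \<Longrightarrow> fro_norm (S * G * M - S * B) \<le> fro_norm (S * G * H - S * B)"
  shows "fro_norm (G * M - B) \<le> (1 + \<epsilon>) * fro_norm (B - G * Z)"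
proof -
  define E where "E = B - G * Z"
  have GZ: "G * Z \<in> carrier_mat K l" using G Z by simp
  have E: "E \<in> carrier_mat K l" unfolding E_def by (rule minus_carrier_mat[OF GZ])
  define \<Delta> where "\<Delta> = M - Z"
  have \<Delta>: "\<Delta> \<in> carrier_mat n l" unfolding \<Delta>_def by (rule minus_carrier_mat[OF Z])
  define T where "T = Y * \<Delta>"
  have T: "T \<in> carrier_mat r l" unfolding T_def using Y \<Delta> by simp
  have SG: "S * G \<in> carrier_mat J n" and SW: "S * W \<in> carrier_mat J r" and SE: "S * E \<in> carrier_mat J l"
    and SB: "S * B \<in> carrier_mat J l" and SWT: "(S * W)\<^sup>T \<in> carrier_mat r J"
    using S G W E B by simp_all
  define D where "D = (S * W) * T"
  have D: "D \<in> carrier_mat J l" unfolding D_def using SW T by simp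
  have SG_SWY: "S * G = (S * W) * Y"
    unfolding assoc_mult_mat[OF S W Y] GY[symmetric] ..
  have D_SG: "D = (S * G) * \<Delta>"
    unfolding D_def T_def SG_SWY by (rule assoc_mult_mat[OF SW Y \<Delta>, symmetric])
  have G\<Delta>: "G * \<Delta> = W * T"
    unfolding T_def by (subst GY) (rule assoc_mult_mat[OF W Y \<Delta>])
  have SE_eq: "S * E = S * B - (S * G) * Z"
    unfolding E_def mult_minus_distrib_mat[OF S B GZ] assoc_mult_mat[OF S G Z] ..
  have D_eq: "D = (S * G) * M - (S * G) * Z"
    unfolding D_SG \<Delta>_def by (rule mult_minus_distrib_mat[OF SG M Z])
  have SGM: "(S * G) * M \<in> carrier_mat J l" and SGZ: "(S * G) * Z \<in> carrier_mat J l"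
    using SG M Z by simp_all
  define a where "a = mdot J l D D"
  define c where "c = mdot J l D (S * E)"
  \<comment> \<open>On the segment Z + s (M - Z) the sketched residual is s D - S E, so the squared
    objective is quadratic in s.\<close>
  have entry: "((S * G) * (Z + s \<cdot>\<^sub>m \<Delta>) - S * B) $$ w = s * D $$ w - (S * E) $$ w"
    if w: "w \<in> {..<J} \<times> {..<l}" for s w
  proof -
    obtain i k where ik: "w = (i, k)" "i < J" "k < l" using w by auto
    have s\<Delta>: "s \<cdot>\<^sub>m \<Delta> \<in> carrier_mat n l" using \<Delta> by simp
    have "(S * G) * (Z + s \<cdot>\<^sub>m \<Delta>) = (S * G) * Z + s \<cdot>\<^sub>m D"
      unfolding mult_add_distrib_mat[OF SG Z s\<Delta>] mult_smult_distrib[OF SG \<Delta>] D_SG ..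
    then show ?thesis
      unfolding SE_eq using ik S G Z B D by simp
  qed
  have M_eq: "Z + 1 \<cdot>\<^sub>m \<Delta> = M"
    unfolding \<Delta>_def using M Z by (intro eq_matI) auto
  have "a - 2 * c \<le> s\<^sup>2 * a - 2 * s * c" for s
  proof -
    let ?H = "\<lambda>s. Z + s \<cdot>\<^sub>m \<Delta>"
    have H: "?H s \<in> carrier_mat n l" for s using Z \<Delta> by simp
    have val: "(fro_norm ((S * G) * ?H s - S * B))\<^sup>2 = s\<^sup>2 * a - 2 * s * c + mdot J l (S * E) (S * E)" for s
    proof -
      have "(S * G) * ?H s - S * B \<in> carrier_mat J l" by (rule minus_carrier_mat[OF SB])
      then show ?thesis
        unfolding a_def c_def by (subst fro_norm_sq(1)) (auto intro!: mdot_lin_comb entry)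
    qed
    have "fro_norm ((S * G) * ?H 1 - S * B) \<le> fro_norm ((S * G) * ?H s - S * B)"
      unfolding M_eq by (rule minimal[OF H])
    then have "(fro_norm ((S * G) * ?H 1 - S * B))\<^sup>2 \<le> (fro_norm ((S * G) * ?H s - S * B))\<^sup>2"
      by (intro power_mono) (auto simp: fro_norm_def sum_nonneg)
    then show ?thesis unfolding val by simp
  qed
  then have ac: "a \<le> c"
    by (rule quadratic_min_at_1) (simp add: a_def mdot_self_nonneg)
  define \<tau> where "\<tau> = mdot r l T T"
  define F where "F = (S * W)\<^sup>T * (S * E)"
  have Fc: "F \<in> carrier_mat r l" unfolding F_def using SWT SE by simp
  have \<tau>0: "0 \<le> \<tau>" unfolding \<tau>_def by (rule mdot_self_nonneg)
  have \<tau>a: "1 / 4 * \<tau> \<le> a"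
    unfolding \<tau>_def a_def mdot_cols[OF T T] mdot_cols[OF D D] sum_distrib_left
  proof (rule sum_mono)
    fix k assume "k \<in> {..<l}"
    then have k: "k < l" by simp
    have "Matrix.col T k \<in> carrier_vec r" using T by auto
    from low[OF this] show "1 / 4 * sqn (Matrix.col T k) \<le> sqn (Matrix.col D k)"
      unfolding D_def col_mult2[OF SW T k] .
  qed
  have c_eq: "c = mdot r l T F"
    unfolding c_def D_def F_def by (rule mdot_adjoint[OF SW T SE])
  \<comment> \<open>From |T|^2 / 4 \<le> |D|^2 \<le> <D, S E> = <T, F> \<le> |T| |F|, which yields
    |T|^2 \<le> 16 |F|^2.\<close>
  have "(1 / 4 * \<tau>)\<^sup>2 \<le> \<tau> * mdot r l F F"
  proof -
    have "(1 / 4 * \<tau>)\<^sup>2 \<le> c\<^sup>2" using \<tau>a ac \<tau>0 by (intro power_mono) auto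
    also have "\<dots> \<le> \<tau> * mdot r l F F" unfolding c_eq \<tau>_def by (rule mdot_Cauchy_Schwarz)
    finally show ?thesis .
  qed
  then have "\<tau> * \<tau> \<le> \<tau> * (16 * mdot r l F F)" by (simp add: power2_eq_square)
  then have \<tau>F: "\<tau> \<le> 16 * mdot r l F F"
    using \<tau>0 mdot_self_nonneg[of r l F] by (cases "\<tau> = 0") auto
  have FF: "mdot r l F F \<le> \<epsilon> / 32 * mdot K l E E"
    using amm unfolding E_def[symmetric] F_def[symmetric] fro_norm_sq(1)[OF Fc] fro_norm_sq(1)[OF E] .
  have WT: "mdot K l (W * T) (W * T) \<le> 2 * \<tau>"
  proof -
    have WTc: "W * T \<in> carrier_mat K l" using W T by simp
    have "mdot K l (W * T) (W * T) \<le> (\<Sum>k<l. 2 * sqn (Matrix.col T k))"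
      unfolding mdot_cols[OF WTc WTc]
    proof (rule sum_mono)
      fix k assume "k \<in> {..<l}"
      then have k: "k < l" by simp
      have "Matrix.col T k \<in> carrier_vec r" using T by auto
      from up[OF this] show "sqn (Matrix.col (W * T) k) \<le> 2 * sqn (Matrix.col T k)"
        unfolding col_mult2[OF W T k] .
    qed
    then show ?thesis unfolding \<tau>_def mdot_cols[OF T T] sum_distrib_left .
  qed
  have cross: "mdot K l (W * T) E = 0"
  proof -
    have "W\<^sup>T * E = X\<^sup>T * (G\<^sup>T * E)"
      unfolding WX transpose_mult[OF G X] using G X E by (intro assoc_mult_mat[of _ r n _ K]) auto
    also have "\<dots> = 0\<^sub>m r l" unfolding E_def orth using X by simp
    finally have "mdot K l (W * T) E = mdot r l T (0\<^sub>m r l)"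
      using mdot_adjoint[OF W T E] by simp
    then show ?thesis by (auto simp: mdot_def intro!: sum.neutral)
  qed
  \<comment> \<open>\<open>E\<close> is orthogonal to the column space, so the squared norms add.
    The excess |W T|^2 \<le> 2 |T|^2 \<le> 32 |F|^2 is at most \<epsilon> |E|^2; this dictates the
    threshold \<epsilon> / 32.\<close>
  have "mdot K l (G * M - B) (G * M - B) = 1\<^sup>2 * mdot K l (W * T) (W * T) - 2 * 1 * mdot K l (W * T) E + mdot K l E E"
  proof (rule mdot_lin_comb)
    fix w assume "w \<in> {..<K} \<times> {..<l}"
    then obtain i k where ik: "w = (i, k)" "i < K" "k < l" by auto
    have GM: "G * M \<in> carrier_mat K l" using G M by simp
    have "W * T = G * M - G * Z"
      unfolding G\<Delta>[symmetric] \<Delta>_def by (rule mult_minus_distrib_mat[OF G M Z])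
    then show "(G * M - B) $$ w = 1 * (W * T) $$ w - E $$ w"
      unfolding E_def using ik G M Z B by simp
  qed
  also have "\<dots> \<le> 32 * (\<epsilon> / 32 * mdot K l E E) + mdot K l E E"
    using WT \<tau>F FF cross by simp
  also have "\<dots> = (1 + \<epsilon>) * mdot K l E E" by (simp add: algebra_simps)
  \<comment> \<open>Bounding 1 + \<epsilon> by its square makes the root produce the factor 1 +
    \<epsilon>.\<close>
  also have "\<dots> \<le> (1 + \<epsilon>)\<^sup>2 * mdot K l E E"
    using \<epsilon> mdot_self_nonneg[of K l E] by (intro mult_right_mono) (auto simp: power2_eq_square)
  finally have "sqrt (mdot K l (G * M - B) (G * M - B)) \<le> sqrt ((1 + \<epsilon>)\<^sup>2 * mdot K l E E)"
    by simp
  also have "\<dots> = (1 + \<epsilon>) * sqrt (mdot K l E E)"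
    using \<epsilon> by (simp add: real_sqrt_mult)
  finally show ?thesis
    using fro_norm_sq(2)[OF E] fro_norm_sq(2)[OF minus_carrier_mat[OF B], of "G * M"] E_def by simp
qed

section \<open>Sampling by row norms\<close>

text \<open>Given the earlier draws the new summand has mean zero, so the cross term drops out and
  second moments add.\<close>

lemma expectation_iid_sum_sq:
  fixes g :: "'a \<Rightarrow> real"
  assumes fin: "finite (set_pmf q)" and mean: "mean q g = 0"
  shows "mean (Pi_pmf {..<J} d (\<lambda>_. q)) (\<lambda>f. (\<Sum>j<J. g (f j))\<^sup>2)
    = real J * mean q (\<lambda>i. (g i)\<^sup>2)"
proof (induction J)
  case 0
  then show ?case by simp
next
  case (Suc J)
  let ?P = "Pi_pmf {..<J} d (\<lambda>_. q)"
  have finP: "finite (set_pmf ?P)" by (intro finite_set_Pi_pmf fin) auto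
  note int = integrable_measure_pmf_finite[OF fin] integrable_measure_pmf_finite[OF finP]
  have "mean (Pi_pmf {..<Suc J} d (\<lambda>_. q)) (\<lambda>f. (\<Sum>j<Suc J. g (f j))\<^sup>2)
      = mean (pair_pmf q ?P) (\<lambda>(i, f). (\<Sum>j<Suc J. g ((f(J := i)) j))\<^sup>2)"
    unfolding lessThan_Suc by (subst Pi_pmf_insert) (auto simp: case_prod_unfold)
  also have "\<dots> = mean ?P (\<lambda>f. mean q
      (\<lambda>i. (\<Sum>j<J. g (f j))\<^sup>2 + (2 * (\<Sum>j<J. g (f j))) * g i + (g i)\<^sup>2))"
  proof -
    have "(\<Sum>j<Suc J. g ((f(J := i)) j)) = (\<Sum>j<J. g (f j)) + g i" for f i
      by (simp add: sum.lessThan_Suc)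
    then show ?thesis
      unfolding expectation_pair_pmf_finite[OF fin finP] by (simp add: power2_sum mult_ac add_ac)
  qed
  also have "\<dots> = mean ?P (\<lambda>f. (\<Sum>j<J. g (f j))\<^sup>2 + mean q (\<lambda>i. (g i)\<^sup>2))"
    by (simp add: int mean)
  also have "\<dots> = mean ?P (\<lambda>f. (\<Sum>j<J. g (f j))\<^sup>2) + mean q (\<lambda>i. (g i)\<^sup>2)"
    by (simp add: int)
  finally show ?case unfolding Suc.IH by (simp add: algebra_simps)
qed

lemma mult_mat_vec_index_sum:
  fixes A :: "real mat"
  assumes "A \<in> carrier_mat m n" "x \<in> carrier_vec n" "i < m"
  shows "(A *\<^sub>v x) $ i = (\<Sum>l<n. A $$ (i, l) * x $ l)"
  using assms by (simp add: scalar_prod_def atLeast0LessThan)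

text \<open>Separates the sampling analysis from the origin of \<open>W\<close>: it rests on the
  conditioning of \<open>W\<close> and the law of the rows alone.\<close>

locale row_norm_sampling =
  fixes K r J :: nat and W :: "real mat" and q :: "nat pmf"
  assumes W: "W \<in> carrier_mat K r" and r: "0 < r" and J: "0 < J"
    and up: "\<And>t. t \<in> carrier_vec r \<Longrightarrow> sqn (W *\<^sub>v t) \<le> 2 * sqn t"
    and low: "\<And>t. t \<in> carrier_vec r \<Longrightarrow> 2 / 3 * sqn t \<le> sqn (W *\<^sub>v t)"
    and q: "\<And>i. pmf q i = (if i < K then (\<Sum>l<r. (W $$ (i, l))\<^sup>2) / mdot K r W W else 0)"
begin

abbreviation "\<omega> i \<equiv> \<Sum>l<r. (W $$ (i, l))\<^sup>2"
abbreviation "P \<equiv> Pi_pmf {..<J} 0 (\<lambda>_. q)"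

lemma set_q: "set_pmf q \<subseteq> {..<K}"
  by (auto simp: set_pmf_iff q split: if_splits)

lemma fin_q: "finite (set_pmf q)"
  using set_q finite_subset by blast

lemma fin_P: "finite (set_pmf P)"
  by (intro finite_set_Pi_pmf fin_q) auto

lemma P_lt: "f \<in> set_pmf P \<Longrightarrow> j < J \<Longrightarrow> f j < K"
  using Pi_pmf_range[of f "{..<J}" 0 "\<lambda>_. q" j] set_q by auto

lemma expectation_q: "mean q h = (\<Sum>i<K. h i * pmf q i)"
  for h :: "nat \<Rightarrow> real"
  by (rule integral_measure_pmf_real) (use set_q in auto)

lemma W_unit: "l < r \<Longrightarrow> W *\<^sub>v unit_vec r l = Matrix.col W l"
  using W by (intro eq_vecI) auto

lemma sqn_unit: "l < r \<Longrightarrow> sqn (unit_vec r l :: real Matrix.vec) = 1"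
  by (subst scalar_prod_left_unit) auto

lemma total_le: "mdot K r W W \<le> 2 * real r"
proof -
  have "mdot K r W W = (\<Sum>l<r. sqn (W *\<^sub>v unit_vec r l))"
    unfolding mdot_cols[OF W W] by (intro sum.cong refl) (simp only: W_unit lessThan_iff)
  also have "\<dots> \<le> (\<Sum>l<r. 2 * sqn (unit_vec r l :: real Matrix.vec))"
    by (intro sum_mono up) auto
  also have "\<dots> = 2 * real r" by (simp add: sqn_unit del: scalar_prod_left_unit)
  finally show ?thesis .
qed

lemma total_pos: "0 < mdot K r W W"
proof -
  have "0 < 2 / 3 * real r" using r by simp
  also have "\<dots> = (\<Sum>l<r. 2 / 3 * sqn (unit_vec r l :: real Matrix.vec))"
    by (simp add: sqn_unit del: scalar_prod_left_unit)
  also have "\<dots> \<le> (\<Sum>l<r. sqn (W *\<^sub>v unit_vec r l))"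
    by (intro sum_mono low) auto
  also have "\<dots> = mdot K r W W"
    unfolding mdot_cols[OF W W] by (intro sum.cong refl) (simp only: W_unit lessThan_iff)
  finally show ?thesis .
qed

lemma \<omega>_eq: "i < K \<Longrightarrow> \<omega> i = pmf q i * mdot K r W W"
  using total_pos by (simp add: q)

text \<open>Division by a vanishing \<open>pmf q i\<close> returns 0. A row that is never drawn is
  zero itself, so the unbiasedness identities below hold at that row too.\<close>

lemma row_zero:
  assumes "i < K" "pmf q i = 0" "l < r"
  shows "W $$ (i, l) = 0"
proof -
  have "\<omega> i = 0" using \<omega>_eq assms by simp
  then have "\<forall>l\<in>{..<r}. (W $$ (i, l))\<^sup>2 = 0" by (subst (asm) sum_nonneg_eq_0_iff) auto
  then show ?thesis using assms by simp
qed

definition scaled_row :: "nat \<Rightarrow> nat \<Rightarrow> real" where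
  "scaled_row i l = 1 / sqrt (pmf q i) * W $$ (i, l)"

lemma ip_scaled_row:
  assumes "i < K"
  shows "(ip r (scaled_row i) x)\<^sup>2 = ((W *\<^sub>v Matrix.vec r x) $ i)\<^sup>2 / pmf q i"
proof -
  have "ip r (scaled_row i) x = 1 / sqrt (pmf q i) * (W *\<^sub>v Matrix.vec r x) $ i"
    unfolding scaled_row_def[abs_def] ip_scale
    using W assms by (simp add: ip_def scalar_prod_def atLeast0LessThan)
  then show ?thesis by (simp add: power_divide)
qed

text \<open>Sampling by row norms gives all drawn rows the same rescaled squared norm |W|_F^2. This
  is the uniform bound that the tail estimate requires.\<close>

lemma scaled_row_norm:
  assumes "i \<in> set_pmf q"
  shows "ip r (scaled_row i) (scaled_row i) \<le> 2 * real r"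
proof -
  have i: "i < K" "0 < pmf q i" using assms set_q by (auto simp: pmf_positive)
  have "ip r (scaled_row i) (scaled_row i) = (1 / sqrt (pmf q i) * (1 / sqrt (pmf q i))) * \<omega> i"
    unfolding scaled_row_def[abs_def] ip_scale by (simp add: ip_def power2_eq_square)
  also have "\<dots> = \<omega> i / pmf q i" using i by simp
  also have "\<dots> = mdot K r W W" using i by (simp add: \<omega>_eq)
  finally show ?thesis using total_le by simp
qed

text \<open>The rescaling is unbiased: the mean of the rank-one matrices is W^T W.\<close>

lemma scaled_row_cov:
  "2 / 3 * ip r x x \<le> mean q (\<lambda>i. (ip r (scaled_row i) x)\<^sup>2)"
proof -
  let ?x = "Matrix.vec r x"
  have "mean q (\<lambda>i. (ip r (scaled_row i) x)\<^sup>2) = (\<Sum>i<K. ((W *\<^sub>v ?x) $ i)\<^sup>2)"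
    unfolding expectation_q
  proof (intro sum.cong refl)
    fix i assume "i \<in> {..<K}"
    then have i: "i < K" by simp
    show "(ip r (scaled_row i) x)\<^sup>2 * pmf q i = ((W *\<^sub>v ?x) $ i)\<^sup>2"
    proof (cases "pmf q i = 0")
      case True
      have "(W *\<^sub>v ?x) $ i = (\<Sum>l<r. W $$ (i, l) * x l)"
        using W i by (simp add: scalar_prod_def atLeast0LessThan)
      also have "\<dots> = 0" using row_zero[OF i True] by simp
      finally show ?thesis using True by simp
    next
      case False
      then show ?thesis by (simp add: ip_scaled_row[OF i])
    qed
  qed
  also have "\<dots> = sqn (W *\<^sub>v ?x)"
    using W by (simp add: scalar_prod_def atLeast0LessThan power2_eq_square)
  finally show ?thesis
    using low[of ?x] by (simp add: scalar_prod_def ip_def atLeast0LessThan)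
qed

abbreviation "S \<equiv> sampling_mat J K q"

lemma S_carrier: "S f \<in> carrier_mat J K"
  by (simp add: sampling_mat_def)

lemma S_mult_index:
  assumes A: "A \<in> carrier_mat K n" and f: "f \<in> set_pmf P" and jk: "j < J" "k < n"
  shows "(S f * A) $$ (j, k) = A $$ (f j, k) / sqrt (real J * pmf q (f j))"
proof -
  have "(S f * A) $$ (j, k) = (\<Sum>i<K. of_bool (f j = i) / sqrt (real J * pmf q (f j)) * A $$ (i, k))"
    using A jk by (simp add: sampling_mat_def scalar_prod_def atLeast0LessThan)
  also have "\<dots> = (\<Sum>i<K. if i = f j then A $$ (f j, k) / sqrt (real J * pmf q (f j)) else 0)"
    by (intro sum.cong) auto
  finally show ?thesis using P_lt[OF f jk(1)] by simp
qed

lemma S_mult_vec_index: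
  assumes f: "f \<in> set_pmf P" and j: "j < J" and x: "x \<in> carrier_vec r"
  shows "((S f * W) *\<^sub>v x) $ j = (W *\<^sub>v x) $ (f j) / sqrt (real J * pmf q (f j))"
proof -
  have "((S f * W) *\<^sub>v x) $ j = (\<Sum>l<r. (S f * W) $$ (j, l) * x $ l)"
    by (rule mult_mat_vec_index_sum[OF mult_carrier_mat[OF S_carrier W] x j])
  also have "\<dots> = (\<Sum>l<r. W $$ (f j, l) / sqrt (real J * pmf q (f j)) * x $ l)"
    by (intro sum.cong refl) (simp only: S_mult_index[OF W f j] lessThan_iff)
  also have "\<dots> = (W *\<^sub>v x) $ (f j) / sqrt (real J * pmf q (f j))"
    using W x P_lt[OF f j] by (simp add: scalar_prod_def atLeast0LessThan sum_divide_distrib)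
  finally show ?thesis .
qed

text \<open>The sampled quadratic form is 1 / J times the sum of squares in the tail bound; the row
  bound L = 2 r turns 32 L into 64 r.\<close>

lemma prob_not_bounded_below:
  "measure_pmf.prob P {f. \<not> (\<forall>t\<in>carrier_vec r. 1 / 4 * sqn t \<le> sqn ((S f * W) *\<^sub>v t))}
    \<le> real r * exp (- real J / (64 * real r))"
proof -
  let ?B = "{f. \<exists>x. (\<Sum>j<J. (ip r (scaled_row (f j)) x)\<^sup>2) < real J / 4 * ip r x x}"
  have "f \<in> ?B" if f: "f \<in> set_pmf P" and t: "t \<in> carrier_vec r" "\<not> 1 / 4 * sqn t \<le> sqn ((S f * W) *\<^sub>v t)" for f t
  proof -
    have vt: "Matrix.vec r (\<lambda>l. t $ l) = t" using t by auto
    have "sqn ((S f * W) *\<^sub>v t) = (\<Sum>j<J. (((S f * W) *\<^sub>v t) $ j)\<^sup>2)"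
      using S_carrier[of f] by (simp add: scalar_prod_def atLeast0LessThan power2_eq_square del: index_mult_mat_vec)
    also have "\<dots> = (\<Sum>j<J. (ip r (scaled_row (f j)) (\<lambda>l. t $ l))\<^sup>2 / real J)"
      by (intro sum.cong refl)
        (simp add: S_mult_vec_index[OF f _ t(1)] ip_scaled_row P_lt[OF f] vt power_divide real_sqrt_mult
          power_mult_distrib mult.commute del: index_mult_mat_vec)
    finally have "(\<Sum>j<J. (ip r (scaled_row (f j)) (\<lambda>l. t $ l))\<^sup>2) = real J * sqn ((S f * W) *\<^sub>v t)"
      using J by (simp add: sum_divide_distrib[symmetric])
    moreover have "sqn t = ip r (\<lambda>l. t $ l) (\<lambda>l. t $ l)"
      using t by (simp add: scalar_prod_def ip_def atLeast0LessThan)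
    moreover have "real J * sqn ((S f * W) *\<^sub>v t) < real J * (1 / 4 * sqn t)"
      using t(2) J by simp
    ultimately have "(\<Sum>j<J. (ip r (scaled_row (f j)) (\<lambda>l. t $ l))\<^sup>2)
        < real J / 4 * ip r (\<lambda>l. t $ l) (\<lambda>l. t $ l)"
      by simp
    then show ?thesis by blast
  qed
  then have "measure_pmf.prob P {f. \<not> (\<forall>t\<in>carrier_vec r. 1 / 4 * sqn t \<le> sqn ((S f * W) *\<^sub>v t))}
      \<le> measure_pmf.prob P ?B"
    by (intro measure_pmf.finite_measure_mono_AE) (auto simp: AE_measure_pmf_iff)
  also have "\<dots> \<le> real r * exp (- real J / (32 * (2 * real r)))"
    using r by (intro matrix_chernoff_lower fin_q scaled_row_norm scaled_row_cov J) auto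
  finally show ?thesis by simp
qed

text \<open>Each entry of the sampled product averages \<open>J\<close> independent terms whose mean
  is the entry of W^T E, that is zero. In the second moment the probabilities cancel against the row
  norms: the sum of |W_i|^2 |E_i|^2 / q_i over the rows is at most |W|_F^2 |E|_F^2.\<close>

lemma expectation_product_error:
  assumes E: "E \<in> carrier_mat K l" and WE: "W\<^sup>T * E = 0\<^sub>m r l"
  shows "mean P (\<lambda>f. mdot r l ((S f * W)\<^sup>T * (S f * E)) ((S f * W)\<^sup>T * (S f * E)))
    \<le> 2 * real r / real J * mdot K l E E"
proof -
  define g where "g w i = W $$ (i, fst w) * E $$ (i, snd w) / pmf q i" for w :: "nat \<times> nat" and i
  let ?D = "{..<r} \<times> {..<l}"
  have entry: "((S f * W)\<^sup>T * (S f * E)) $$ w = (\<Sum>j<J. g w (f j)) / real J"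
    if f: "f \<in> set_pmf P" and w: "w \<in> ?D" for f w
  proof -
    obtain a k where ak: "w = (a, k)" "a < r" "k < l" using w by auto
    have "((S f * W)\<^sup>T * (S f * E)) $$ w = (\<Sum>j<J. (S f * W) $$ (j, a) * (S f * E) $$ (j, k))"
      using ak S_carrier[of f] W E by (simp add: scalar_prod_def atLeast0LessThan)
    also have "\<dots> = (\<Sum>j<J. g w (f j) / real J)"
    proof (intro sum.cong refl)
      fix j assume "j \<in> {..<J}"
      then have j: "j < J" by simp
      show "(S f * W) $$ (j, a) * (S f * E) $$ (j, k) = g w (f j) / real J"
        unfolding S_mult_index[OF W f j ak(2)] S_mult_index[OF E f j ak(3)]
        by (simp add: g_def ak(1) mult.commute)
    qed
    finally show ?thesis by (simp add: sum_divide_distrib)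
  qed
  have mean: "mean q (g w) = 0" if w: "w \<in> ?D" for w
  proof -
    obtain a k where ak: "w = (a, k)" "a < r" "k < l" using w by auto
    have "mean q (g w) = (\<Sum>i<K. W $$ (i, a) * E $$ (i, k))"
      unfolding expectation_q using ak(2)
      by (intro sum.cong refl) (auto simp: g_def ak(1) row_zero)
    also have "\<dots> = (W\<^sup>T * E) $$ (a, k)"
      using ak W E by (simp add: scalar_prod_def atLeast0LessThan)
    finally show ?thesis using ak by (simp add: WE)
  qed
  have "mean P (\<lambda>f. mdot r l ((S f * W)\<^sup>T * (S f * E)) ((S f * W)\<^sup>T * (S f * E)))
      = mean P (\<lambda>f. \<Sum>w\<in>?D. 1 / (real J)\<^sup>2 * (\<Sum>j<J. g w (f j))\<^sup>2)"
    unfolding mdot_def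
    by (intro expectation_cong_pmf sum.cong refl) (simp add: entry power2_eq_square)
  also have "\<dots> = (\<Sum>w\<in>?D. 1 / (real J)\<^sup>2 * mean P (\<lambda>f. (\<Sum>j<J. g w (f j))\<^sup>2))"
    by (subst Bochner_Integration.integral_sum) (auto intro: integrable_measure_pmf_finite fin_P)
  also have "\<dots> = (\<Sum>w\<in>?D. 1 / real J * mean q (\<lambda>i. (g w i)\<^sup>2))"
    using J by (intro sum.cong refl, simp only: expectation_iid_sum_sq[OF fin_q mean])
      (simp add: power2_eq_square)
  also have "\<dots> = 1 / real J * mean q (\<lambda>i. \<Sum>w\<in>?D. (g w i)\<^sup>2)"
    unfolding sum_distrib_left[symmetric]
    by (subst Bochner_Integration.integral_sum) (auto intro: integrable_measure_pmf_finite fin_q)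
  also have "mean q (\<lambda>i. \<Sum>w\<in>?D. (g w i)\<^sup>2)
      \<le> (\<Sum>i<K. mdot K r W W * (\<Sum>k<l. (E $$ (i, k))\<^sup>2))"
    unfolding expectation_q
  proof (rule sum_mono)
    fix i assume "i \<in> {..<K}"
    then have i: "i < K" by simp
    define e where "e = (\<Sum>k<l. (E $$ (i, k))\<^sup>2)"
    have e: "0 \<le> e" unfolding e_def by (intro sum_nonneg) simp
    have "(\<Sum>w\<in>?D. (g w i)\<^sup>2) = \<omega> i * e / (pmf q i)\<^sup>2"
      unfolding e_def sum_product sum.cartesian_product sum_divide_distrib
      by (intro sum.cong refl) (simp add: g_def case_prod_unfold power_mult_distrib power_divide)
    then have g: "(\<Sum>w\<in>?D. (g w i)\<^sup>2) = pmf q i * mdot K r W W * e / (pmf q i)\<^sup>2"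
      unfolding \<omega>_eq[OF i] .
    show "(\<Sum>w\<in>?D. (g w i)\<^sup>2) * pmf q i \<le> mdot K r W W * (\<Sum>k<l. (E $$ (i, k))\<^sup>2)"
      unfolding g e_def[symmetric] using total_pos e
      by (cases "pmf q i = 0") (simp_all add: power2_eq_square)
  qed
  also have "\<dots> = mdot K r W W * mdot K l E E"
    by (simp add: sum_distrib_left mdot_def[of K l] sum.cartesian_product case_prod_unfold power2_eq_square)
  also have "\<dots> \<le> 2 * real r * mdot K l E E"
    by (intro mult_right_mono total_le mdot_self_nonneg)
  finally show ?thesis by (simp add: divide_right_mono)
qed

text \<open>Markov's inequality at \<epsilon>/32 |E|^2, with (2 r / J) / (\<epsilon> / 32) = 64 r /
  (\<epsilon> J). For \<open>E\<close> of norm zero the threshold degenerates; there the mean is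
  zero and the error vanishes on the whole support.\<close>

lemma prob_product_error:
  assumes E: "E \<in> carrier_mat K l" and WE: "W\<^sup>T * E = 0\<^sub>m r l" and \<epsilon>: "0 < \<epsilon>"
  shows "measure_pmf.prob P {f. \<not> (fro_norm ((S f * W)\<^sup>T * (S f * E)))\<^sup>2 \<le> \<epsilon> / 32 * (fro_norm E)\<^sup>2}
    \<le> 64 * real r / (\<epsilon> * real J)"
proof -
  let ?h = "\<lambda>f. mdot r l ((S f * W)\<^sup>T * (S f * E)) ((S f * W)\<^sup>T * (S f * E))"
  have c: "(S f * W)\<^sup>T * (S f * E) \<in> carrier_mat r l" for f
    using mult_carrier_mat[OF S_carrier W] mult_carrier_mat[OF S_carrier E] by (simp add: mult_carrier_mat[of _ r J])
  let ?B = "{f. \<epsilon> / 32 * mdot K l E E < ?h f}"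
  have B: "{f. \<not> (fro_norm ((S f * W)\<^sup>T * (S f * E)))\<^sup>2 \<le> \<epsilon> / 32 * (fro_norm E)\<^sup>2} = ?B"
    unfolding fro_norm_sq(1)[OF c] fro_norm_sq(1)[OF E] by (simp add: not_le)
  note le = expectation_product_error[OF E WE]
  have nn: "0 \<le> ?h f" for f by (rule mdot_self_nonneg)
  show ?thesis
  proof (cases "mdot K l E E = 0")
    case True
    have "?h f = 0" if f: "f \<in> set_pmf P" for f
    proof -
      have "mean P ?h = 0"
        using le True nn by (intro antisym) auto
      then have "(\<Sum>f\<in>set_pmf P. ?h f * pmf P f) = 0"
        by (subst (asm) integral_measure_pmf_real[of "set_pmf P"]) (auto simp: fin_P)
      then have "\<forall>f\<in>set_pmf P. ?h f * pmf P f = 0"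
        using fin_P nn by (subst (asm) sum_nonneg_eq_0_iff) auto
      then show ?thesis using f by (auto simp: set_pmf_iff)
    qed
    then have "measure_pmf.prob P ?B = 0"
      using True by (subst measure_pmf_zero_iff) auto
    then show ?thesis unfolding B using \<epsilon> by simp
  next
    case False
    then have EE: "0 < mdot K l E E" using mdot_self_nonneg[of K l E] by linarith
    define \<theta> where "\<theta> = \<epsilon> / 32 * mdot K l E E"
    have \<theta>: "0 < \<theta>" using \<epsilon> EE by (simp add: \<theta>_def)
    have "measure_pmf.prob P ?B * \<theta> = mean P (\<lambda>f. indicator ?B f * \<theta>)" by simp
    also have "\<dots> \<le> mean P ?h"
      by (rule expectation_mono_pmf[OF fin_P]) (use nn in \<open>auto simp: indicator_def \<theta>_def\<close>)
    also have "\<dots> \<le> 2 * real r / real J * mdot K l E E" by (rule le)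
    also have "\<dots> = 64 * real r / (\<epsilon> * real J) * \<theta>"
      using \<epsilon> J by (simp add: \<theta>_def)
    finally show ?thesis unfolding B using \<theta> by (simp only: mult_le_cancel_right_pos)
  qed
qed

end

section \<open>The main theorem\<close>

text \<open>Q Q^T B is the orthogonal projection of \<open>B\<close> onto the column space; Z = C
  Q^T B writes it through the columns of \<open>G\<close>, which may be linearly dependent.\<close>

lemma least_squares_projection:
  assumes G: "G \<in> carrier_mat K n" and B: "B \<in> carrier_mat K l"
  obtains Z where "Z \<in> carrier_mat n l" "G\<^sup>T * (B - G * Z) = 0\<^sub>m n l"
    "\<And>H. H \<in> carrier_mat n l \<Longrightarrow> fro_norm (B - G * Z) \<le> fro_norm (G * H - B)"
proof -
  obtain m Q A C where Q: "Q \<in> carrier_mat K m" and A: "A \<in> carrier_mat m n" and C: "C \<in> carrier_mat n m"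
    and QQ: "Q\<^sup>T * Q = 1\<^sub>m m" and GQA: "G = Q * A" and QGC: "Q = G * C"
    using orthonormal_factorization[OF G] by metis
  define Z where "Z = C * (Q\<^sup>T * B)"
  have QT: "Q\<^sup>T \<in> carrier_mat m K" and GT: "G\<^sup>T \<in> carrier_mat n K" and AT: "A\<^sup>T \<in> carrier_mat n m"
    using Q G A by simp_all
  have QTB: "Q\<^sup>T * B \<in> carrier_mat m l" using QT B by simp
  have Z: "Z \<in> carrier_mat n l" unfolding Z_def using C QTB by simp
  have GZ: "G * Z = Q * (Q\<^sup>T * B)"
    unfolding Z_def assoc_mult_mat[OF G C QTB, symmetric] QGC[symmetric] ..
  have GZc: "G * Z \<in> carrier_mat K l" using G Z by simp
  have QQB: "Q * (Q\<^sup>T * B) \<in> carrier_mat K l" using Q QTB by simp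
  have E: "B - G * Z \<in> carrier_mat K l" by (rule minus_carrier_mat[OF GZc])
  have "Q\<^sup>T * (B - G * Z) = 0\<^sub>m m l"
    unfolding GZ mult_minus_distrib_mat[OF QT B QQB] assoc_mult_mat[OF QT Q QTB, symmetric] QQ
      left_mult_one_mat[OF QTB] by (rule minus_r_inv_mat[OF QTB])
  moreover have "G\<^sup>T * (B - G * Z) = A\<^sup>T * (Q\<^sup>T * (B - G * Z))"
  proof -
    have "G\<^sup>T = A\<^sup>T * Q\<^sup>T" unfolding GQA by (rule transpose_mult[OF Q A])
    then show ?thesis using assoc_mult_mat[OF AT QT E] by simp
  qed
  ultimately have orth: "G\<^sup>T * (B - G * Z) = 0\<^sub>m n l" using AT by simp
  have opt: "fro_norm (B - G * Z) \<le> fro_norm (G * H - B)" if H: "H \<in> carrier_mat n l" for H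
  proof -
    let ?E = "B - G * Z"
    have HZ: "H - Z \<in> carrier_mat n l" by (rule minus_carrier_mat[OF Z])
    have "mdot K l (G * H - B) (G * H - B) = 1\<^sup>2 * mdot K l (G * (H - Z)) (G * (H - Z))
        - 2 * 1 * mdot K l (G * (H - Z)) ?E + mdot K l ?E ?E"
    proof (rule mdot_lin_comb)
      fix w assume "w \<in> {..<K} \<times> {..<l}"
      then obtain i k where ik: "w = (i, k)" "i < K" "k < l" by auto
      show "(G * H - B) $$ w = 1 * (G * (H - Z)) $$ w - ?E $$ w"
        unfolding mult_minus_distrib_mat[OF G H Z] using ik G H Z B by simp
    qed
    moreover have "mdot K l (G * (H - Z)) ?E = 0"
      unfolding mdot_adjoint[OF G HZ E] orth by (auto simp: mdot_def intro!: sum.neutral)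
    ultimately have "mdot K l ?E ?E \<le> mdot K l (G * H - B) (G * H - B)"
      using mdot_self_nonneg[of K l "G * (H - Z)"] by simp
    then show ?thesis
      using fro_norm_sq(2)[OF E] fro_norm_sq(2)[OF minus_carrier_mat[OF B], of "G * H"] by simp
  qed
  show ?thesis by (rule that[OF Z orth opt])
qed

lemma prob_sampled_solution:
  fixes \<epsilon> \<delta> :: real
  assumes emb: "embeds \<Psi> G" and \<Psi>: "\<Psi> \<in> carrier_mat J1 K" and G: "G \<in> carrier_mat K n"
    and G0: "G \<noteq> 0\<^sub>m K n" and svd: "compact_svd (\<Psi> * G) U D V"
    and B: "B \<in> carrier_mat K l" and n: "1 \<le> n"
    and \<epsilon>: "0 < \<epsilon>" "\<epsilon> < 1" and \<delta>: "0 < \<delta>" "\<delta> < 1"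
    and J2: "real J2 \<ge> 600 * real n * max (ln (real n / \<delta>)) (1 / (\<epsilon> * \<delta>))"
  shows "measure_pmf.prob (sampling_pmf J2 K (proportional_pmf K (approx_lev G D V) q\<^sub>0))
    {S. \<forall>G'. is_arg_min (\<lambda>H. fro_norm (S * G * H\<^sup>T - S * B)) (\<lambda>H. H \<in> carrier_mat l n) G' \<longrightarrow>
      fro_norm (G * G'\<^sup>T - B) \<le> (1 + \<epsilon>) * (INF H\<in>carrier_mat l n. fro_norm (G * H\<^sup>T - B))} \<ge> 1 - \<delta> / 2"
proof -
  define W where "W = G * V * the (mat_inverse D)"
  define q where "q = proportional_pmf K (approx_lev G D V) q\<^sub>0"
  obtain r X Y where rn: "r \<le> n" and X: "X \<in> carrier_mat n r" and Y: "Y \<in> carrier_mat r n"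
    and W: "W \<in> carrier_mat K r" and WX: "W = G * X" and GY: "G = W * Y"
    and up: "\<And>t. t \<in> carrier_vec r \<Longrightarrow> sqn (W *\<^sub>v t) \<le> 2 * sqn t"
    and low: "\<And>t. t \<in> carrier_vec r \<Longrightarrow> 2 / 3 * sqn t \<le> sqn (W *\<^sub>v t)"
    using compact_svd_conditioned_basis[OF emb \<Psi> G svd] unfolding W_def[symmetric] by metis
  \<comment> \<open>W = 0 would give G = W Y = 0. Hence \<open>r\<close> is positive and some
    sampling weight is nonzero, so \<open>q\<close> is the law proportional to the weights.\<close>
  have zero: False if "\<And>i k. i < K \<Longrightarrow> k < r \<Longrightarrow> W $$ (i, k) = 0"
  proof -
    have "W * Y = 0\<^sub>m K n"
      using W Y that by (intro eq_matI) (auto simp: scalar_prod_def intro!: sum.neutral)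
    then show False using GY G0 by simp
  qed
  have r: "0 < r" using zero by (cases r) auto
  have lev: "approx_lev G D V i = (\<Sum>k<r. (W $$ (i, k))\<^sup>2)" if "i < K" for i
    unfolding approx_lev_def W_def[symmetric] Let_def
    using that W by (simp add: scalar_prod_def atLeast0LessThan power2_eq_square)
  have lev0: "\<exists>i<K. approx_lev G D V i \<noteq> 0"
  proof (rule ccontr)
    assume "\<not> ?thesis"
    then have "(\<Sum>k<r. (W $$ (i, k))\<^sup>2) = 0" if "i < K" for i using lev that by simp
    then have "\<forall>k\<in>{..<r}. (W $$ (i, k))\<^sup>2 = 0" if "i < K" for i
      using that by (subst sum_nonneg_eq_0_iff[symmetric]) auto
    then show False by (intro zero) auto
  qed
  have total: "(\<Sum>i<K. approx_lev G D V i) = mdot K r W W"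
    by (simp add: lev mdot_def sum.cartesian_product case_prod_unfold power2_eq_square)
  have q_eq: "pmf q i = (if i < K then (\<Sum>k<r. (W $$ (i, k))\<^sup>2) / mdot K r W W else 0)" for i
  proof -
    have "0 \<le> approx_lev G D V i" if "i < K" for i using that by (simp add: lev sum_nonneg)
    from pmf_proportional_pmf[OF this lev0] show ?thesis unfolding q_def total by (simp add: lev)
  qed
  define \<mu> where "\<mu> = max (ln (real n / \<delta>)) (1 / (\<epsilon> * \<delta>))"
  have \<epsilon>\<delta>: "0 < \<epsilon> * \<delta>" "\<epsilon> * \<delta> < 1"
    using \<epsilon> \<delta> mult_strict_mono[of \<epsilon> 1 \<delta> 1] by simp_all
  \<comment> \<open>Because \<epsilon> \<delta> < 1, the maximum is at least 1 and can absorb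
    additive constants such as ln 4.\<close>
  have \<mu>: "1 \<le> \<mu>" "ln (real n / \<delta>) \<le> \<mu>" "1 / (\<epsilon> * \<delta>) \<le> \<mu>"
    using \<epsilon>\<delta> by (simp_all add: \<mu>_def le_max_iff_disj)
  have J2\<mu>: "600 * real n * \<mu> \<le> real J2" using J2 by (simp add: \<mu>_def)
  have "0 < 600 * real n * \<mu>" using n \<mu> by simp
  then have "0 < real J2" using J2\<mu> by linarith
  then have J2pos: "0 < J2" by simp
  interpret row_norm_sampling K r J2 W q
    by unfold_locales (use W r J2pos up low q_eq in auto)
  obtain Z where Z: "Z \<in> carrier_mat n l" and orth: "G\<^sup>T * (B - G * Z) = 0\<^sub>m n l"
    and opt: "\<And>H. H \<in> carrier_mat n l \<Longrightarrow> fro_norm (B - G * Z) \<le> fro_norm (G * H - B)"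
    using least_squares_projection[OF G B] by metis
  let ?E = "B - G * Z"
  have GZ: "G * Z \<in> carrier_mat K l" using G Z by simp
  have E: "?E \<in> carrier_mat K l" by (rule minus_carrier_mat[OF GZ])
  have WE: "W\<^sup>T * ?E = 0\<^sub>m r l"
  proof -
    have "W\<^sup>T * ?E = X\<^sup>T * (G\<^sup>T * ?E)"
      unfolding WX transpose_mult[OF G X] using G X E by (intro assoc_mult_mat[of _ r n _ K]) auto
    then show ?thesis unfolding orth using X by simp
  qed
  define good where "good S \<longleftrightarrow> (\<forall>G'. is_arg_min (\<lambda>H. fro_norm (S * G * H\<^sup>T - S * B)) (\<lambda>H. H \<in> carrier_mat l n) G' \<longrightarrow>
      fro_norm (G * G'\<^sup>T - B) \<le> (1 + \<epsilon>) * (INF H\<in>carrier_mat l n. fro_norm (G * H\<^sup>T - B)))" for S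
  let ?L = "{f. \<not> (\<forall>t\<in>carrier_vec r. 1 / 4 * sqn t \<le> sqn ((S f * W) *\<^sub>v t))}"
  let ?A = "{f. \<not> (fro_norm ((S f * W)\<^sup>T * (S f * ?E)))\<^sup>2 \<le> \<epsilon> / 32 * (fro_norm ?E)\<^sup>2}"
  have good: "good (S f)" if "f \<notin> ?L" "f \<notin> ?A" for f
    unfolding good_def
  proof (intro allI impI)
    fix G' assume arg: "is_arg_min (\<lambda>H. fro_norm (S f * G * H\<^sup>T - S f * B)) (\<lambda>H. H \<in> carrier_mat l n) G'"
    then have G': "G' \<in> carrier_mat l n" unfolding is_arg_min_def by simp
    have "fro_norm (G * G'\<^sup>T - B) \<le> (1 + \<epsilon>) * fro_norm ?E"
    proof (rule sketched_least_squares[OF G W X Y WX GY B Z orth S_carrier[of f] _ up _ \<epsilon>(1)])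
      show "1 / 4 * sqn t \<le> sqn ((S f * W) *\<^sub>v t)" if "t \<in> carrier_vec r" for t
        using \<open>f \<notin> ?L\<close> that by blast
      show "(fro_norm ((S f * W)\<^sup>T * (S f * ?E)))\<^sup>2 \<le> \<epsilon> / 32 * (fro_norm ?E)\<^sup>2"
        using \<open>f \<notin> ?A\<close> by blast
      show "G'\<^sup>T \<in> carrier_mat n l" using G' by simp
      show "fro_norm (S f * G * G'\<^sup>T - S f * B) \<le> fro_norm (S f * G * H - S f * B)"
        if "H \<in> carrier_mat n l" for H
      proof -
        have "H\<^sup>T \<in> carrier_mat l n" using that by simp
        then have "\<not> fro_norm (S f * G * (H\<^sup>T)\<^sup>T - S f * B) < fro_norm (S f * G * G'\<^sup>T - S f * B)"
          using arg unfolding is_arg_min_def by blast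
        then show ?thesis by simp
      qed
    qed
    also have "fro_norm ?E \<le> (INF H\<in>carrier_mat l n. fro_norm (G * H\<^sup>T - B))"
    proof (rule cINF_greatest)
      show "carrier_mat l n \<noteq> ({} :: real mat set)" using zero_carrier_mat by blast
      show "fro_norm ?E \<le> fro_norm (G * H\<^sup>T - B)" if "H \<in> carrier_mat l n" for H
        using that by (intro opt) simp
    qed
    then have "(1 + \<epsilon>) * fro_norm ?E \<le> (1 + \<epsilon>) * (INF H\<in>carrier_mat l n. fro_norm (G * H\<^sup>T - B))"
      using \<epsilon> by (intro mult_left_mono) auto
    finally show "fro_norm (G * G'\<^sup>T - B) \<le> (1 + \<epsilon>) * (INF H\<in>carrier_mat l n. fro_norm (G * H\<^sup>T - B))" .
  qed
  have "measure_pmf.prob P (- {f. good (S f)}) \<le> measure_pmf.prob P (?L \<union> ?A)"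
    using good by (intro measure_pmf.finite_measure_mono) auto
  also have "\<dots> \<le> measure_pmf.prob P ?L + measure_pmf.prob P ?A"
    by (rule measure_Un_le) auto
  \<comment> \<open>It suffices that J2 \<ge> 64 n ln (4 n / \<delta>). The logarithm is at most 3 +
    \<mu> \<le> 9 \<mu>, and 64 * 9 = 576 stays below 600.\<close>
  also have "measure_pmf.prob P ?L \<le> \<delta> / 4"
  proof -
    have rn': "0 < real r" "real r \<le> real n" "0 < real n" using r rn n by auto
    have "ln (4 * real n / \<delta>) = ln 4 + ln (real n / \<delta>)"
      using rn' \<delta> ln_mult[of 4 "real n / \<delta>"] by simp
    moreover have "ln (4 :: real) \<le> 4 - 1" by (rule ln_le_minus_one) simp
    ultimately have "ln (4 * real n / \<delta>) \<le> 9 * \<mu>" using \<mu> by linarith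
    also have "\<dots> \<le> real J2 / (64 * real n)"
      using J2\<mu> rn' \<mu> by (simp add: field_simps)
    also have "\<dots> \<le> real J2 / (64 * real r)" using rn' by (intro divide_left_mono) auto
    finally have "exp (- real J2 / (64 * real r)) \<le> exp (- ln (4 * real n / \<delta>))" by simp
    also have "\<dots> = \<delta> / (4 * real n)" using rn' \<delta> by (simp add: exp_minus)
    finally have "real r * exp (- real J2 / (64 * real r)) \<le> real n * (\<delta> / (4 * real n))"
      using rn' by (intro mult_mono) auto
    also have "\<dots> = \<delta> / 4" using rn' by simp
    finally show ?thesis using prob_not_bounded_below by linarith
  qed
  \<comment> \<open>The bound 64 r / (\<epsilon> J2) drops to \<delta>/4 once J2 \<ge> 256 r /
    (\<epsilon> \<delta>).\<close>
  also have "measure_pmf.prob P ?A \<le> \<delta> / 4"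
  proof -
    have "600 * real n * (1 / (\<epsilon> * \<delta>)) \<le> real J2"
      using J2\<mu> mult_left_mono[OF \<mu>(3), of "600 * real n"] by simp
    then have "600 * real n \<le> \<epsilon> * \<delta> * real J2" using \<epsilon>\<delta> by (simp add: field_simps)
    moreover have "256 * real r \<le> 600 * real n" using rn by (intro mult_mono) auto
    ultimately have "256 * real r \<le> \<epsilon> * \<delta> * real J2" by linarith
    then have "64 * real r / (\<epsilon> * real J2) \<le> \<delta> / 4"
      using \<epsilon> J2pos by (simp add: field_simps)
    then show ?thesis using prob_product_error[OF E WE \<epsilon>(1)] by linarith
  qed
  finally have "measure_pmf.prob P (- {f. good (S f)}) \<le> \<delta> / 2" by simp
  moreover have "measure_pmf.prob P (- {f. good (S f)}) = 1 - measure_pmf.prob P {f. good (S f)}"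
    using measure_pmf.prob_compl[of "{f. good (S f)}" P] by (simp add: Compl_eq_Diff_UNIV)
  moreover have "measure_pmf.prob (sampling_pmf J2 K q) {S. good S} = measure_pmf.prob P {f. good (S f)}"
    unfolding sampling_pmf_def by (simp add: vimage_def)
  ultimately show ?thesis unfolding good_def q_def by simp
qed

text \<open>The law of the second stage may depend on the first: averaging its conditional success
  probability over the good first outcomes gives (1 - a) (1 - b).\<close>

lemma prob_bind_pmf_ge:
  assumes "measure_pmf.prob P {x. A x} \<ge> 1 - a" "\<And>x. x \<in> set_pmf P \<Longrightarrow> A x \<Longrightarrow> measure_pmf.prob (Q x) B \<ge> 1 - b"
    and "0 \<le> a" "0 \<le> b" "b \<le> 1"
  shows "measure_pmf.prob (bind_pmf P Q) B \<ge> 1 - (a + b)"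
proof -
  have "(1 - a) * (1 - b) \<le> measure_pmf.prob P {x. A x} * (1 - b)"
    using assms by (intro mult_right_mono) auto
  also have "\<dots> = mean P (\<lambda>x. indicator {x. A x} x * (1 - b))" by simp
  also have "\<dots> \<le> mean P (\<lambda>x. measure_pmf.prob (Q x) B)"
  proof (rule integral_mono_AE)
    show "integrable (measure_pmf P) (\<lambda>x. indicator {x. A x} x * (1 - b))"
      by (rule measure_pmf.integrable_const_bound[where B = 1]) (use assms in \<open>auto simp: indicator_def\<close>)
    show "integrable (measure_pmf P) (\<lambda>x. measure_pmf.prob (Q x) B)"
      by (rule measure_pmf.integrable_const_bound[where B = 1]) auto
    show "AE x in measure_pmf P. indicator {x. A x} x * (1 - b) \<le> measure_pmf.prob (Q x) B"
      using assms(2) by (auto simp: AE_measure_pmf_iff indicator_def)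
  qed
  also have "\<dots> = measure_pmf.prob (bind_pmf P Q) B"
  proof -
    have "measure_pmf.prob (bind_pmf P Q) B = enn2real (\<integral>\<^sup>+ x. emeasure (measure_pmf (Q x)) B \<partial>measure_pmf P)"
      by (simp add: measure_def)
    also have "\<dots> = enn2real (\<integral>\<^sup>+ x. ennreal (measure_pmf.prob (Q x) B) \<partial>measure_pmf P)"
      by (simp add: measure_pmf.emeasure_eq_measure)
    also have "\<dots> = mean P (\<lambda>x. measure_pmf.prob (Q x) B)"
      by (rule integral_eq_nn_integral[symmetric]) auto
    finally show ?thesis by simp
  qed
  finally have "(1 - a) * (1 - b) \<le> measure_pmf.prob (bind_pmf P Q) B" .
  moreover have "1 - (a + b) \<le> (1 - a) * (1 - b)" using assms by (simp add: algebra_simps)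
  ultimately show ?thesis by linarith
qed

text \<open>The constant of the sketch is at most exp x with x = 36 N / J \<le> 1, hence exceeds 1
  by at most 2 x. The embedding then fails with probability at most 8 n^2 x = 288 N n^2 / J, which
  600 \<ge> 2 * 288 brings below \<delta>/2.\<close>

lemma prob_recursive_sketch_embeds:
  fixes \<delta> :: real
  assumes P: "recursive_sketch J Is P" and Is: "Is \<noteq> []" "\<And>i. i \<in> set Is \<Longrightarrow> 0 < i" "length Is \<le> N"
    and G: "G \<in> carrier_mat (prod_list Is) n" and n: "1 \<le> n" and \<delta>: "0 < \<delta>" "\<delta> < 1"
    and J: "real J \<ge> 600 * real N * (real n)\<^sup>2 / \<delta>"
  shows "measure_pmf.prob P {\<Psi>. embeds \<Psi> G} \<ge> 1 - \<delta> / 2" "set_pmf P \<subseteq> carrier_mat J (prod_list Is)"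
proof -
  have N: "1 \<le> real N" using Is(1,3) by (cases Is) auto
  have n2: "1 \<le> (real n)\<^sup>2" using n by (simp add: one_le_power)
  have J\<delta>: "600 * real N * (real n)\<^sup>2 \<le> \<delta> * real J" using J \<delta> by (simp add: field_simps)
  have Nn: "real N \<le> real N * (real n)\<^sup>2" using N n2 mult_left_mono[of 1 "(real n)\<^sup>2" "real N"] by simp
  have Jpos: "0 < real J"
  proof -
    have "0 < \<delta> * real J" using J\<delta> Nn N by linarith
    then show ?thesis using \<delta> by (simp add: zero_less_mult_iff)
  qed
  then have "0 < J" by simp
  note sketch = dot_preserving_recursive_sketch[OF P this Is(1,2)]
  then show "set_pmf P \<subseteq> carrier_mat J (prod_list Is)" unfolding dot_preserving_def by simp
  define x where "x = 36 * real N / real J"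
  have x0: "0 \<le> x" unfolding x_def by simp
  have "\<delta> * real J \<le> real J" using \<delta> by (simp add: mult_left_le_one_le)
  then have "36 * real N \<le> real J" using J\<delta> Nn N by linarith
  then have x1: "x \<le> 1" unfolding x_def using Jpos by (simp add: divide_le_eq)
  have "(1 + 9 / real J) ^ (4 * length Is) \<le> exp (9 / real J) ^ (4 * length Is)"
    by (intro power_mono exp_ge_add_one_self) simp
  also have "\<dots> = exp (36 * real (length Is) / real J)"
    by (simp add: exp_of_nat_mult[symmetric])
  also have "\<dots> \<le> exp x"
    unfolding exp_le_cancel_iff x_def using Is(3) by (intro divide_right_mono) auto
  also have "\<dots> \<le> 1 + x + x\<^sup>2" by (rule exp_bound[OF x0 x1])
  also have "\<dots> \<le> 1 + 2 * x"
    using x0 x1 mult_left_le_one_le[of x x] by (simp add: power2_eq_square)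
  finally have b: "(1 + 9 / real J) ^ (4 * length Is) - 1 \<le> 2 * x" by simp
  have "4 * (real n)\<^sup>2 * ((1 + 9 / real J) ^ (4 * length Is) - 1) \<le> 4 * (real n)\<^sup>2 * (2 * x)"
    by (intro mult_left_mono b) simp
  also have "\<dots> = 288 * (real N * (real n)\<^sup>2) / real J" by (simp add: x_def)
  also have "\<dots> \<le> \<delta> / 2"
  proof -
    have "0 \<le> real N * (real n)\<^sup>2" by simp
    then have "288 * (real N * (real n)\<^sup>2) \<le> \<delta> / 2 * real J" using J\<delta> by linarith
    then show ?thesis using Jpos by (simp add: divide_le_eq)
  qed
  finally show "measure_pmf.prob P {\<Psi>. embeds \<Psi> G} \<ge> 1 - \<delta> / 2"
    using prob_embeds[OF sketch G] by linarith
qed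

theorem theorem11:
  shows "\<exists>c::real. c > 0 \<and>
    (\<forall>(N::nat) (n::nat) (I :: nat \<Rightarrow> nat) (R :: nat \<Rightarrow> nat)
       (X :: (nat \<Rightarrow> nat) \<Rightarrow> real) (cores :: nat \<Rightarrow> nat \<Rightarrow> nat \<Rightarrow> nat \<Rightarrow> real)
       (\<epsilon>::real) (\<delta>::real) (J1::nat) (J2::nat) (P\<Psi> :: real mat pmf)
       (U1 :: real mat \<Rightarrow> real mat) (D1 :: real mat \<Rightarrow> real mat) (V1 :: real mat \<Rightarrow> real mat)
       (q\<^sub>0 :: nat pmf) (XX :: real mat) (GG :: real mat) (K::nat) (rr::nat) (w :: nat list)
       (q :: real mat \<Rightarrow> nat pmf).
      N \<ge> 2 \<longrightarrow> n \<in> {1..N} \<longrightarrow>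
      (\<forall>j\<in>{1..N}. I j \<ge> 1) \<longrightarrow> (\<forall>j\<in>{1..N}. R j \<ge> 1) \<longrightarrow> R 0 = R N \<longrightarrow>
      XX = mode_unfold N n I X \<longrightarrow>
      GG = subchain_mat N n I R cores \<longrightarrow>
      K = (\<Prod>j\<in>{1..N} - {n}. I j) \<longrightarrow>
      rr = R (n - 1) * R n \<longrightarrow>
      GG \<noteq> 0\<^sub>m K rr \<longrightarrow>
      w = rev [1..<n] @ rev [Suc n..<Suc N] \<longrightarrow>
      0 < \<epsilon> \<longrightarrow> \<epsilon> < 1 \<longrightarrow> 0 < \<delta> \<longrightarrow> \<delta> < 1 \<longrightarrow>
      recursive_sketch J1 (map I w) P\<Psi> \<longrightarrow>
      (\<forall>\<Psi>\<in>set_pmf P\<Psi>. compact_svd (\<Psi> * GG) (U1 \<Psi>) (D1 \<Psi>) (V1 \<Psi>)) \<longrightarrow>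
      set_pmf q\<^sub>0 \<subseteq> {..<K} \<longrightarrow>
      q = (\<lambda>\<Psi>. proportional_pmf K (approx_lev GG (D1 \<Psi>) (V1 \<Psi>)) q\<^sub>0) \<longrightarrow>
      real J1 \<ge> c * real N * (real rr)\<^sup>2 / \<delta> \<longrightarrow>
      real J2 \<ge> c * real rr * max (ln (real rr / \<delta>)) (1 / (\<epsilon> * \<delta>)) \<longrightarrow>
      measure_pmf.prob (bind_pmf P\<Psi> (\<lambda>\<Psi>. sampling_pmf J2 K (q \<Psi>)))
        {S. \<forall>G'. is_arg_min (\<lambda>G. fro_norm (S * GG * G\<^sup>T - S * XX\<^sup>T))
                   (\<lambda>G. G \<in> carrier_mat (I n) rr) G' \<longrightarrow>
              fro_norm (GG * G'\<^sup>T - XX\<^sup>T)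
                \<le> (1 + \<epsilon>) * (INF G\<in>carrier_mat (I n) rr. fro_norm (GG * G\<^sup>T - XX\<^sup>T))}
        \<ge> 1 - \<delta>)"
proof (intro exI[of _ 600] conjI allI impI)
  fix N n J1 J2 K rr :: nat and I R :: "nat \<Rightarrow> nat" and X :: "(nat \<Rightarrow> nat) \<Rightarrow> real"
    and cores :: "nat \<Rightarrow> nat \<Rightarrow> nat \<Rightarrow> nat \<Rightarrow> real" and \<epsilon> \<delta> :: real and P\<Psi> :: "real mat pmf"
    and U1 D1 V1 :: "real mat \<Rightarrow> real mat" and q\<^sub>0 :: "nat pmf" and XX GG :: "real mat" and w :: "nat list"
    and q :: "real mat \<Rightarrow> nat pmf"
  assume N: "2 \<le> N" and n: "n \<in> {1..N}" and I: "\<forall>j\<in>{1..N}. 1 \<le> I j" and R: "\<forall>j\<in>{1..N}. 1 \<le> R j"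
    and R0: "R 0 = R N" and XX: "XX = mode_unfold N n I X" and GG: "GG = subchain_mat N n I R cores"
    and K: "K = (\<Prod>j\<in>{1..N} - {n}. I j)" and rr: "rr = R (n - 1) * R n" and GG0: "GG \<noteq> 0\<^sub>m K rr"
    and w: "w = rev [1..<n] @ rev [Suc n..<Suc N]" and \<epsilon>: "0 < \<epsilon>" "\<epsilon> < 1" and \<delta>: "0 < \<delta>" "\<delta> < 1"
    and P: "recursive_sketch J1 (map I w) P\<Psi>"
    and svd: "\<forall>\<Psi>\<in>set_pmf P\<Psi>. compact_svd (\<Psi> * GG) (U1 \<Psi>) (D1 \<Psi>) (V1 \<Psi>)"
    and q: "q = (\<lambda>\<Psi>. proportional_pmf K (approx_lev GG (D1 \<Psi>) (V1 \<Psi>)) q\<^sub>0)"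
    and J1: "600 * real N * (real rr)\<^sup>2 / \<delta> \<le> real J1"
    and J2: "600 * real rr * max (ln (real rr / \<delta>)) (1 / (\<epsilon> * \<delta>)) \<le> real J2"
  have dist: "distinct w" and set_w: "set w = {1..N} - {n}" using n by (auto simp: w)
  have len: "length w = N - 1" using distinct_card[OF dist] n by (simp add: set_w)
  have prod: "prod_list (map I w) = K"
    unfolding K set_w[symmetric] using dist by (simp add: prod.distinct_set_conv_list)
  have rr1: "1 \<le> rr"
  proof -
    have "1 \<le> R n" using R n by blast
    \<comment> \<open>For n = 1 the index n - 1 = 0 lies outside the modes, and R 0 = R N supplies
      the bound.\<close>
    moreover have "1 \<le> R (n - 1)"
    proof (cases "n = 1")
      case True
      then show ?thesis using R R0 N by auto
    next
      case False
      then have "n - 1 \<in> {1..N}" using n by auto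
      then show ?thesis using R by blast
    qed
    ultimately show ?thesis unfolding rr using mult_le_mono[of 1 "R (n - 1)" 1 "R n"] by simp
  qed
  have GGc: "GG \<in> carrier_mat K rr"
  proof -
    \<comment> \<open>Unfolding the three-way subchain tensor along mode 2 leaves modes 1 and 3, of
      sizes \<open>R n\<close> and \<open>R (n - 1)\<close>, for the columns.\<close>
    have "{1..3} - {2} = {1, 3 :: nat}" by auto
    then show ?thesis
      unfolding GG subchain_mat_def mode_unfold_def by (simp add: subchain_dims_def K rr mult.commute)
  qed
  have XXT: "XX\<^sup>T \<in> carrier_mat K (I n)" unfolding XX mode_unfold_def by (simp add: K)
  have Is: "map I w \<noteq> []" "\<And>i. i \<in> set (map I w) \<Longrightarrow> 0 < i" "length (map I w) \<le> N"
    using N len I set_w by force+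
  have emb: "1 - \<delta> / 2 \<le> measure_pmf.prob P\<Psi> {\<Psi>. embeds \<Psi> GG}" "set_pmf P\<Psi> \<subseteq> carrier_mat J1 K"
    using prob_recursive_sketch_embeds[of J1 "map I w" P\<Psi> N GG rr \<delta>] P Is GGc rr1 \<delta> J1
    unfolding prod by blast+
  let ?good = "{S. \<forall>G'. is_arg_min (\<lambda>G. fro_norm (S * GG * G\<^sup>T - S * XX\<^sup>T)) (\<lambda>G. G \<in> carrier_mat (I n) rr) G' \<longrightarrow>
        fro_norm (GG * G'\<^sup>T - XX\<^sup>T) \<le> (1 + \<epsilon>) * (INF G\<in>carrier_mat (I n) rr. fro_norm (GG * G\<^sup>T - XX\<^sup>T))}"
  \<comment> \<open>The failure probability is shared equally between the embedding and the
    sampling.\<close>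
  have "1 - (\<delta> / 2 + \<delta> / 2) \<le> measure_pmf.prob (bind_pmf P\<Psi> (\<lambda>\<Psi>. sampling_pmf J2 K (q \<Psi>))) ?good"
  proof (rule prob_bind_pmf_ge[OF emb(1)])
    fix \<Psi> assume \<Psi>: "\<Psi> \<in> set_pmf P\<Psi>" "embeds \<Psi> GG"
    then have "\<Psi> \<in> carrier_mat J1 K" "compact_svd (\<Psi> * GG) (U1 \<Psi>) (D1 \<Psi>) (V1 \<Psi>)"
      using emb(2) svd by blast+
    then show "1 - \<delta> / 2 \<le> measure_pmf.prob (sampling_pmf J2 K (q \<Psi>)) ?good"
      unfolding q by (rule prob_sampled_solution[OF \<Psi>(2) _ GGc GG0 _ XXT rr1 \<epsilon> \<delta> J2])
  qed (use \<delta> in auto)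
  then show "1 - \<delta> \<le> measure_pmf.prob (bind_pmf P\<Psi> (\<lambda>\<Psi>. sampling_pmf J2 K (q \<Psi>))) ?good"
    by simp
qed simp

end
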